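(* Let $G$ be a Morse local-to-global group and let $\partial_{*}G$ denote its Morse boundary. (1) The set $\{g^{+} : g\in G \text{ is a Morse element}\}$ of attracting fixed points of Morse elements of $G$ is dense in $\partial_{*}G$. (2) If $H$ is an infinite normal subgroup of $G$, then the limit set $\Lambda_{*}(H)$ of $H$ in $\partial_{*}G$ is all of $\partial_{*}G$.
   Context: All finite generating sets are symmetric. $\mathrm{Cay}(G,A)$ is the Cayley graph (vertices $g\in G$, $g,h$ joined by an edge if $g^{-1}h\in A$, edges of length $1$), and $e$ is the identity. Morse quasi-geodesics: let $X$ be a metric space and $I\subseteq\mathbb{R}$ a closed interval. A map $\gamma:I\to X$ is a $(k,c)$-quasi-geodesic ($k\ge1$, $c\ge0$) if $\frac1k|s-t|-c\le d(\gamma(s),\gamma(t))\le k|s-t|+c$ for all $s,t\in I$; a geodesic is a $(1,0)$-quasi-geodesic. A Morse gauge is a function $M:[1,\infty)\times[0,\infty)\to[0,\infty)$. A quasi-geodesic $\gamma:I\to X$ is $M$-Morse if for every $[s,t]\subseteq I$, every $(k,c)$-quasi-geodesic with endpoints $\gamma(s),\gamma(t)$ is contained in the $M(k,c)$-neighborhood of $\gamma|_{[s,t]}$. An $(M;k,c)$-Morse quasi-geodesic is an $M$-Morse $(k,c)$-quasi-geodesic. For $B\ge0$, $\gamma:I\to X$ is a $(B;M;k,c)$-local Morse quasi-geodesic if $\gamma|_{[s,t]}$ is an $(M;k,c)$-Morse quasi-geodesic for every $[s,t]\subseteq I$ with $|s-t|\le B$. Morse local-to-global: $X$ is a Morse local-to-global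 space if for every Morse gauge $M$ and $k\ge1$, $c\ge0$ there exist $B\ge0$, a Morse gauge $M'$, and $k'\ge1$, $c'\ge0$ such that every $(B;M;k,c)$-local Morse quasi-geodesic is an $(M';k',c')$-Morse quasi-geodesic. A Morse local-to-global group is a finitely generated group some (equivalently, every) Cayley graph of which, with respect to a finite generating set, is a Morse local-to-global space. Stable subgroups and Morse elements: $H\le G$ is $(M,k)$-stable in $\mathrm{Cay}(G,A)$ if for every $h\in H$ every geodesic in $\mathrm{Cay}(G,A)$ from $e$ to $h$ is $M$-Morse and contained in the $k$-neighborhood of $H$; $H$ is stable if for every finite generating set $A$ of $G$ there exist $M$ and $k\ge0$ such that $H$ is $(M,k)$-stable in $\mathrm{Cay}(G,A)$. An element $g\in G$ is Morse if $\langle g\rangle$ is stable. Morse boundary: let $X$ be a proper geodesic metric space with basepoint $e$. As a set $\partial_{*}X_e$ consists of Morse geodesic rays starting at $e$, modulo asymptotic equivalence (bounded Hausdorff distance). For a Morse gauge $M$, $\partial_{*}^{M}X_e$ is the set of classes containing an $M$-Morse geodesic ray based at $e$, with the compact-open topology; equivalently, a neighborhood system at $[\alpha]$ is given by the sets $V_n(\alpha)$, $n\in\mathbb{N}$, of (classes of) $M$-Morse geodesic rays $\gamma$ with $\gamma(0)=e$ and $d(\alpha(t),\gamma(t))<\delta_M$ for all $t<n$, where $\delta_M$ is a constant depending only on $M$. Order Morse gauges by $M\le M'$ iff $M(\lambda,\epsilon)\le M'(\lambda,\epsilon)$ for all $\lambda\ge1,\epsilon\ge0$. Then $\partial_{*}X_e=\varinjlim\partial_{*}^{M}X_e$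 has the direct limit topology: $U$ is open iff $U\cap\partial_{*}^{M}X_e$ is open for all $M$. The Morse boundary $\partial_{*}G$ is the Morse boundary of a Cayley graph of $G$ with respect to a finite generating set, based at $e$ (well defined up to homeomorphism). For $g\in G$, $[e,g]$ denotes a geodesic from $e$ to $g$ in the Cayley graph. For a sequence $g_n\in G$ and $x\in\partial_{*}G$, $[e,g_n]\to x$ means that $[e,g_n]$ converges uniformly on compact subsets to a geodesic ray representing $x$. For a Morse element $g$ (of infinite order), $g^{+}\in\partial_{*}G$ is the limit of the geodesics $[e,g^n]$ as $n\to\infty$, i.e. the class of the geodesic rays from $e$ at bounded Hausdorff distance from $\{g^n:n\ge0\}$. Limit set: $\Lambda_{*}(H)=\{x\in\partial_{*}G : \text{there exist a Morse gauge } M \text{ and } h_n\in H \text{ such that } [e,h_n]\to x \text{ and each } [e,h_n] \text{ is } M\text{-Morse}\}$. *)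

theory Defs
  imports "HOL-Analysis.Analysis" "HOL-Algebra.Generated_Groups"
begin

text \<open>
  The geometric realisation of the simple graph with vertex set \<open>V\<close> and symmetric edge relation
  \<open>E\<close>. A point is given by its barycentric coordinates: the point at distance \<open>t\<close> from \<open>u\<close> on an
  edge of length 1 from \<open>u\<close> to \<open>v\<close> is the function with value \<open>1 - t\<close> at \<open>u\<close> and \<open>t\<close> at \<open>v\<close>,
  and a vertex is the indicator function of itself. Loops, if there are any in \<open>E\<close>, are not
  realised.
\<close>

definition vertex :: "'v \<Rightarrow> 'v \<Rightarrow> real" where
  "vertex u = indicator {u}"

definition edge_point :: "'v \<Rightarrow> 'v \<Rightarrow> real \<Rightarrow> 'v \<Rightarrow> real" where
  "edge_point u v t = (\<lambda>w. (1 - t) * vertex u w + t * vertex v w)"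

definition realization :: "'v set \<Rightarrow> ('v \<times> 'v) set \<Rightarrow> ('v \<Rightarrow> real) set" where
  "realization V E =
     {edge_point u v t | u v t. u \<in> V \<and> v \<in> V \<and> (u = v \<or> (u, v) \<in> E) \<and> 0 \<le> t \<and> t \<le> 1}"

definition support :: "('v \<Rightarrow> real) \<Rightarrow> 'v set" where
  "support p = {w. p w \<noteq> 0}"

definition combinatorial_dist :: "('v \<times> 'v) set \<Rightarrow> 'v \<Rightarrow> 'v \<Rightarrow> nat" where
  "combinatorial_dist E u v = (LEAST n. (u, v) \<in> E ^^ n)"

definition on_common_edge :: "('v \<times> 'v) set \<Rightarrow> ('v \<Rightarrow> real) \<Rightarrow> ('v \<Rightarrow> real) \<Rightarrow> bool" where
  "on_common_edge E p q \<longleftrightarrow>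
     (\<exists>u v. (u = v \<or> (u, v) \<in> E) \<and> support p \<subseteq> {u, v} \<and> support q \<subseteq> {u, v})"

text \<open>
  The path metric. On a single edge the distance is the difference of the edge parameters, which
  is the supremum distance of the barycentric coordinates. Otherwise a shortest path leaves \<open>p\<close>
  through an endpoint \<open>u\<close> of its edge, which is at distance \<open>1 - p u\<close> from \<open>p\<close>, and reaches \<open>q\<close>
  through an endpoint \<open>v\<close> of its edge. (An endpoint that is not in the support is only dropped
  when the point is itself a vertex.) The value 0 outside the realisation is a convention
  required by \<open>Metric_space\<close>.
\<close>

definition route_dist :: "('v \<times> 'v) set \<Rightarrow> ('v \<Rightarrow> real) \<Rightarrow> ('v \<Rightarrow> real) \<Rightarrow> real" where
  "route_dist E p q =
     Min {(1 - p u) + real (combinatorial_dist E u v) + (1 - q v) | u v.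
            u \<in> support p \<and> v \<in> support q}"

definition realization_dist ::
    "'v set \<Rightarrow> ('v \<times> 'v) set \<Rightarrow> ('v \<Rightarrow> real) \<Rightarrow> ('v \<Rightarrow> real) \<Rightarrow> real" where
  "realization_dist V E p q =
     (if p \<in> realization V E \<and> q \<in> realization V E then
        if on_common_edge E p q then (SUP w. \<bar>p w - q w\<bar>) else route_dist E p q
      else 0)"

definition metric_graph :: "'v set \<Rightarrow> ('v \<times> 'v) set \<Rightarrow> ('v \<Rightarrow> real) metric" where
  "metric_graph V E = metric (realization V E, realization_dist V E)"

locale connected_graph =
  fixes V :: "'v set" and E :: "('v \<times> 'v) set"
  assumes wf: "E \<subseteq> V \<times> V"
    and symE: "sym E"
    and conn: "\<And>u v. u \<in> V \<Longrightarrow> v \<in> V \<Longrightarrow> (u, v) \<in> E\<^sup>*"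
begin

abbreviation "gd \<equiv> combinatorial_dist E"
abbreviation "R \<equiv> realization V E"

lemma gd_path: "u \<in> V \<Longrightarrow> v \<in> V \<Longrightarrow> (u, v) \<in> E ^^ gd u v"
  unfolding combinatorial_dist_def
  by (metis LeastI_ex conn rtrancl_power)

lemma gd_le: "(u, v) \<in> E ^^ n \<Longrightarrow> gd u v \<le> n"
  unfolding combinatorial_dist_def by (rule Least_le)

lemma gd_refl [simp]: "gd u u = 0"
  using gd_le[of u u 0] by simp

lemma gd_edge: "(u, v) \<in> E \<Longrightarrow> gd u v \<le> 1"
  by (rule gd_le) simp

lemma gd_eq_0: "u \<in> V \<Longrightarrow> v \<in> V \<Longrightarrow> gd u v = 0 \<Longrightarrow> u = v"
  using gd_path[of u v] by simp

lemma gd_triangle: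
  assumes "u \<in> V" "v \<in> V" "w \<in> V"
  shows "gd u w \<le> gd u v + gd v w"
proof (rule gd_le)
  show "(u, w) \<in> E ^^ (gd u v + gd v w)"
    using gd_path[OF assms(1,2)] gd_path[OF assms(2,3)] by (auto simp: relpow_add)
qed

lemma gd_commute: "gd u v = gd v u"
proof -
  have "(a, b) \<in> E ^^ n \<Longrightarrow> (b, a) \<in> E ^^ n" for a b n
  proof (induction n arbitrary: b)
    case (Suc n)
    then obtain c where "(a, c) \<in> E ^^ n" "(c, b) \<in> E" by auto
    then have "(b, c) \<in> E" "(c, a) \<in> E ^^ n"
      using Suc.IH symE by (auto dest: symD)
    then show ?case by (rule relpow_Suc_I2)
  qed simp
  then have "(u, v) \<in> E ^^ n \<longleftrightarrow> (v, u) \<in> E ^^ n" for n by blast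
  then show ?thesis by (simp add: combinatorial_dist_def)
qed

lemma point_cases:
  assumes "p \<in> R"
  obtains (vertex) u where "u \<in> V" "p = vertex u" "support p = {u}"
  | (edge) u v where "u \<in> V" "v \<in> V" "u \<noteq> v" "(u, v) \<in> E" "support p = {u, v}"
      "p u + p v = 1" "0 < p u" "0 < p v"
proof -
  obtain u v t where *: "u \<in> V" "v \<in> V" "u = v \<or> (u, v) \<in> E" "0 \<le> t" "t \<le> 1"
    and p: "p = edge_point u v t"
    using assms by (auto simp: realization_def)
  consider "u = v \<or> t = 0" | "t = 1" | "u \<noteq> v" "0 < t" "t < 1" using * by linarith
  then show thesis
  proof cases
    case 1
    then have "p = vertex u" by (auto simp: p edge_point_def algebra_simps)
    then show ?thesis using vertex[of u] * by (auto simp: support_def vertex_def indicator_def)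
  next
    case 2
    then have "p = vertex v" by (auto simp: p edge_point_def)
    then show ?thesis using vertex[of v] * by (auto simp: support_def vertex_def indicator_def)
  next
    case 3
    then have uv: "p u = 1 - t" "p v = t"
      by (auto simp: p edge_point_def vertex_def)
    have "p w = 0" if "w \<noteq> u" "w \<noteq> v" for w
      using that by (simp add: p edge_point_def vertex_def)
    then have "support p = {u, v}" using uv 3 by (auto simp: support_def)
    then show ?thesis using edge[of u v] * uv 3 by auto
  qed
qed

lemma finite_support: "p \<in> R \<Longrightarrow> finite (support p)"
  by (erule point_cases) auto

lemma support_nonempty: "p \<in> R \<Longrightarrow> support p \<noteq> {}"
  by (erule point_cases) auto

lemma support_V: "p \<in> R \<Longrightarrow> u \<in> support p \<Longrightarrow> u \<in> V"
  by (erule point_cases) auto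

lemma point_outside: "w \<notin> support p \<Longrightarrow> p w = (0::real)"
  by (simp add: support_def)

lemma point_bounds:
  assumes "p \<in> R"
  shows "0 \<le> p w" "p w \<le> 1"
proof -
  from assms have "0 \<le> p w \<and> p w \<le> 1"
  proof (cases rule: point_cases)
    case (edge u v)
    then show ?thesis using point_outside[of w p] by (cases "w = u"; cases "w = v") auto
  qed (simp_all add: vertex_def indicator_def)
  then show "0 \<le> p w" "p w \<le> 1" by auto
qed

lemma point_sum:
  assumes "p \<in> R" "support p \<subseteq> {u, v}" "u \<noteq> v"
  shows "p u + p v = 1"
  using assms(1)
proof (cases rule: point_cases)
  case (vertex a)
  then have "a = u \<or> a = v" using assms(2) by simp
  then show ?thesis using assms(3) by (auto simp: vertex(2) vertex_def)
next
  case (edge a b)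
  then have "{a, b} = {u, v}" using assms(2,3) by auto
  then show ?thesis using edge by (auto simp: doubleton_eq_iff)
qed

lemma point_single: "p \<in> R \<Longrightarrow> support p \<subseteq> {u} \<Longrightarrow> p = vertex u"
  by (erule point_cases) auto

lemma support_pair:
  assumes "p \<in> R" "u \<in> support p" "v \<in> support p" "u \<noteq> v"
  shows "support p = {u, v}" "p u + p v = 1" "(u, v) \<in> E"
proof -
  from assms(1) have "support p = {u, v} \<and> p u + p v = 1 \<and> (u, v) \<in> E"
  proof (cases rule: point_cases)
    case (vertex a)
    then show ?thesis using assms by auto
  next
    case (edge a b)
    then have "a = u \<and> b = v \<or> a = v \<and> b = u" using assms by auto
    then show ?thesis using edge symE by (auto dest: symD)
  qed
  then show "support p = {u, v}" "p u + p v = 1" "(u, v) \<in> E" by auto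
qed

definition "sd p q = (SUP w. \<bar>p w - q w\<bar>)" for p q :: "'v \<Rightarrow> real"

lemma bdd: assumes "p \<in> R" "q \<in> R" shows "bdd_above (range (\<lambda>w. \<bar>p w - q w\<bar>))"
proof (rule bdd_aboveI2)
  show "\<bar>p w - q w\<bar> \<le> 1" for w
    using point_bounds[OF assms(1), of w] point_bounds[OF assms(2), of w] by linarith
qed

lemma sd_upper: "p \<in> R \<Longrightarrow> q \<in> R \<Longrightarrow> \<bar>p w - q w\<bar> \<le> sd p q"
  unfolding sd_def by (rule cSUP_upper[OF _ bdd]) auto

lemma sd_least: "(\<And>w. \<bar>p w - q w\<bar> \<le> c) \<Longrightarrow> sd p q \<le> c"
  unfolding sd_def by (rule cSUP_least) auto

lemma sd_nonneg: "p \<in> R \<Longrightarrow> q \<in> R \<Longrightarrow> 0 \<le> sd p q"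
  using sd_upper[of p q undefined] by linarith

lemma sd_le_1: assumes "p \<in> R" "q \<in> R" shows "sd p q \<le> 1"
proof (rule sd_least)
  show "\<bar>p w - q w\<bar> \<le> 1" for w
    using point_bounds[OF assms(1), of w] point_bounds[OF assms(2), of w] by linarith
qed

lemma sd_commute: "sd p q = sd q p"
  unfolding sd_def by (simp add: abs_minus_commute)

lemma sd_triangle:
  assumes "p \<in> R" "q \<in> R" "r \<in> R"
  shows "sd p r \<le> sd p q + sd q r"
proof (rule sd_least)
  show "\<bar>p w - r w\<bar> \<le> sd p q + sd q r" for w
    using sd_upper[OF assms(1,2), of w] sd_upper[OF assms(2,3), of w] by linarith
qed

definition "rt p q u v = (1 - p u) + real (gd u v) + (1 - q v)" for p q :: "'v \<Rightarrow> real"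

lemma route_eq:
  "route_dist E p q = Min ((\<lambda>(u, v). rt p q u v) ` (support p \<times> support q))"
proof -
  have "{rt p q u v | u v. u \<in> support p \<and> v \<in> support q}
      = (\<lambda>(u, v). rt p q u v) ` (support p \<times> support q)"
    by auto
  then show ?thesis by (simp add: route_dist_def rt_def)
qed

lemma route_le:
  assumes "p \<in> R" "q \<in> R" "u \<in> support p" "v \<in> support q"
  shows "route_dist E p q \<le> rt p q u v"
  unfolding route_eq using assms by (intro Min_le) (auto intro: finite_support)

lemma route_attained:
  assumes "p \<in> R" "q \<in> R"
  obtains u v where "u \<in> support p" "v \<in> support q" "route_dist E p q = rt p q u v"
proof -
  have "route_dist E p q \<in> (\<lambda>(u, v). rt p q u v) ` (support p \<times> support q)"
    unfolding route_eq using assms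
    by (intro Min_in) (auto intro: finite_support simp: support_nonempty)
  then show thesis using that by auto
qed

lemma route_commute:
  assumes "p \<in> R" "q \<in> R"
  shows "route_dist E p q = route_dist E q p"
proof -
  have le: "route_dist E a b \<le> route_dist E b a" if ab: "a \<in> R" "b \<in> R" for a b
  proof -
    obtain u v where "u \<in> support b" "v \<in> support a" "route_dist E b a = rt b a u v"
      using route_attained[OF ab(2,1)] .
    then show ?thesis using route_le[OF ab, of v u] gd_commute[of u v]
      by (simp add: rt_def)
  qed
  show ?thesis using le assms by (intro antisym) auto
qed

lemma route_nonneg:
  assumes "p \<in> R" "q \<in> R" shows "0 \<le> route_dist E p q"
proof -
  obtain u v where "route_dist E p q = rt p q u v" using route_attained[OF assms] .
  then show ?thesis
    using point_bounds(2)[OF assms(1), of u] point_bounds(2)[OF assms(2), of v]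
    by (simp add: rt_def)
qed

lemma route_triangle:
  assumes "p \<in> R" "q \<in> R" "r \<in> R"
  shows "route_dist E p r \<le> route_dist E p q + route_dist E q r"
proof -
  obtain u v where 1: "u \<in> support p" "v \<in> support q" "route_dist E p q = rt p q u v"
    using route_attained[OF assms(1,2)] .
  obtain v' w where 2: "v' \<in> support q" "w \<in> support r" "route_dist E q r = rt q r v' w"
    using route_attained[OF assms(2,3)] .
  have V: "u \<in> V" "v \<in> V" "v' \<in> V" "w \<in> V"
    using 1 2 support_V assms by blast+
  have "real (gd v v') \<le> (1 - q v) + (1 - q v')"
  proof (cases "v = v'")
    case True
    then show ?thesis using point_bounds(2)[OF assms(2), of v] by simp
  next
    case False
    from support_pair[OF assms(2) 1(2) 2(1) False] gd_edge[of v v'] show ?thesis by auto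
  qed
  moreover have "gd u w \<le> gd u v + gd v v' + gd v' w"
    using gd_triangle[OF V(1,2,4)] gd_triangle[OF V(2,3,4)] by linarith
  then have "real (gd u w) \<le> real (gd u v) + real (gd v v') + real (gd v' w)"
    by (metis of_nat_add of_nat_mono)
  ultimately show ?thesis
    using route_le[OF assms(1,3) 1(1) 2(2)] 1(3) 2(3) by (simp add: rt_def)
qed

lemma common_commute: "on_common_edge E p q = on_common_edge E q p"
  unfolding on_common_edge_def by blast

lemma common_V:
  assumes "p \<in> R" "on_common_edge E p q"
  obtains u v where "u = v \<or> (u, v) \<in> E" "support p \<subseteq> {u, v}" "support q \<subseteq> {u, v}"
    "u \<in> V" "v \<in> V" "u \<in> support p"
proof -
  obtain u v where *: "u = v \<or> (u, v) \<in> E" "support p \<subseteq> {u, v}" "support q \<subseteq> {u, v}"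
    using assms(2) by (auto simp: on_common_edge_def)
  obtain a where a: "a \<in> support p" using support_nonempty[OF assms(1)] by blast
  have aV: "a \<in> V" using a support_V assms(1) by blast
  have "u \<in> V" "v \<in> V" using * a aV wf by auto
  moreover have "a = u \<or> a = v" using a * by auto
  ultimately show thesis using that[of u v] that[of v u] * a symE by (auto dest: symD)
qed

lemma sd_le_route:
  assumes "p \<in> R" "q \<in> R" "on_common_edge E p q"
  shows "sd p q \<le> route_dist E p q"
proof -
  obtain a b where ab: "a \<in> support p" "b \<in> support q" "route_dist E p q = rt p q a b"
    using route_attained[OF assms(1,2)] .
  note bounds = point_bounds[OF assms(1)] point_bounds[OF assms(2)]
  show ?thesis
  proof (cases "a = b")
    case False
    then have "gd a b \<noteq> 0" using gd_eq_0 ab support_V assms by blast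
    then have "1 \<le> real (gd a b)" by linarith
    then show ?thesis
      using sd_le_1[OF assms(1,2)] ab(3) bounds(2)[of a] bounds(4)[of b] by (simp add: rt_def)
  next
    case True
    obtain u v where uv: "support p \<subseteq> {u, v}" "support q \<subseteq> {u, v}"
      using common_V[OF assms(1,3)] by metis
    have "\<bar>p w - q w\<bar> \<le> 2 - p a - q a" for w
    proof (cases "w \<in> {u, v}")
      case False
      then have "p w = 0" "q w = 0" using uv by (auto intro: point_outside)
      then show ?thesis using bounds(2)[of a] bounds(4)[of a] by simp
    next
      case w: True
      show ?thesis
      proof (cases "w = a")
        case True
        then show ?thesis using bounds(2)[of a] bounds(4)[of a] by (simp add: abs_le_iff)
      next
        case False
        then have "{u, v} = {a, w}" using w ab(1) uv(1) by auto
        then have "p a + p w = 1" "q a + q w = 1"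
          using point_sum[OF assms(1), of a w] point_sum[OF assms(2), of a w] uv False by auto
        then show ?thesis using bounds(1)[of w] bounds(3)[of w] by linarith
      qed
    qed
    then have "sd p q \<le> 2 - p a - q a" by (rule sd_least)
    then show ?thesis using ab(3) True by (simp add: rt_def)
  qed
qed

lemma route_le_sd:
  assumes "p \<in> R" "support q = {x}" "q \<in> R" "on_common_edge E p q"
  shows "route_dist E p q \<le> sd p q"
proof -
  have q: "q = vertex x" using assms point_single by blast
  show ?thesis
  proof (cases "x \<in> support p")
    case True
    have "1 - p x \<le> sd p q"
      using sd_upper[OF assms(1,3), of x] q by (simp add: vertex_def)
    then show ?thesis using route_le[OF assms(1,3) True, of x] assms(2) q
      by (simp add: rt_def vertex_def)
  next
    case False
    obtain u v where uv: "u = v \<or> (u, v) \<in> E" "support p \<subseteq> {u, v}" "support q \<subseteq> {u, v}"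
      "u \<in> support p"
      using common_V[OF assms(1,4)] by metis
    then have v: "v = x" "u \<noteq> x" and sp: "support p \<subseteq> {u}" using False assms(2) by auto
    have "p = vertex u" using point_single[OF assms(1) sp] .
    moreover have "1 \<le> sd p q"
      using sd_upper[OF assms(1,3), of x] q point_outside[OF False] by (simp add: vertex_def)
    moreover have "real (gd u x) \<le> 1" using gd_edge[of u x] uv v by auto
    ultimately show ?thesis using route_le[OF assms(1,3) uv(4), of x] assms(2) q
      by (simp add: rt_def vertex_def)
  qed
qed

lemma route_le_sd_route:
  assumes "p \<in> R" "q \<in> R" "r \<in> R" "on_common_edge E p q"
  shows "route_dist E p r \<le> sd p q + route_dist E q r"
proof -
  obtain v w where vw: "v \<in> support q" "w \<in> support r" "route_dist E q r = rt q r v w"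
    using route_attained[OF assms(2,3)] .
  show ?thesis
  proof (cases "v \<in> support p")
    case True
    then show ?thesis
      using route_le[OF assms(1,3) True vw(2)] vw(3) sd_upper[OF assms(1,2), of v]
      by (simp add: rt_def)
  next
    case False
    obtain a b where ab: "a = b \<or> (a, b) \<in> E" "support p \<subseteq> {a, b}" "support q \<subseteq> {a, b}"
      "a \<in> support p" "a \<in> V" "b \<in> V"
      using common_V[OF assms(1,4)] by metis
    then have b: "b = v" "a \<noteq> v" and "support p \<subseteq> {a}" using False vw(1) by auto
    then have p: "p = vertex a" using point_single[OF assms(1)] by blast
    have "q v \<le> sd p q"
      using sd_upper[OF assms(1,2), of v] point_outside[OF False] by simp
    moreover have "real (gd a w) \<le> 1 + real (gd v w)"
      using gd_triangle[of a v w] gd_edge[of a v] ab b support_V[OF assms(3) vw(2)] by auto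
    ultimately show ?thesis
      using route_le[OF assms(1,3) ab(4) vw(2)] vw(3) p by (simp add: rt_def vertex_def)
  qed
qed

lemma rdist_eq:
  "p \<in> R \<Longrightarrow> q \<in> R \<Longrightarrow>
     realization_dist V E p q = (if on_common_edge E p q then sd p q else route_dist E p q)"
  by (simp add: realization_dist_def sd_def)

lemma rdist_le_route:
  "p \<in> R \<Longrightarrow> q \<in> R \<Longrightarrow> realization_dist V E p q \<le> route_dist E p q"
  by (simp add: rdist_eq sd_le_route)

lemma Metric_space_realization: "Metric_space R (realization_dist V E)"
proof
  show "0 \<le> realization_dist V E p q" for p q
    by (cases "p \<in> R \<and> q \<in> R")
      (auto simp: rdist_eq sd_nonneg route_nonneg, auto simp: realization_dist_def)
  show "realization_dist V E p q = realization_dist V E q p" for p q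
    by (cases "p \<in> R \<and> q \<in> R")
      (auto simp: rdist_eq sd_commute route_commute common_commute[of p q],
       auto simp: realization_dist_def)
next
  fix p q assume p: "p \<in> R" and q: "q \<in> R"
  show "realization_dist V E p q = 0 \<longleftrightarrow> p = q"
  proof
    assume "p = q"
    moreover have "on_common_edge E p p"
      using p by (cases rule: point_cases) (auto simp: on_common_edge_def)
    ultimately show "realization_dist V E p q = 0"
      using p by (simp add: rdist_eq sd_def)
  next
    assume 0: "realization_dist V E p q = 0"
    show "p = q"
    proof (cases "on_common_edge E p q")
      case True
      then have "sd p q = 0" using 0 p q by (simp add: rdist_eq)
      then have "\<bar>p w - q w\<bar> \<le> 0" for w using sd_upper[OF p q] by metis
      then show ?thesis by auto
    next
      case False
      obtain u v where uv: "u \<in> support p" "v \<in> support q" "route_dist E p q = rt p q u v"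
        using route_attained[OF p q] .
      have "rt p q u v = 0" using 0 p q uv False by (simp add: rdist_eq)
      then have *: "p u = 1" "q v = 1" "gd u v = 0"
        using point_bounds(2)[OF p, of u] point_bounds(2)[OF q, of v] by (auto simp: rt_def)
      have "u = v" using *(3) gd_eq_0 uv support_V p q by blast
      have single: "support r \<subseteq> {x}" if r: "r \<in> R" "r x = 1" for r x
      proof
        fix y assume y: "y \<in> support r"
        have x: "x \<in> support r" using r by (simp add: support_def)
        show "y \<in> {x}"
          using support_pair(2)[OF r(1) x y] r(2) y by (auto simp: support_def)
      qed
      show ?thesis
        using point_single[OF p single[OF p *(1)]] point_single[OF q single[OF q *(2)]] \<open>u = v\<close>
        by simp
    qed
  qed
next
  fix p q r assume p: "p \<in> R" and q: "q \<in> R" and r: "r \<in> R"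
  let ?d = "realization_dist V E"
  show "?d p r \<le> ?d p q + ?d q r"
  proof (cases "on_common_edge E p q")
    case pq: True
    show ?thesis
    proof (cases "on_common_edge E q r")
      case qr: True
      show ?thesis
      proof (cases "on_common_edge E p r")
        case True
        then show ?thesis using pq qr p q r by (simp add: rdist_eq sd_triangle)
      next
        case pr: False
        from q show ?thesis
        proof (cases rule: point_cases)
          case (vertex x)
          have "?d p r \<le> route_dist E p q + route_dist E q r"
            using pr p q r by (simp add: rdist_eq route_triangle)
          also have "route_dist E p q \<le> sd p q"
            using route_le_sd[OF p vertex(3) q pq] .
          also have "route_dist E q r \<le> sd q r"
            using route_le_sd[OF r vertex(3) q] qr common_commute route_commute[OF q r]
              sd_commute[of q r] by metis
          finally show ?thesis using pq qr p q r by (simp add: rdist_eq)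
        next
          case (edge a b)
          obtain u v where 1: "support p \<subseteq> {u, v}" "support q \<subseteq> {u, v}"
            using common_V[OF p pq] by metis
          obtain u' v' where 2: "support q \<subseteq> {u', v'}" "support r \<subseteq> {u', v'}"
            using common_V[OF q qr] by metis
          have "{u, v} = {a, b}" "{u', v'} = {a, b}" using 1 2 edge by auto
          then have "on_common_edge E p r"
            using 1 2 edge(4) unfolding on_common_edge_def by auto
          then show ?thesis using pr by simp
        qed
      qed
    next
      case False
      have "?d p r \<le> sd p q + route_dist E q r"
        using rdist_le_route[OF p r] route_le_sd_route[OF p q r pq] by linarith
      then show ?thesis using False pq p q r by (simp add: rdist_eq)
    qed
  next
    case pq: False
    show ?thesis
    proof (cases "on_common_edge E q r")
      case True
      have "route_dist E r p \<le> sd r q + route_dist E q p"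
        using route_le_sd_route[OF r q p] True common_commute by metis
      then have "route_dist E p r \<le> route_dist E p q + sd q r"
        using route_commute p q r sd_commute by (metis add.commute)
      then show ?thesis using rdist_le_route[OF p r] True pq p q r by (simp add: rdist_eq)
    next
      case False
      then show ?thesis
        using rdist_le_route[OF p r] route_triangle[OF p q r] pq p q r by (simp add: rdist_eq)
    qed
  qed
qed

lemma mspace_metric_graph: "mspace (metric_graph V E) = realization V E"
  and mdist_metric_graph: "mdist (metric_graph V E) = realization_dist V E"
  using Metric_space_realization
  by (simp_all add: metric_graph_def Metric_space.mspace_metric Metric_space.mdist_metric)

lemma mdist_vertex:
  assumes "u \<in> V" "v \<in> V"
  shows "mdist (metric_graph V E) (vertex u) (vertex v) = real (combinatorial_dist E u v)"
proof -
  have in_R: "vertex x \<in> R" if "x \<in> V" for x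
  proof -
    have "vertex x = edge_point x x 0" by (simp add: edge_point_def)
    then show ?thesis using that unfolding realization_def by force
  qed
  have supp: "support (vertex x) = {x}" for x :: 'v
    by (auto simp: support_def vertex_def indicator_def)
  note uv = in_R[OF assms(1)] in_R[OF assms(2)]
  have "route_dist E (vertex u) (vertex v) = real (gd u v)"
    by (simp add: route_eq supp) (simp add: rt_def vertex_def)
  moreover have "sd (vertex u) (vertex v) = route_dist E (vertex u) (vertex v)"
    if "on_common_edge E (vertex u) (vertex v)"
    using route_le_sd[OF uv(1) supp uv(2) that] sd_le_route[OF uv that] by simp
  ultimately show ?thesis using uv by (simp add: mdist_metric_graph rdist_eq)
qed

end

definition finite_generating_set :: "('g, 'm) monoid_scheme \<Rightarrow> 'g set \<Rightarrow> bool" where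
  "finite_generating_set G A \<longleftrightarrow>
     finite A \<and> A \<subseteq> carrier G \<and> (\<forall>a\<in>A. inv\<^bsub>G\<^esub> a \<in> A) \<and> generate G A = carrier G"

definition cayley_edges :: "('g, 'm) monoid_scheme \<Rightarrow> 'g set \<Rightarrow> ('g \<times> 'g) set" where
  "cayley_edges G A = {(g, h). g \<in> carrier G \<and> h \<in> carrier G \<and> inv\<^bsub>G\<^esub> g \<otimes>\<^bsub>G\<^esub> h \<in> A}"

definition cayley_graph :: "('g, 'm) monoid_scheme \<Rightarrow> 'g set \<Rightarrow> ('g \<Rightarrow> real) metric" where
  "cayley_graph G A = metric_graph (carrier G) (cayley_edges G A)"

lemma connected_graph_cayley:
  fixes G (structure)
  assumes "group G" "finite_generating_set G A"
  shows "connected_graph (carrier G) (cayley_edges G A)"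
proof -
  interpret group G by fact
  have A: "A \<subseteq> carrier G" "\<And>a. a \<in> A \<Longrightarrow> inv a \<in> A" "generate G A = carrier G"
    using assms(2) by (auto simp: finite_generating_set_def)
  let ?E = "cayley_edges G A"
  have sym: "sym ?E"
  proof (rule symI)
    fix g h assume "(g, h) \<in> ?E"
    then have gh: "g \<in> carrier G" "h \<in> carrier G" "inv g \<otimes> h \<in> A"
      by (auto simp: cayley_edges_def)
    then have "inv (inv g \<otimes> h) = inv h \<otimes> g" by (simp add: inv_mult_group)
    then show "(h, g) \<in> ?E" using gh A(2)[OF gh(3)] by (simp add: cayley_edges_def)
  qed
  have edge: "(k \<otimes> g, k \<otimes> h) \<in> ?E" if k: "k \<in> carrier G" and gh: "(g, h) \<in> ?E" for k g h
  proof -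
    have c: "g \<in> carrier G" "h \<in> carrier G" "inv g \<otimes> h \<in> A"
      using gh by (auto simp: cayley_edges_def)
    have "inv k \<otimes> (k \<otimes> h) = h"
      using c(2) k m_assoc[of "inv k" k h] by simp
    then have "inv (k \<otimes> g) \<otimes> (k \<otimes> h) = inv g \<otimes> h"
      using c(1,2) k by (simp add: inv_mult_group m_assoc)
    then show ?thesis using c k by (simp add: cayley_edges_def)
  qed
  have trans: "(k \<otimes> g, k \<otimes> h) \<in> ?E\<^sup>*" if k: "k \<in> carrier G" and gh: "(g, h) \<in> ?E\<^sup>*" for k g h
    using gh by induction (auto intro: rtrancl_into_rtrancl edge[OF k])
  have gen: "(\<one>, x) \<in> ?E\<^sup>*" if "x \<in> generate G A" for x
    using that
  proof induction
    case one then show ?case by simp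
  next
    case (incl h)
    then have "(\<one>, h) \<in> ?E" using A(1) by (auto simp: cayley_edges_def)
    then show ?case by (rule r_into_rtrancl)
  next
    case (inv h)
    then have "inv h \<in> A" "inv h \<in> carrier G" using A by auto
    then have "(\<one>, inv h) \<in> ?E" by (auto simp: cayley_edges_def)
    then show ?case by (rule r_into_rtrancl)
  next
    case (eng h1 h2)
    then have "h1 \<in> carrier G" using A(3) by simp
    from trans[OF this eng.IH(2)] eng.IH(1) this show ?case by simp
  qed
  show ?thesis
  proof
    show "?E \<subseteq> carrier G \<times> carrier G" by (auto simp: cayley_edges_def)
    show "sym ?E" by fact
    fix u v assume uv: "u \<in> carrier G" "v \<in> carrier G"
    have "(u, \<one>) \<in> ?E\<^sup>*"
      using symD[OF sym_rtrancl[OF sym], of \<one> u] gen[of u] uv(1) A(3) by simp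
    moreover have "(\<one>, v) \<in> ?E\<^sup>*" using gen[of v] uv(2) A(3) by simp
    ultimately show "(u, v) \<in> ?E\<^sup>*" by simp
  qed
qed

lemma mspace_cayley_graph:
  assumes "group G" "finite_generating_set G A"
  shows "mspace (cayley_graph G A) = realization (carrier G) (cayley_edges G A)"
  unfolding cayley_graph_def
  using connected_graph.mspace_metric_graph[OF connected_graph_cayley[OF assms]] .

lemma mdist_cayley_graph:
  assumes "group G" "finite_generating_set G A"
  shows "mdist (cayley_graph G A) = realization_dist (carrier G) (cayley_edges G A)"
  unfolding cayley_graph_def
  using connected_graph.mdist_metric_graph[OF connected_graph_cayley[OF assms]] .

definition nbhd :: "'p metric \<Rightarrow> real \<Rightarrow> 'p set \<Rightarrow> 'p set" where
  "nbhd X r S = {x \<in> mspace X. \<exists>y\<in>S. mdist X x y \<le> r}"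

definition quasi_geodesic ::
    "'p metric \<Rightarrow> real \<Rightarrow> real \<Rightarrow> real set \<Rightarrow> (real \<Rightarrow> 'p) \<Rightarrow> bool" where
  "quasi_geodesic X k c I \<gamma> \<longleftrightarrow>
     k \<ge> 1 \<and> c \<ge> 0 \<and> closed I \<and> is_interval I \<and> \<gamma> \<in> I \<rightarrow> mspace X \<and>
     (\<forall>s\<in>I. \<forall>t\<in>I. 1 / k * \<bar>s - t\<bar> - c \<le> mdist X (\<gamma> s) (\<gamma> t) \<and>
                    mdist X (\<gamma> s) (\<gamma> t) \<le> k * \<bar>s - t\<bar> + c)"

abbreviation geodesic :: "'p metric \<Rightarrow> real set \<Rightarrow> (real \<Rightarrow> 'p) \<Rightarrow> bool" where
  "geodesic X \<equiv> quasi_geodesic X 1 0"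

text \<open>
  A Morse gauge is a function on \<open>[1,\<infinity>) \<times> [0,\<infinity>)\<close>; its values elsewhere are never used.
\<close>

definition morse_gauge :: "(real \<Rightarrow> real \<Rightarrow> real) \<Rightarrow> bool" where
  "morse_gauge M \<longleftrightarrow> (\<forall>k\<ge>1. \<forall>c\<ge>0. M k c \<ge> 0)"

definition morse :: "'p metric \<Rightarrow> (real \<Rightarrow> real \<Rightarrow> real) \<Rightarrow> real set \<Rightarrow> (real \<Rightarrow> 'p) \<Rightarrow> bool" where
  "morse X M I \<gamma> \<longleftrightarrow>
     (\<forall>s t. s \<le> t \<and> {s..t} \<subseteq> I \<longrightarrow>
        (\<forall>k c a b \<sigma>. a \<le> b \<and> quasi_geodesic X k c {a..b} \<sigma> \<and> \<sigma> a = \<gamma> s \<and> \<sigma> b = \<gamma> t \<longrightarrow>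
           \<sigma> ` {a..b} \<subseteq> nbhd X (M k c) (\<gamma> ` {s..t})))"

definition morse_quasi_geodesic ::
    "'p metric \<Rightarrow> (real \<Rightarrow> real \<Rightarrow> real) \<Rightarrow> real \<Rightarrow> real \<Rightarrow> real set \<Rightarrow> (real \<Rightarrow> 'p) \<Rightarrow> bool" where
  "morse_quasi_geodesic X M k c I \<gamma> \<longleftrightarrow> quasi_geodesic X k c I \<gamma> \<and> morse X M I \<gamma>"

definition local_morse_quasi_geodesic ::
    "'p metric \<Rightarrow> real \<Rightarrow> (real \<Rightarrow> real \<Rightarrow> real) \<Rightarrow> real \<Rightarrow> real \<Rightarrow> real set \<Rightarrow> (real \<Rightarrow> 'p) \<Rightarrow> bool"
  where
  "local_morse_quasi_geodesic X B M k c I \<gamma> \<longleftrightarrow>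
     closed I \<and> is_interval I \<and> \<gamma> \<in> I \<rightarrow> mspace X \<and>
     (\<forall>s t. s \<le> t \<and> {s..t} \<subseteq> I \<and> \<bar>s - t\<bar> \<le> B \<longrightarrow> morse_quasi_geodesic X M k c {s..t} \<gamma>)"

definition morse_local_to_global_space :: "'p metric \<Rightarrow> bool" where
  "morse_local_to_global_space X \<longleftrightarrow>
     (\<forall>M k c. morse_gauge M \<and> k \<ge> 1 \<and> c \<ge> 0 \<longrightarrow>
        (\<exists>B M' k' c'. B \<ge> 0 \<and> morse_gauge M' \<and> k' \<ge> 1 \<and> c' \<ge> 0 \<and>
           (\<forall>I \<gamma>. local_morse_quasi_geodesic X B M k c I \<gamma> \<longrightarrow>
                  morse_quasi_geodesic X M' k' c' I \<gamma>)))"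

definition morse_local_to_global_group :: "('g, 'm) monoid_scheme \<Rightarrow> bool" where
  "morse_local_to_global_group G \<longleftrightarrow>
     group G \<and>
     (\<exists>A. finite_generating_set G A \<and> morse_local_to_global_space (cayley_graph G A))"

definition geodesic_segment ::
    "'p metric \<Rightarrow> real \<Rightarrow> (real \<Rightarrow> 'p) \<Rightarrow> 'p \<Rightarrow> 'p \<Rightarrow> bool" where
  "geodesic_segment X l \<gamma> p q \<longleftrightarrow> l \<ge> 0 \<and> geodesic X {0..l} \<gamma> \<and> \<gamma> 0 = p \<and> \<gamma> l = q"

definition stable_in_cayley ::
    "('g, 'm) monoid_scheme \<Rightarrow> 'g set \<Rightarrow> (real \<Rightarrow> real \<Rightarrow> real) \<Rightarrow> real \<Rightarrow> 'g set \<Rightarrow> bool" where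
  "stable_in_cayley G A M k H \<longleftrightarrow>
     (\<forall>h\<in>H. \<forall>l \<gamma>. geodesic_segment (cayley_graph G A) l \<gamma> (vertex \<one>\<^bsub>G\<^esub>) (vertex h) \<longrightarrow>
        morse (cayley_graph G A) M {0..l} \<gamma> \<and>
        \<gamma> ` {0..l} \<subseteq> nbhd (cayley_graph G A) k (vertex ` H))"

definition stable_subgroup :: "('g, 'm) monoid_scheme \<Rightarrow> 'g set \<Rightarrow> bool" where
  "stable_subgroup G H \<longleftrightarrow>
     subgroup H G \<and>
     (\<forall>A. finite_generating_set G A \<longrightarrow>
        (\<exists>M k. morse_gauge M \<and> k \<ge> 0 \<and> stable_in_cayley G A M k H))"

definition morse_element :: "('g, 'm) monoid_scheme \<Rightarrow> 'g \<Rightarrow> bool" where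
  "morse_element G g \<longleftrightarrow> g \<in> carrier G \<and> stable_subgroup G (generate G {g})"

text \<open>Rays are genuine maps on \<open>[0,\<infinity>)\<close>, that is, extensional functions.\<close>

definition geodesic_rays :: "'p metric \<Rightarrow> 'p \<Rightarrow> (real \<Rightarrow> 'p) set" where
  "geodesic_rays X e = {\<gamma> \<in> {0..} \<rightarrow>\<^sub>E mspace X. geodesic X {0..} \<gamma> \<and> \<gamma> 0 = e}"

definition morse_rays_of_gauge ::
    "'p metric \<Rightarrow> 'p \<Rightarrow> (real \<Rightarrow> real \<Rightarrow> real) \<Rightarrow> (real \<Rightarrow> 'p) set" where
  "morse_rays_of_gauge X e M = {\<gamma> \<in> geodesic_rays X e. morse X M {0..} \<gamma>}"

definition morse_rays :: "'p metric \<Rightarrow> 'p \<Rightarrow> (real \<Rightarrow> 'p) set" where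
  "morse_rays X e = (\<Union>M\<in>Collect morse_gauge. morse_rays_of_gauge X e M)"

definition bounded_hausdorff_dist :: "'p metric \<Rightarrow> 'p set \<Rightarrow> 'p set \<Rightarrow> bool" where
  "bounded_hausdorff_dist X S T \<longleftrightarrow> (\<exists>r\<ge>0. S \<subseteq> nbhd X r T \<and> T \<subseteq> nbhd X r S)"

definition asymptotic :: "'p metric \<Rightarrow> 'p \<Rightarrow> ((real \<Rightarrow> 'p) \<times> (real \<Rightarrow> 'p)) set" where
  "asymptotic X e =
     {(\<alpha>, \<beta>). \<alpha> \<in> morse_rays X e \<and> \<beta> \<in> morse_rays X e \<and>
              bounded_hausdorff_dist X (\<alpha> ` {0..}) (\<beta> ` {0..})}"

definition morse_boundary_set :: "'p metric \<Rightarrow> 'p \<Rightarrow> (real \<Rightarrow> 'p) set set" where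
  "morse_boundary_set X e = morse_rays X e // asymptotic X e"

definition boundary_stratum ::
    "'p metric \<Rightarrow> 'p \<Rightarrow> (real \<Rightarrow> real \<Rightarrow> real) \<Rightarrow> (real \<Rightarrow> 'p) set set" where
  "boundary_stratum X e M =
     {x \<in> morse_boundary_set X e. \<exists>\<gamma>\<in>x. \<gamma> \<in> morse_rays_of_gauge X e M}"

definition compact_open_topology ::
    "'p metric \<Rightarrow> (real \<Rightarrow> 'p) set \<Rightarrow> (real \<Rightarrow> 'p) topology" where
  "compact_open_topology X F =
     topology_generated_by
       {{\<gamma> \<in> F. \<gamma> ` K \<subseteq> U} | K U. compact K \<and> K \<subseteq> {0..} \<and> openin (mtopology_of X) U}"

text \<open>
  The compact-open topology on a stratum is the quotient topology of the compact-open topology on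
  the \<open>M\<close>-Morse rays representing its points.
\<close>

definition stratum_topology ::
    "'p metric \<Rightarrow> 'p \<Rightarrow> (real \<Rightarrow> real \<Rightarrow> real) \<Rightarrow> (real \<Rightarrow> 'p) set topology" where
  "stratum_topology X e M =
     topology (\<lambda>U. U \<subseteq> boundary_stratum X e M \<and>
       openin (compact_open_topology X (morse_rays_of_gauge X e M))
         {\<gamma> \<in> morse_rays_of_gauge X e M. asymptotic X e `` {\<gamma>} \<in> U})"

definition morse_boundary :: "'p metric \<Rightarrow> 'p \<Rightarrow> (real \<Rightarrow> 'p) set topology" where
  "morse_boundary X e =
     topology (\<lambda>U. U \<subseteq> morse_boundary_set X e \<and>
       (\<forall>M. morse_gauge M \<longrightarrow> openin (stratum_topology X e M) (U \<inter> boundary_stratum X e M)))"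

lemma nbhd_trans:
  assumes "S \<subseteq> nbhd X r T" "T \<subseteq> nbhd X r' U" "U \<subseteq> mspace X"
  shows "S \<subseteq> nbhd X (r + r') U"
proof
  fix x assume "x \<in> S"
  then obtain y where y: "x \<in> mspace X" "y \<in> T" "mdist X x y \<le> r"
    using assms(1) by (auto simp: nbhd_def)
  then obtain z where z: "y \<in> mspace X" "z \<in> U" "mdist X y z \<le> r'"
    using assms(2) by (auto simp: nbhd_def)
  then have "mdist X x z \<le> r + r'"
    using y assms(3) mdist_triangle[of x X y z] by fastforce
  then show "x \<in> nbhd X (r + r') U" using y z by (auto simp: nbhd_def)
qed

lemma equiv_asymptotic: "equiv (morse_rays X e) (asymptotic X e)"
proof -
  have sub: "\<gamma> ` {0..} \<subseteq> mspace X" if "\<gamma> \<in> morse_rays X e" for \<gamma>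
    using that by (auto simp: morse_rays_def morse_rays_of_gauge_def geodesic_rays_def)
  show ?thesis
  proof (rule equivI)
    show "asymptotic X e \<subseteq> morse_rays X e \<times> morse_rays X e"
      by (auto simp: asymptotic_def)
    show "refl_on (morse_rays X e) (asymptotic X e)"
    proof (rule refl_onI)
      fix \<gamma> assume "\<gamma> \<in> morse_rays X e"
      moreover have "S \<subseteq> nbhd X 0 S" if S: "S \<subseteq> mspace X" for S
      proof
        fix x assume "x \<in> S"
        moreover have "mdist X x x \<le> 0" using S \<open>x \<in> S\<close> mdist_zero[of x X x] by (metis order_refl subsetD)
        ultimately show "x \<in> nbhd X 0 S" using S unfolding nbhd_def by blast
      qed
      ultimately have "bounded_hausdorff_dist X (\<gamma> ` {0..}) (\<gamma> ` {0..})"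
        using sub unfolding bounded_hausdorff_dist_def by blast
      then show "(\<gamma>, \<gamma>) \<in> asymptotic X e"
        using \<open>\<gamma> \<in> morse_rays X e\<close> by (simp add: asymptotic_def)
    qed
    show "sym (asymptotic X e)"
      by (auto simp: sym_def asymptotic_def bounded_hausdorff_dist_def)
    show "trans (asymptotic X e)"
    proof (rule transI)
      fix \<alpha> \<beta> \<gamma>
      assume "(\<alpha>, \<beta>) \<in> asymptotic X e" "(\<beta>, \<gamma>) \<in> asymptotic X e"
      then obtain r r' where m: "\<alpha> \<in> morse_rays X e" "\<gamma> \<in> morse_rays X e" and r:
        "r \<ge> 0" "\<alpha> ` {0..} \<subseteq> nbhd X r (\<beta> ` {0..})" "\<beta> ` {0..} \<subseteq> nbhd X r (\<alpha> ` {0..})"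
        "r' \<ge> 0" "\<beta> ` {0..} \<subseteq> nbhd X r' (\<gamma> ` {0..})" "\<gamma> ` {0..} \<subseteq> nbhd X r' (\<beta> ` {0..})"
        unfolding asymptotic_def bounded_hausdorff_dist_def by blast
      have "r + r' \<ge> 0" using r by simp
      moreover have "\<alpha> ` {0..} \<subseteq> nbhd X (r + r') (\<gamma> ` {0..})"
        using nbhd_trans[OF r(2,5) sub[OF m(2)]] .
      moreover have "\<gamma> ` {0..} \<subseteq> nbhd X (r + r') (\<alpha> ` {0..})"
        using nbhd_trans[OF r(6,3) sub[OF m(1)]] by (simp add: add.commute)
      ultimately have "bounded_hausdorff_dist X (\<alpha> ` {0..}) (\<gamma> ` {0..})"
        unfolding bounded_hausdorff_dist_def by blast
      then show "(\<alpha>, \<gamma>) \<in> asymptotic X e"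
        using m by (simp add: asymptotic_def)
    qed
  qed
qed

lemma topspace_compact_open_topology [simp]: "topspace (compact_open_topology X F) = F"
proof -
  have "\<exists>S. \<gamma> \<in> S \<and> (\<exists>K U. S = {\<gamma> \<in> F. \<gamma> ` K \<subseteq> U} \<and> compact K \<and> K \<subseteq> {0..} \<and>
      openin (mtopology_of X) U)" if "\<gamma> \<in> F" for \<gamma>
    by (rule exI[of _ "{\<gamma> \<in> F. \<gamma> ` {} \<subseteq> {}}"]) (use that in \<open>auto intro!: exI[of _ "{}"]\<close>)
  then show ?thesis
    unfolding compact_open_topology_def topology_generated_by_topspace by blast
qed

lemma openin_stratum_topology:
  "openin (stratum_topology X e M) U \<longleftrightarrow>
     U \<subseteq> boundary_stratum X e M \<and>
     openin (compact_open_topology X (morse_rays_of_gauge X e M))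
       {\<gamma> \<in> morse_rays_of_gauge X e M. asymptotic X e `` {\<gamma>} \<in> U}"
proof -
  let ?P = "\<lambda>U. {\<gamma> \<in> morse_rays_of_gauge X e M. asymptotic X e `` {\<gamma>} \<in> U}"
  let ?T = "compact_open_topology X (morse_rays_of_gauge X e M)"
  have "istopology (\<lambda>U. U \<subseteq> boundary_stratum X e M \<and> openin ?T (?P U))"
    unfolding istopology_def
  proof (intro conjI allI impI)
    fix S T
    assume *: "S \<subseteq> boundary_stratum X e M \<and> openin ?T (?P S)"
      "T \<subseteq> boundary_stratum X e M \<and> openin ?T (?P T)"
    have "?P (S \<inter> T) = ?P S \<inter> ?P T" by blast
    then show "openin ?T (?P (S \<inter> T))" using * by auto
    show "S \<inter> T \<subseteq> boundary_stratum X e M" using * by blast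
  next
    fix \<K> assume *: "\<forall>K\<in>\<K>. K \<subseteq> boundary_stratum X e M \<and> openin ?T (?P K)"
    have "?P (\<Union>\<K>) = (\<Union>K\<in>\<K>. ?P K)" by blast
    then show "openin ?T (?P (\<Union>\<K>))" using * by auto
    show "\<Union>\<K> \<subseteq> boundary_stratum X e M" using * by blast
  qed
  then show ?thesis by (simp add: stratum_topology_def topology_inverse')
qed

lemma openin_morse_boundary:
  "openin (morse_boundary X e) U \<longleftrightarrow>
     U \<subseteq> morse_boundary_set X e \<and>
     (\<forall>M. morse_gauge M \<longrightarrow> openin (stratum_topology X e M) (U \<inter> boundary_stratum X e M))"
proof -
  have "istopology (\<lambda>U. U \<subseteq> morse_boundary_set X e \<and>
     (\<forall>M. morse_gauge M \<longrightarrow> openin (stratum_topology X e M) (U \<inter> boundary_stratum X e M)))"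
    unfolding istopology_def
  proof (intro conjI allI impI)
    fix S T M
    assume *: "S \<subseteq> morse_boundary_set X e \<and> (\<forall>M. morse_gauge M \<longrightarrow>
        openin (stratum_topology X e M) (S \<inter> boundary_stratum X e M))"
      "T \<subseteq> morse_boundary_set X e \<and> (\<forall>M. morse_gauge M \<longrightarrow>
        openin (stratum_topology X e M) (T \<inter> boundary_stratum X e M))"
    show "S \<inter> T \<subseteq> morse_boundary_set X e" using * by blast
    assume "morse_gauge M"
    then have "openin (stratum_topology X e M)
        ((S \<inter> boundary_stratum X e M) \<inter> (T \<inter> boundary_stratum X e M))"
      using * by blast
    moreover have "(S \<inter> boundary_stratum X e M) \<inter> (T \<inter> boundary_stratum X e M)
        = S \<inter> T \<inter> boundary_stratum X e M" by blast
    ultimately show "openin (stratum_topology X e M) (S \<inter> T \<inter> boundary_stratum X e M)" by simp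
  next
    fix \<K> M
    assume *: "\<forall>K\<in>\<K>. K \<subseteq> morse_boundary_set X e \<and> (\<forall>M. morse_gauge M \<longrightarrow>
        openin (stratum_topology X e M) (K \<inter> boundary_stratum X e M))"
    show "\<Union>\<K> \<subseteq> morse_boundary_set X e" using * by blast
    assume "morse_gauge M"
    then have "openin (stratum_topology X e M) (\<Union>K\<in>\<K>. K \<inter> boundary_stratum X e M)"
      using * by blast
    moreover have "(\<Union>K\<in>\<K>. K \<inter> boundary_stratum X e M) = \<Union>\<K> \<inter> boundary_stratum X e M"
      by blast
    ultimately show "openin (stratum_topology X e M) (\<Union>\<K> \<inter> boundary_stratum X e M)" by simp
  qed
  then show ?thesis by (simp add: morse_boundary_def topology_inverse')
qed

lemma asymptotic_class_in_stratum:
  assumes "morse_gauge M" "\<gamma> \<in> morse_rays_of_gauge X e M"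
  shows "asymptotic X e `` {\<gamma>} \<in> boundary_stratum X e M"
proof -
  have "\<gamma> \<in> morse_rays X e" using assms by (auto simp: morse_rays_def)
  then have "\<gamma> \<in> asymptotic X e `` {\<gamma>}"
    "asymptotic X e `` {\<gamma>} \<in> morse_boundary_set X e"
    unfolding morse_boundary_set_def
    by (rule equiv_class_self[OF equiv_asymptotic], rule quotientI)
  then show ?thesis using assms(2) unfolding boundary_stratum_def by blast
qed

lemma topspace_stratum_topology:
  assumes "morse_gauge M"
  shows "topspace (stratum_topology X e M) = boundary_stratum X e M"
proof
  show "topspace (stratum_topology X e M) \<subseteq> boundary_stratum X e M"
    using openin_topspace[of "stratum_topology X e M"] unfolding openin_stratum_topology
    by (rule conjunct1)
  have "{\<gamma> \<in> morse_rays_of_gauge X e M. asymptotic X e `` {\<gamma>} \<in> boundary_stratum X e M}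
      = morse_rays_of_gauge X e M"
    using asymptotic_class_in_stratum[OF assms] by (intro subset_antisym subsetI) simp_all
  then have "openin (stratum_topology X e M) (boundary_stratum X e M)"
    unfolding openin_stratum_topology
    by (metis openin_topspace order_refl topspace_compact_open_topology)
  then show "boundary_stratum X e M \<subseteq> topspace (stratum_topology X e M)"
    by (rule openin_subset)
qed

lemma topspace_morse_boundary [simp]:
  "topspace (morse_boundary X e) = morse_boundary_set X e"
proof
  show "topspace (morse_boundary X e) \<subseteq> morse_boundary_set X e"
    using openin_topspace[of "morse_boundary X e"] unfolding openin_morse_boundary
    by (rule conjunct1)
  have "morse_boundary_set X e \<inter> boundary_stratum X e M = boundary_stratum X e M" for M
    by (auto simp: boundary_stratum_def)
  then have "openin (morse_boundary X e) (morse_boundary_set X e)"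
    unfolding openin_morse_boundary by (metis openin_topspace order_refl topspace_stratum_topology)
  then show "morse_boundary_set X e \<subseteq> topspace (morse_boundary X e)"
    by (rule openin_subset)
qed

abbreviation cayley_boundary ::
    "('g, 'm) monoid_scheme \<Rightarrow> 'g set \<Rightarrow> (real \<Rightarrow> 'g \<Rightarrow> real) set topology" where
  "cayley_boundary G A \<equiv> morse_boundary (cayley_graph G A) (vertex \<one>\<^bsub>G\<^esub>)"

text \<open>
  The point \<open>g\<^sup>+\<close> of a Morse element \<open>g\<close> of infinite order is itself an asymptoticity class, so
  it is the set of all rays from the identity at bounded Hausdorff distance from \<open>{g\<^sup>n | n \<ge> 0}\<close>.
\<close>

definition attracting_point ::
    "('g, 'm) monoid_scheme \<Rightarrow> 'g set \<Rightarrow> 'g \<Rightarrow> (real \<Rightarrow> 'g \<Rightarrow> real) set" where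
  "attracting_point G A g =
     {\<gamma> \<in> morse_rays (cayley_graph G A) (vertex \<one>\<^bsub>G\<^esub>).
        bounded_hausdorff_dist (cayley_graph G A) (\<gamma> ` {0..})
          (range (\<lambda>n::nat. vertex (g [^]\<^bsub>G\<^esub> n)))}"

text \<open>
  Uniform convergence on compact subsets of \<open>[0,\<infinity>)\<close> of geodesics \<open>\<gamma> n\<close>, defined on \<open>[0, l n]\<close>,
  to a ray \<open>\<alpha>\<close>; the lengths \<open>l n\<close> are required to tend to infinity.
\<close>

definition segments_converge ::
    "'p metric \<Rightarrow> (nat \<Rightarrow> real) \<Rightarrow> (nat \<Rightarrow> real \<Rightarrow> 'p) \<Rightarrow> (real \<Rightarrow> 'p) \<Rightarrow> bool" where
  "segments_converge X l \<gamma> \<alpha> \<longleftrightarrow>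
     (\<forall>T\<ge>0. \<forall>\<epsilon>>0. \<forall>\<^sub>F n in sequentially.
        T \<le> l n \<and> (\<forall>t\<in>{0..T}. mdist X (\<gamma> n t) (\<alpha> t) < \<epsilon>))"

definition limit_set ::
    "('g, 'm) monoid_scheme \<Rightarrow> 'g set \<Rightarrow> 'g set \<Rightarrow> (real \<Rightarrow> 'g \<Rightarrow> real) set set" where
  "limit_set G A H =
     {x \<in> topspace (cayley_boundary G A).
        \<exists>M h l \<gamma>. morse_gauge M \<and>
          (\<forall>n::nat. h n \<in> H \<and>
             geodesic_segment (cayley_graph G A) (l n) (\<gamma> n) (vertex \<one>\<^bsub>G\<^esub>) (vertex (h n)) \<and>
             morse (cayley_graph G A) M {0..l n} (\<gamma> n)) \<and>
          (\<exists>\<alpha>\<in>x. segments_converge (cayley_graph G A) l \<gamma> \<alpha>)}"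

end

theory Submission
  imports Defs
begin

text \<open>
  Density. Read a Morse ray \<open>\<alpha>\<close> as a sequence of vertices. There are finitely many words of a given
  length \<open>L\<close>, so some word occurs twice, arbitrarily far out and far apart. Follow \<open>\<alpha>\<close> to the second
  occurrence and then repeat forever the piece between the two. Every piece of length at most
  \<open>L\<close> of the resulting path is a translate of a piece of \<open>\<alpha>\<close>, so the path is locally Morse with a
  gauge and constants that depend on \<open>\<alpha>\<close> only. By the local-to-global property it is a Morse
  quasi-geodesic, with constants that do not depend on the place where the repetition starts. It
  follows the powers of a single element \<open>y\<close>, so \<open>y\<close> is Morse, and the geodesic rays that represent
  \<open>y\<^sup>+\<close> stay close to the path, hence to \<open>\<alpha>\<close> for a long time
  (\<open>attracting_rays_follow_morse_ray\<close>). By local finiteness these rays subconverge to a ray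
  asymptotic to \<open>\<alpha>\<close>. All of them are Morse for one gauge, so the convergence takes place in one
  stratum and therefore in the boundary (\<open>in_closure_of_morse_boundary\<close>).

  Limit sets. Looking back along \<open>\<alpha>\<close> from later and later points, one sees a limiting Morse ray
  \<open>b\<close>. If some \<open>x \<in> H\<close> moves the end of \<open>b\<close>, then \<open>b\<close> and \<open>x \<cdot> b\<close> together form a bi-infinite Morse
  quasi-geodesic. Walk along \<open>\<alpha>\<close> to a point \<open>g\<close> from which the way back looks like \<open>b\<close> for a long time, turn by
  \<open>x\<close>, and walk back. This path is locally Morse, hence uniformly Morse, and it leads from the
  identity to \<open>g x g\<inverse>\<close>, which is in \<open>H\<close> because \<open>H\<close> is normal (\<open>in_limit_set_if_turn\<close>).
  If on the other hand all of \<open>H\<close> fixes the end of \<open>b\<close>, then each element of \<open>H\<close> eventually shifts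
  \<open>b\<close> along itself. Only finitely many elements have a bounded shift, since conjugation by a far
  point of \<open>b\<close> maps them into a ball. If \<open>H\<close> fixed three ends in one orbit, the shifts along any
  two of them would cancel up to a bounded error, so all shifts would be bounded and \<open>H\<close> finite. So the
  orbit has at most two points. As \<open>H\<close> contains an element with a large shift, the stabiliser of
  the end, and with it the whole group, lies within a bounded distance of \<open>H\<close>
  (\<open>group_near_fixing_normal_subgroup\<close>), and then \<open>\<alpha>\<close> can be followed inside \<open>H\<close>.

  Tools. Quasi-geodesics are arbitrary maps here, not necessarily continuous. So their endpoints
  may be moved by a bounded amount, paths may jump from vertex to vertex, and Morse paths may be
  transported by maps that are defined up to bounded error. Translations, reversals, perturbations
  and changes of the generating set are all instances of \<open>morse_transport\<close>; its gauge is explicit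
  because the whole argument is about uniformity of gauges. The coarse geometry rests on
  \<open>quasi_geodesic_detour\<close>, which yields the dichotomy \<open>asymptotic_or_divergent\<close> for Morse rays.
\<close>

section \<open>Quasi-geodesics and Morse paths\<close>

lemma quasi_geodesicI:
  assumes "k \<ge> 1" "c \<ge> 0" "closed I" "is_interval I" "\<gamma> \<in> I \<rightarrow> mspace X"
    and "\<And>s t. s \<in> I \<Longrightarrow> t \<in> I \<Longrightarrow> s \<le> t \<Longrightarrow> t - s \<le> k * (mdist X (\<gamma> s) (\<gamma> t) + c)"
    and "\<And>s t. s \<in> I \<Longrightarrow> t \<in> I \<Longrightarrow> s \<le> t \<Longrightarrow> mdist X (\<gamma> s) (\<gamma> t) \<le> k * (t - s) + c"
  shows "quasi_geodesic X k c I \<gamma>"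
proof -
  have *: "1 / k * \<bar>s - t\<bar> - c \<le> mdist X (\<gamma> s) (\<gamma> t) \<and> mdist X (\<gamma> s) (\<gamma> t) \<le> k * \<bar>s - t\<bar> + c"
    if "s \<in> I" "t \<in> I" "s \<le> t" for s t
    using assms(6,7)[OF that] that(3) assms(1) by (simp add: field_simps)
  have "1 / k * \<bar>s - t\<bar> - c \<le> mdist X (\<gamma> s) (\<gamma> t) \<and> mdist X (\<gamma> s) (\<gamma> t) \<le> k * \<bar>s - t\<bar> + c"
    if "s \<in> I" "t \<in> I" for s t
    using *[OF that] *[OF that(2,1)] by (cases "s \<le> t") (auto simp: mdist_commute abs_minus_commute)
  then show ?thesis using assms by (simp add: quasi_geodesic_def)
qed

lemma quasi_geodesicD:
  assumes "quasi_geodesic X k c I \<gamma>"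
  shows "k \<ge> 1" "c \<ge> 0" "closed I" "is_interval I" "\<And>t. t \<in> I \<Longrightarrow> \<gamma> t \<in> mspace X"
    and "\<And>s t. s \<in> I \<Longrightarrow> t \<in> I \<Longrightarrow> \<bar>s - t\<bar> \<le> k * (mdist X (\<gamma> s) (\<gamma> t) + c)"
    and "\<And>s t. s \<in> I \<Longrightarrow> t \<in> I \<Longrightarrow> mdist X (\<gamma> s) (\<gamma> t) \<le> k * \<bar>s - t\<bar> + c"
proof -
  show k: "k \<ge> 1" and "c \<ge> 0" "closed I" "is_interval I" "\<And>t. t \<in> I \<Longrightarrow> \<gamma> t \<in> mspace X"
    using assms by (auto simp: quasi_geodesic_def)
  fix s t assume st: "s \<in> I" "t \<in> I"
  then have "1 / k * \<bar>s - t\<bar> - c \<le> mdist X (\<gamma> s) (\<gamma> t)"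
    using assms by (auto simp: quasi_geodesic_def)
  then show "\<bar>s - t\<bar> \<le> k * (mdist X (\<gamma> s) (\<gamma> t) + c)" using k by (simp add: field_simps)
  show "mdist X (\<gamma> s) (\<gamma> t) \<le> k * \<bar>s - t\<bar> + c" using assms st by (auto simp: quasi_geodesic_def)
qed

lemma quasi_geodesic_mono:
  assumes "quasi_geodesic X k c I \<gamma>" "k \<le> k'" "c \<le> c'"
  shows "quasi_geodesic X k' c' I \<gamma>"
proof (rule quasi_geodesicI)
  note D = quasi_geodesicD[OF assms(1)]
  show "k' \<ge> 1" "c' \<ge> 0" "closed I" "is_interval I" "\<gamma> \<in> I \<rightarrow> mspace X" using D assms by auto
  fix s t assume st: "s \<in> I" "t \<in> I" "s \<le> t"
  have "k * (mdist X (\<gamma> s) (\<gamma> t) + c) \<le> k' * (mdist X (\<gamma> s) (\<gamma> t) + c')"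
    using D(1,2) assms by (intro mult_mono) auto
  then show "t - s \<le> k' * (mdist X (\<gamma> s) (\<gamma> t) + c')" using D(6)[OF st(1,2)] st(3) by simp
  have "k * (t - s) \<le> k' * (t - s)" using assms st by (intro mult_right_mono) auto
  then show "mdist X (\<gamma> s) (\<gamma> t) \<le> k' * (t - s) + c'" using D(7)[OF st(1,2)] st(3) assms(3) by simp
qed

lemma quasi_geodesic_subset:
  assumes "quasi_geodesic X k c I \<gamma>" "J \<subseteq> I" "closed J" "is_interval J"
  shows "quasi_geodesic X k c J \<gamma>"
  using assms unfolding quasi_geodesic_def by (auto simp: Pi_iff subset_iff)

lemma quasi_geodesic_perturb:
  assumes "quasi_geodesic X k c I \<gamma>" "\<gamma>' \<in> I \<rightarrow> mspace X"
    and "\<And>t. t \<in> I \<Longrightarrow> mdist X (\<gamma>' t) (\<gamma> t) \<le> R" "R \<ge> 0"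
  shows "quasi_geodesic X k (c + 2 * R) I \<gamma>'"
proof (rule quasi_geodesicI)
  note D = quasi_geodesicD[OF assms(1)]
  show "k \<ge> 1" "c + 2 * R \<ge> 0" "closed I" "is_interval I" "\<gamma>' \<in> I \<rightarrow> mspace X"
    using D assms by auto
  fix s t assume st: "s \<in> I" "t \<in> I" "s \<le> t"
  have m: "\<gamma> s \<in> mspace X" "\<gamma> t \<in> mspace X" "\<gamma>' s \<in> mspace X" "\<gamma>' t \<in> mspace X"
    using D(5) assms(2) st by auto
  have 1: "mdist X (\<gamma> s) (\<gamma> t) \<le> mdist X (\<gamma>' s) (\<gamma>' t) + 2 * R"
    using mdist_triangle[of "\<gamma> s" X "\<gamma>' s" "\<gamma> t"] mdist_triangle[of "\<gamma>' s" X "\<gamma>' t" "\<gamma> t"]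
      assms(3)[OF st(1)] assms(3)[OF st(2)] m mdist_commute[of X "\<gamma> s" "\<gamma>' s"] by linarith
  have 2: "mdist X (\<gamma>' s) (\<gamma>' t) \<le> mdist X (\<gamma> s) (\<gamma> t) + 2 * R"
    using mdist_triangle[of "\<gamma>' s" X "\<gamma> s" "\<gamma>' t"] mdist_triangle[of "\<gamma> s" X "\<gamma> t" "\<gamma>' t"]
      assms(3)[OF st(1)] assms(3)[OF st(2)] m mdist_commute[of X "\<gamma> t" "\<gamma>' t"] by linarith
  have "k * (mdist X (\<gamma> s) (\<gamma> t) + c) \<le> k * (mdist X (\<gamma>' s) (\<gamma>' t) + (c + 2 * R))"
    using D(1) 1 by (intro mult_left_mono) auto
  then show "t - s \<le> k * (mdist X (\<gamma>' s) (\<gamma>' t) + (c + 2 * R))"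
    using D(6)[OF st(1,2)] st(3) by linarith
  show "mdist X (\<gamma>' s) (\<gamma>' t) \<le> k * (t - s) + (c + 2 * R)"
    using D(7)[OF st(1,2)] st(3) 2 by simp
qed

lemma quasi_geodesic_reflect:
  assumes "quasi_geodesic X k c {a..b} \<gamma>"
  shows "quasi_geodesic X k c {m - b..m - a} (\<lambda>t. \<gamma> (m - t))"
proof (rule quasi_geodesicI)
  note D = quasi_geodesicD[OF assms(1)]
  show "k \<ge> 1" "c \<ge> 0" "closed {m - b..m - a}" "is_interval {m - b..m - a}" using D by auto
  show "(\<lambda>t. \<gamma> (m - t)) \<in> {m - b..m - a} \<rightarrow> mspace X" using D(5) by auto
  fix s t assume "s \<in> {m - b..m - a}" "t \<in> {m - b..m - a}" "s \<le> t"
  then show "t - s \<le> k * (mdist X (\<gamma> (m - s)) (\<gamma> (m - t)) + c)"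
    "mdist X (\<gamma> (m - s)) (\<gamma> (m - t)) \<le> k * (t - s) + c"
    using D(6,7)[of "m - s" "m - t"] by auto
qed

definition quasi_isometric_embedding ::
    "'q metric \<Rightarrow> 'p metric \<Rightarrow> real \<Rightarrow> real \<Rightarrow> ('q \<Rightarrow> 'p) \<Rightarrow> bool" where
  "quasi_isometric_embedding Y X K C \<psi> \<longleftrightarrow>
     K \<ge> 1 \<and> C \<ge> 0 \<and> \<psi> \<in> mspace Y \<rightarrow> mspace X \<and>
     (\<forall>p\<in>mspace Y. \<forall>q\<in>mspace Y.
        mdist X (\<psi> p) (\<psi> q) \<le> K * mdist Y p q + C \<and>
        mdist Y p q \<le> K * mdist X (\<psi> p) (\<psi> q) + C)"

lemma quasi_isometric_embedding_id: "quasi_isometric_embedding X X 1 0 (\<lambda>p. p)"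
  by (simp add: quasi_isometric_embedding_def)

lemma quasi_geodesic_quasi_isometric_image:
  assumes "quasi_geodesic Y k c I \<sigma>" "quasi_isometric_embedding Y X K C \<psi>"
  shows "quasi_geodesic X (K * k) (K * c + C) I (\<lambda>t. \<psi> (\<sigma> t))"
proof (rule quasi_geodesicI)
  note D = quasi_geodesicD[OF assms(1)]
  have K: "K \<ge> 1" "C \<ge> 0" "\<psi> \<in> mspace Y \<rightarrow> mspace X"
    using assms(2) by (auto simp: quasi_isometric_embedding_def)
  show "K * k \<ge> 1" using K(1) D(1) mult_mono[of 1 K 1 k] by simp
  show "K * c + C \<ge> 0" "closed I" "is_interval I" "(\<lambda>t. \<psi> (\<sigma> t)) \<in> I \<rightarrow> mspace X"
    using D K by (auto simp: Pi_iff)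
  fix s t assume st: "s \<in> I" "t \<in> I" "s \<le> t"
  let ?dX = "mdist X (\<psi> (\<sigma> s)) (\<psi> (\<sigma> t))" and ?dY = "mdist Y (\<sigma> s) (\<sigma> t)"
  have 1: "?dX \<le> K * ?dY + C" and 2: "?dY \<le> K * ?dX + C"
    using assms(2) D(5) st by (auto simp: quasi_isometric_embedding_def)
  have "?dY + c \<le> K * ?dX + C + c" using 2 by simp
  also have "\<dots> \<le> K * (?dX + (K * c + C))"
  proof -
    have "C \<le> K * C" using K mult_right_mono[of 1 K C] by simp
    moreover have "c \<le> K * c" using K D(2) mult_right_mono[of 1 K c] by simp
    then have "c \<le> K * (K * c)" using K D(2) mult_left_mono[of c "K * c" K] by linarith
    ultimately show ?thesis by (simp add: algebra_simps)
  qed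
  finally have "k * (?dY + c) \<le> k * (K * (?dX + (K * c + C)))"
    using D(1) by (intro mult_left_mono) auto
  then show "t - s \<le> K * k * (?dX + (K * c + C))"
    using D(6)[OF st(1,2)] st(3) by (simp add: mult.assoc mult.left_commute)
  have "K * ?dY \<le> K * (k * (t - s) + c)"
    using D(7)[OF st(1,2)] st(3) K by (intro mult_left_mono) auto
  then show "?dX \<le> K * k * (t - s) + (K * c + C)" using 1 by (simp add: algebra_simps)
qed

lemma morse_cong: "morse X M I \<gamma> \<Longrightarrow> (\<And>t. t \<in> I \<Longrightarrow> \<gamma> t = \<gamma>' t) \<Longrightarrow> morse X M I \<gamma>'"
  unfolding morse_def
  by (smt (verit) atLeastAtMost_iff image_cong order_refl subsetD)

lemma quasi_geodesic_cong:
  "quasi_geodesic X k c I \<gamma> \<Longrightarrow> (\<And>t. t \<in> I \<Longrightarrow> \<gamma> t = \<gamma>' t) \<Longrightarrow> quasi_geodesic X k c I \<gamma>'"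
  unfolding quasi_geodesic_def by (auto simp: Pi_iff)

lemma morse_subset: "morse X M I \<gamma> \<Longrightarrow> J \<subseteq> I \<Longrightarrow> morse X M J \<gamma>"
  unfolding morse_def by (meson subset_trans)

lemma morse_if_compact_pieces:
  "(\<And>s t. s \<le> t \<Longrightarrow> {s..t} \<subseteq> I \<Longrightarrow> morse X M {s..t} \<gamma>) \<Longrightarrow> morse X M I \<gamma>"
  unfolding morse_def by (meson order_refl)

lemma nbhd_mono: "r \<le> r' \<Longrightarrow> nbhd X r S \<subseteq> nbhd X r' S"
  unfolding nbhd_def by force

lemma morse_mono:
  assumes "morse X M I \<gamma>" "\<And>k c. k \<ge> 1 \<Longrightarrow> c \<ge> 0 \<Longrightarrow> M k c \<le> M' k c"
  shows "morse X M' I \<gamma>"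
  unfolding morse_def
proof (intro allI impI)
  fix s t k c a b \<sigma>
  assume 1: "s \<le> t \<and> {s..t} \<subseteq> I"
    and 2: "a \<le> b \<and> quasi_geodesic X k c {a..b} \<sigma> \<and> \<sigma> a = \<gamma> s \<and> \<sigma> b = \<gamma> t"
  then have "\<sigma> ` {a..b} \<subseteq> nbhd X (M k c) (\<gamma> ` {s..t})"
    using assms(1) unfolding morse_def by blast
  moreover have "M k c \<le> M' k c" using 2 assms(2) quasi_geodesicD(1,2) by metis
  ultimately show "\<sigma> ` {a..b} \<subseteq> nbhd X (M' k c) (\<gamma> ` {s..t})"
    using nbhd_mono by (metis subset_trans)
qed

lemma quasi_geodesic_near_morse_aux:
  assumes M: "morse X M I \<gamma>" "morse_gauge M" and st: "s \<le> t" "{s..t} \<subseteq> I"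
    and \<gamma>: "\<gamma> s \<in> mspace X" "\<gamma> t \<in> mspace X"
    and \<sigma>: "quasi_geodesic X k c {a..b} \<sigma>" "a \<le> b"
    and R: "mdist X (\<sigma> a) (\<gamma> s) \<le> R" "mdist X (\<sigma> b) (\<gamma> t) \<le> R" and x: "x \<in> {a..b}"
  shows "\<exists>u\<in>{s..t}. mdist X (\<sigma> x) (\<gamma> u) \<le> M k (c + 2 * R) + R"
proof -
  note D = quasi_geodesicD[OF \<sigma>(1)]
  have R0: "R \<ge> 0" using R(1) mdist_nonneg[of X "\<sigma> a" "\<gamma> s"] by linarith
  have M0: "M k (c + 2 * R) \<ge> 0" using M(2) D(1,2) R0 by (simp add: morse_gauge_def)
  consider "x = a" | "x = b" | "a < x" "x < b" using x by fastforce
  then show ?thesis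
  proof cases
    case 1
    then show ?thesis using R M0 st by (intro bexI[of _ s]) auto
  next
    case 2
    then show ?thesis using R M0 st by (intro bexI[of _ t]) auto
  next
    case 3
    let ?\<sigma> = "\<sigma>(a := \<gamma> s, b := \<gamma> t)"
    have "quasi_geodesic X k (c + 2 * R) {a..b} ?\<sigma>"
    proof (rule quasi_geodesic_perturb[OF \<sigma>(1) _ _ R0])
      show "?\<sigma> \<in> {a..b} \<rightarrow> mspace X" using D(5) \<gamma> by auto
      show "mdist X (?\<sigma> u) (\<sigma> u) \<le> R" if "u \<in> {a..b}" for u
        using R R0 mdist_zero[OF D(5)[OF that] D(5)[OF that]] by (auto simp: mdist_commute)
    qed
    moreover have "?\<sigma> a = \<gamma> s" "?\<sigma> b = \<gamma> t" using 3 by auto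
    ultimately have "?\<sigma> ` {a..b} \<subseteq> nbhd X (M k (c + 2 * R)) (\<gamma> ` {s..t})"
      using M(1) st \<sigma>(2) unfolding morse_def by blast
    moreover have "?\<sigma> x = \<sigma> x" using 3 by simp
    ultimately have "\<sigma> x \<in> nbhd X (M k (c + 2 * R)) (\<gamma> ` {s..t})" using x by (metis imageI subsetD)
    then obtain u where "u \<in> {s..t}" "mdist X (\<sigma> x) (\<gamma> u) \<le> M k (c + 2 * R)"
      unfolding nbhd_def by blast
    then show ?thesis using R0 by (intro bexI[of _ u]) auto
  qed
qed

text \<open>The endpoints of the quasi-geodesic are moved onto the Morse path, at the cost of its
  additive constant; they may be met in either order.\<close>

lemma quasi_geodesic_near_morse:
  assumes M: "morse X M I \<gamma>" "morse_gauge M" and st: "s \<in> I" "t \<in> I" "is_interval I"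
    and \<gamma>: "\<gamma> \<in> I \<rightarrow> mspace X"
    and \<sigma>: "quasi_geodesic X k c {a..b} \<sigma>" "a \<le> b"
    and R: "mdist X (\<sigma> a) (\<gamma> s) \<le> R" "mdist X (\<sigma> b) (\<gamma> t) \<le> R" and x: "x \<in> {a..b}"
  obtains u where "u \<in> I" "min s t \<le> u" "u \<le> max s t" 
    "mdist X (\<sigma> x) (\<gamma> u) \<le> M k (c + 2 * R) + R"
proof -
  have mm: "min s t \<in> I" "max s t \<in> I" using st by (auto simp: min_def max_def)
  have *: "{min s t..max s t} \<subseteq> I"
  proof
    fix v assume "v \<in> {min s t..max s t}"
    then show "v \<in> I" using mem_is_interval_1_I[OF st(3) mm, of v] by simp
  qed
  have \<gamma>': "\<gamma> s \<in> mspace X" "\<gamma> t \<in> mspace X" using st \<gamma> by auto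
  have "\<exists>u\<in>{min s t..max s t}. mdist X (\<sigma> x) (\<gamma> u) \<le> M k (c + 2 * R) + R"
  proof (cases "s \<le> t")
    case True
    then have "{s..t} \<subseteq> I" using * by simp
    from quasi_geodesic_near_morse_aux[OF M True this \<gamma>' \<sigma> R x] True show ?thesis by simp
  next
    case False
    then have ts: "t \<le> s" "{t..s} \<subseteq> I" using * by auto
    have "\<exists>u\<in>{t..s}. mdist X (\<sigma> (0 - - x)) (\<gamma> u) \<le> M k (c + 2 * R) + R"
      by (rule quasi_geodesic_near_morse_aux[OF M ts \<gamma>'(2,1) quasi_geodesic_reflect[OF \<sigma>(1), of 0]])
        (use R x \<sigma>(2) in simp_all)
    then show ?thesis using ts by simp
  qed
  then obtain u where "u \<in> {min s t..max s t}" "mdist X (\<sigma> x) (\<gamma> u) \<le> M k (c + 2 * R) + R" by blast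
  then show thesis using that[of u] * by auto
qed

text \<open>A discrete intermediate value theorem, for the parameter along a Morse path of the points
  close to another path.\<close>

lemma intermediate_value_up_to_jumps:
  fixes r :: "real \<Rightarrow> real"
  assumes "s \<le> t" and jump: "\<And>x y. x \<in> {s..t} \<Longrightarrow> y \<in> {s..t} \<Longrightarrow> \<bar>x - y\<bar> \<le> 1 \<Longrightarrow> \<bar>r x - r y\<bar> \<le> J"
    and u: "min (r s) (r t) \<le> u" "u \<le> max (r s) (r t)"
  shows "\<exists>x\<in>{s..t}. \<bar>r x - u\<bar> \<le> J"
proof -
  have main: "\<exists>x\<in>{s..t}. \<bar>f x - v\<bar> \<le> J"
    if j: "\<And>x y. x \<in> {s..t} \<Longrightarrow> y \<in> {s..t} \<Longrightarrow> \<bar>x - y\<bar> \<le> 1 \<Longrightarrow> \<bar>f x - f y\<bar> \<le> J"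
      and v: "f s \<le> v" "v \<le> f t" for f :: "real \<Rightarrow> real" and v
  proof -
    define S where "S = {x \<in> {s..t}. f x \<le> v}"
    have S: "s \<in> S" "bdd_above S" using assms(1) v by (auto simp: S_def intro!: bdd_aboveI[of _ t])
    obtain x where x: "x \<in> S" "Sup S - 1 < x"
      using less_cSup_iff[of S "Sup S - 1"] S by auto
    have xs: "x \<in> {s..t}" "f x \<le> v" using x by (auto simp: S_def)
    define y where "y = min t (x + 1)"
    have y: "y \<in> {s..t}" "\<bar>x - y\<bar> \<le> 1" using xs by (auto simp: y_def)
    have "v \<le> f y"
    proof (cases "y = t")
      case False
      then have "Sup S < y" using x by (auto simp: y_def min_def split: if_splits)
      then have "y \<notin> S" using cSup_upper[OF _ S(2)] by fastforce
      then show ?thesis using y by (simp add: S_def)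
    qed (use v in simp)
    then show ?thesis using j[OF xs(1) y] xs by (intro bexI[of _ x]) auto
  qed
  show ?thesis
  proof (cases "r s \<le> r t")
    case True
    then show ?thesis using main[of r u] jump u by auto
  next
    case False
    have "\<exists>x\<in>{s..t}. \<bar>- r x - - u\<bar> \<le> J"
      by (rule main) (use False jump u in \<open>auto simp: abs_minus_commute\<close>)
    then show ?thesis by (auto simp: abs_minus_commute)
  qed
qed

text \<open>The gauge of a path in \<open>Y\<close> that a \<open>(K, C)\<close>-quasi-isometric embedding maps into the
  \<open>R\<close>-neighbourhood of an \<open>M\<close>-Morse \<open>(k, c)\<close>-quasi-geodesic; \<open>k\<^sub>2\<close> and \<open>c\<^sub>2\<close> bound how far the path moves.
  The term \<open>k * (\<dots>) + c\<close> accounts for the gaps that the path leaves along the quasi-geodesic.\<close>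

definition transported_gauge ::
    "real \<Rightarrow> real \<Rightarrow> real \<Rightarrow> real \<Rightarrow> real \<Rightarrow> real \<Rightarrow> real \<Rightarrow> (real \<Rightarrow> real \<Rightarrow> real) \<Rightarrow> real \<Rightarrow> real \<Rightarrow> real" where
  "transported_gauge k c k\<^sub>2 c\<^sub>2 K C R M = (\<lambda>k\<^sub>3 c\<^sub>3.
     K * (M (K * k\<^sub>3) (K * c\<^sub>3 + C + 2 * R) + 2 * R
          + k * (k * (K * (k\<^sub>2 + c\<^sub>2) + C + 2 * R + c)) + c) + C)"

lemma morse_gauge_transported:
  assumes "morse_gauge M" "k \<ge> 1" "c \<ge> 0" "k\<^sub>2 \<ge> 0" "c\<^sub>2 \<ge> 0" "K \<ge> 1" "C \<ge> 0" "R \<ge> 0"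
  shows "morse_gauge (transported_gauge k c k\<^sub>2 c\<^sub>2 K C R M)"
  unfolding morse_gauge_def transported_gauge_def
proof (intro allI impI)
  fix k\<^sub>3 c\<^sub>3 :: real assume "1 \<le> k\<^sub>3" "0 \<le> c\<^sub>3"
  moreover have "1 \<le> K * k\<^sub>3" using mult_mono[of 1 K 1 k\<^sub>3] \<open>1 \<le> k\<^sub>3\<close> assms by simp
  ultimately have "0 \<le> M (K * k\<^sub>3) (K * c\<^sub>3 + C + 2 * R)" using assms by (simp add: morse_gauge_def)
  then show "0 \<le> K * (M (K * k\<^sub>3) (K * c\<^sub>3 + C + 2 * R) + 2 * R
          + k * (k * (K * (k\<^sub>2 + c\<^sub>2) + C + 2 * R + c)) + c) + C"
    using assms by (intro add_nonneg_nonneg mult_nonneg_nonneg) auto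
qed

text \<open>A quasi-geodesic \<open>\<sigma>\<close> between points of \<open>\<beta>\<close> is mapped by \<open>\<psi>\<close> to a quasi-geodesic that ends close to
  \<open>\<gamma>\<close>, so it stays close to the piece of \<open>\<gamma>\<close> in between. That piece is in turn close to the
  image of \<open>\<beta>\<close>: as \<open>\<beta>\<close> proceeds in bounded steps, the parameters \<open>r x\<close> cannot jump over a long part of
  \<open>\<gamma>\<close>. The reparametrisation \<open>r\<close> is arbitrary, so reversed and stretched paths are covered.\<close>

lemma morse_transport:
  fixes X :: "'p metric" and Y :: "'q metric"
  assumes \<gamma>: "quasi_geodesic X k c I \<gamma>" "morse X M I \<gamma>" "morse_gauge M"
    and \<beta>: "is_interval J" "\<beta> \<in> J \<rightarrow> mspace Y" "k\<^sub>2 \<ge> 0" "c\<^sub>2 \<ge> 0"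
      "\<And>x y. x \<in> J \<Longrightarrow> y \<in> J \<Longrightarrow> mdist Y (\<beta> x) (\<beta> y) \<le> k\<^sub>2 * \<bar>x - y\<bar> + c\<^sub>2"
    and \<psi>: "quasi_isometric_embedding Y X K C \<psi>"
    and r: "r \<in> J \<rightarrow> I" "\<And>x. x \<in> J \<Longrightarrow> mdist X (\<psi> (\<beta> x)) (\<gamma> (r x)) \<le> R" "R \<ge> 0"
  shows "morse Y (transported_gauge k c k\<^sub>2 c\<^sub>2 K C R M) J \<beta>"
  unfolding morse_def
proof (intro allI impI subsetI)
  note D = quasi_geodesicD[OF \<gamma>(1)]
  have K: "K \<ge> 1" "C \<ge> 0" "\<psi> \<in> mspace Y \<rightarrow> mspace X"
    "\<And>p q. p \<in> mspace Y \<Longrightarrow> q \<in> mspace Y \<Longrightarrow> mdist X (\<psi> p) (\<psi> q) \<le> K * mdist Y p q + C"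
    "\<And>p q. p \<in> mspace Y \<Longrightarrow> q \<in> mspace Y \<Longrightarrow> mdist Y p q \<le> K * mdist X (\<psi> p) (\<psi> q) + C"
    using \<psi> by (auto simp: quasi_isometric_embedding_def)
  define jp where "jp = k * (K * (k\<^sub>2 + c\<^sub>2) + C + 2 * R + c)"
  have \<psi>\<beta>: "\<psi> (\<beta> x) \<in> mspace X" "\<gamma> (r x) \<in> mspace X" if "x \<in> J" for x
    using that K(3) \<beta>(2) D(5) r(1) by auto
  \<comment> \<open>A step of length at most 1 along \<open>\<beta>\<close> moves the parameter of \<open>\<gamma>\<close> by a bounded amount.\<close>
  have jump: "\<bar>r x - r y\<bar> \<le> jp" if xy: "x \<in> J" "y \<in> J" "\<bar>x - y\<bar> \<le> 1" for x y
  proof -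
    have "k\<^sub>2 * \<bar>x - y\<bar> \<le> k\<^sub>2 * 1" using \<beta>(3) xy by (intro mult_left_mono) auto
    then have "mdist Y (\<beta> x) (\<beta> y) \<le> k\<^sub>2 + c\<^sub>2" using \<beta>(5)[OF xy(1,2)] by simp
    then have "K * mdist Y (\<beta> x) (\<beta> y) \<le> K * (k\<^sub>2 + c\<^sub>2)" using K(1) by (intro mult_left_mono) auto
    then have 1: "mdist X (\<psi> (\<beta> x)) (\<psi> (\<beta> y)) \<le> K * (k\<^sub>2 + c\<^sub>2) + C"
      using K(4)[of "\<beta> x" "\<beta> y"] \<beta>(2) xy by fastforce
    have "mdist X (\<gamma> (r x)) (\<gamma> (r y)) \<le>
        mdist X (\<psi> (\<beta> x)) (\<gamma> (r x)) + mdist X (\<psi> (\<beta> x)) (\<psi> (\<beta> y)) + mdist X (\<psi> (\<beta> y)) (\<gamma> (r y))"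
      using mdist_triangle[of "\<gamma> (r x)" X "\<psi> (\<beta> x)" "\<gamma> (r y)"]
        mdist_triangle[of "\<psi> (\<beta> x)" X "\<psi> (\<beta> y)" "\<gamma> (r y)"] \<psi>\<beta> xy
      by (simp add: mdist_commute)
    then have "mdist X (\<gamma> (r x)) (\<gamma> (r y)) + c \<le> K * (k\<^sub>2 + c\<^sub>2) + C + 2 * R + c"
      using 1 r(2)[OF xy(1)] r(2)[OF xy(2)] by linarith
    then have "k * (mdist X (\<gamma> (r x)) (\<gamma> (r y)) + c) \<le> jp"
      unfolding jp_def using D(1) by (intro mult_left_mono) auto
    then show ?thesis using D(6)[of "r x" "r y"] r(1) xy by fastforce
  qed
  fix s t k\<^sub>3 c\<^sub>3 a b \<sigma> p
  assume st: "s \<le> t \<and> {s..t} \<subseteq> J"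
    and \<sigma>: "a \<le> b \<and> quasi_geodesic Y k\<^sub>3 c\<^sub>3 {a..b} \<sigma> \<and> \<sigma> a = \<beta> s \<and> \<sigma> b = \<beta> t"
    and "p \<in> \<sigma> ` {a..b}"
  then obtain x where x: "x \<in> {a..b}" "p = \<sigma> x" by auto
  have p: "p \<in> mspace Y" using x \<sigma> quasi_geodesicD(5) by metis
  have sJ: "s \<in> J" "t \<in> J" using st by auto
  let ?N = "M (K * k\<^sub>3) (K * c\<^sub>3 + C + 2 * R) + R"
  obtain u where u: "u \<in> I" "min (r s) (r t) \<le> u" "u \<le> max (r s) (r t)"
    and du: "mdist X (\<psi> (\<sigma> x)) (\<gamma> u) \<le> ?N"
  proof (rule quasi_geodesic_near_morse[OF \<gamma>(2,3), of "r s" "r t" "K * k\<^sub>3" "K * c\<^sub>3 + C" a b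
        "\<lambda>x. \<psi> (\<sigma> x)" R x])
    show "quasi_geodesic X (K * k\<^sub>3) (K * c\<^sub>3 + C) {a..b} (\<lambda>x. \<psi> (\<sigma> x))"
      using \<sigma> \<psi> by (blast intro: quasi_geodesic_quasi_isometric_image)
    show "mdist X (\<psi> (\<sigma> a)) (\<gamma> (r s)) \<le> R" "mdist X (\<psi> (\<sigma> b)) (\<gamma> (r t)) \<le> R"
      using \<sigma> r(2) sJ by auto
    show "r s \<in> I" "r t \<in> I" using r(1) sJ by auto
    show "\<gamma> \<in> I \<rightarrow> mspace X" using D(5) by auto
  qed (use that \<sigma> x D(4) in auto)
  obtain y where y: "y \<in> {s..t}" "\<bar>r y - u\<bar> \<le> jp"
  proof -
    have "\<exists>y\<in>{s..t}. \<bar>r y - u\<bar> \<le> jp"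
      by (rule intermediate_value_up_to_jumps) (use st u jump in blast)+
    then show ?thesis using that by blast
  qed
  have yJ: "y \<in> J" using y st by auto
  have "k * \<bar>u - r y\<bar> \<le> k * jp" using y(2) D(1) by (intro mult_left_mono) auto
  then have 1: "mdist X (\<gamma> u) (\<gamma> (r y)) \<le> k * jp + c"
    using D(7)[OF u(1), of "r y"] r(1) yJ by fastforce
  have "mdist X (\<psi> p) (\<psi> (\<beta> y)) \<le> ?N + (k * jp + c) + R"
    using mdist_triangle[of "\<psi> p" X "\<gamma> u" "\<psi> (\<beta> y)"] mdist_triangle[of "\<gamma> u" X "\<gamma> (r y)" "\<psi> (\<beta> y)"]
      du 1 r(2)[OF yJ] \<psi>\<beta>[OF yJ] D(5)[OF u(1)] K(3) p x mdist_commute[of X "\<psi> (\<beta> y)"] by fastforce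
  then have "K * mdist X (\<psi> p) (\<psi> (\<beta> y)) \<le> K * (?N + (k * jp + c) + R)"
    using K(1) by (intro mult_left_mono) auto
  then have "mdist Y p (\<beta> y) \<le> K * (?N + (k * jp + c) + R) + C"
    using K(5)[of p "\<beta> y"] p \<beta>(2) yJ by fastforce
  also have "\<dots> = transported_gauge k c k\<^sub>2 c\<^sub>2 K C R M k\<^sub>3 c\<^sub>3"
    by (simp add: transported_gauge_def jp_def algebra_simps)
  finally show "p \<in> nbhd Y (transported_gauge k c k\<^sub>2 c\<^sub>2 K C R M k\<^sub>3 c\<^sub>3) (\<beta> ` {s..t})"
    using p y by (auto simp: nbhd_def)
qed


section \<open>Projections in coarsely geodesic spaces\<close>

text \<open>Geodesics up to an additive error suffice, and in a graph they only need to be constructed between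
  vertices.\<close>

definition coarsely_geodesic :: "'p metric \<Rightarrow> real \<Rightarrow> bool" where
  "coarsely_geodesic X C \<longleftrightarrow> C \<ge> 0 \<and>
     (\<forall>p\<in>mspace X. \<forall>q\<in>mspace X. \<exists>l \<zeta>.
        l \<ge> 0 \<and> quasi_geodesic X 1 C {0..l} \<zeta> \<and> \<zeta> 0 = p \<and> \<zeta> l = q)"

text \<open>A detour to a point \<open>z\<close> from a (coarsely) nearest point of a quasi-geodesic is again a
  quasi-geodesic: a point of the detour is no closer to the rest of the quasi-geodesic than to
  the nearest point. The constants do not depend on \<open>z\<close>.\<close>

lemma quasi_geodesic_detour:
  assumes \<sigma>: "quasi_geodesic X k c {a..b} \<sigma>" and w: "w \<in> {a..b}"
    and \<zeta>: "quasi_geodesic X 1 C {0..l} \<zeta>" "\<zeta> 0 = \<sigma> w" "l \<ge> 0"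
    and near: "\<And>u. u \<in> {a..b} \<Longrightarrow> mdist X (\<zeta> l) (\<sigma> w) \<le> mdist X (\<zeta> l) (\<sigma> u) + 1"
  shows "quasi_geodesic X (3 * k) (c + 2 + 5 * C) {a..w + l} (\<lambda>t. if t \<le> w then \<sigma> t else \<zeta> (t - w))"
    (is "quasi_geodesic X ?k ?c _ ?\<sigma>")
proof -
  note D = quasi_geodesicD[OF \<sigma>] and Z = quasi_geodesicD[OF \<zeta>(1)]
  have C: "C \<ge> 0" using Z(2) .
  have z: "\<zeta> l \<in> mspace X" using Z(5) \<zeta>(3) by simp
  have key: "v + \<bar>u - w\<bar> \<le> 3 * k * (mdist X (\<sigma> u) (\<zeta> v) + (c + 2 + 5 * C))
      \<and> mdist X (\<sigma> u) (\<zeta> v) \<le> k * \<bar>u - w\<bar> + v + c + C"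
    if u: "u \<in> {a..b}" and v: "v \<in> {0..l}" for u v
  proof -
    have m: "\<sigma> u \<in> mspace X" "\<zeta> v \<in> mspace X" "\<sigma> w \<in> mspace X" using D(5) Z(5) u v w by auto
    let ?D = "mdist X (\<sigma> u) (\<zeta> v)"
    have l1: "l \<le> mdist X (\<zeta> l) (\<sigma> w) + C" using Z(6)[of l 0] \<zeta> by simp
    have l2: "mdist X (\<zeta> l) (\<zeta> v) \<le> l - v + C" using Z(7)[of l v] v \<zeta> by simp
    have l3: "mdist X (\<zeta> l) (\<sigma> u) \<le> mdist X (\<zeta> l) (\<zeta> v) + ?D"
      using mdist_triangle[OF z m(2,1)] by (simp add: mdist_commute)
    have v1: "v \<le> ?D + 1 + 2 * C" using l1 l2 l3 near[OF u] by linarith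
    have v2: "mdist X (\<sigma> w) (\<zeta> v) \<le> v + C" using Z(7)[of 0 v] v \<zeta> by simp
    have "mdist X (\<sigma> u) (\<sigma> w) \<le> 2 * ?D + 1 + 3 * C"
      using mdist_triangle[OF m(1,2,3)] v1 v2 by (simp add: mdist_commute)
    then have "k * (mdist X (\<sigma> u) (\<sigma> w) + c) \<le> k * (2 * ?D + 1 + 3 * C + c)"
      using D(1) by (intro mult_left_mono) auto
    then have "\<bar>u - w\<bar> \<le> k * (2 * ?D + 1 + 3 * C + c)" using D(6)[OF u w] by linarith
    moreover have "v \<le> k * (?D + 1 + 2 * C)"
      using v1 mult_mono[of 1 k "?D + 1 + 2 * C" "?D + 1 + 2 * C"] D(1) C by simp
    moreover have "k * (3 * ?D + 2 + 5 * C + c) \<le> k * (3 * (?D + (c + 2 + 5 * C)))"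
      using D(1,2) C by (intro mult_left_mono) auto
    ultimately have "v + \<bar>u - w\<bar> \<le> 3 * k * (?D + (c + 2 + 5 * C))" by (simp add: algebra_simps)
    moreover have "?D \<le> k * \<bar>u - w\<bar> + v + c + C"
      using mdist_triangle[OF m(1,3,2)] v2 D(7)[OF u w] by linarith
    ultimately show ?thesis by blast
  qed
  have \<sigma>': "quasi_geodesic X ?k ?c {a..b} \<sigma>" and \<zeta>': "quasi_geodesic X ?k ?c {0..l} \<zeta>"
    using quasi_geodesic_mono[OF \<sigma>] quasi_geodesic_mono[OF \<zeta>(1)] D(1,2) C by simp_all
  note D' = quasi_geodesicD[OF \<sigma>'] and Z' = quasi_geodesicD[OF \<zeta>']
  have kmul: "k * p \<le> 3 * k * p" "p \<le> 3 * k * p" if "p \<ge> 0" for p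
    using that D(1) mult_mono[of 1 "3 * k" p p] mult_right_mono[of k "3 * k" p] by auto
  show ?thesis
  proof (rule quasi_geodesicI)
    show "?k \<ge> 1" "?c \<ge> 0" using D' by auto
    show "closed {a..w + l}" "is_interval {a..w + l}" by auto
    show "?\<sigma> \<in> {a..w + l} \<rightarrow> mspace X" using D(5) Z(5) w by auto
    fix s t assume st: "s \<in> {a..w + l}" "t \<in> {a..w + l}" "s \<le> t"
    consider "t \<le> w" | "s \<le> w" "w < t" | "w < s" using st by linarith
    then have "t - s \<le> ?k * (mdist X (?\<sigma> s) (?\<sigma> t) + ?c) \<and> mdist X (?\<sigma> s) (?\<sigma> t) \<le> ?k * (t - s) + ?c"
    proof cases
      case 1
      then show ?thesis using D'(6,7)[of s t] st w by auto
    next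
      case 2
      have "k * (w - s) \<le> 3 * k * (w - s)" "t - w \<le> 3 * k * (t - w)"
        using kmul(1)[of "w - s"] kmul(2)[of "t - w"] 2 by linarith+
      then have "k * (w - s) + (t - w) \<le> ?k * (t - s)" by (simp add: algebra_simps)
      moreover have "\<bar>s - w\<bar> = w - s" "s \<in> {a..b}" "t - w \<in> {0..l}" using 2 st w by auto
      ultimately show ?thesis using key[of s "t - w"] 2 C by simp
    next
      case 3
      then show ?thesis using Z'(6,7)[of "s - w" "t - w"] st by auto
    qed
    then show "t - s \<le> ?k * (mdist X (?\<sigma> s) (?\<sigma> t) + ?c)"
      "mdist X (?\<sigma> s) (?\<sigma> t) \<le> ?k * (t - s) + ?c" by auto
  qed
qed

lemma nearest_point_detour:
  assumes cg: "coarsely_geodesic X C"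
    and \<sigma>: "quasi_geodesic X k c {a..b} \<sigma>" "a \<le> b" and z: "z \<in> mspace X"
  obtains w l \<sigma>\<^sub>1 \<sigma>\<^sub>2 where "w \<in> {a..b}" "l \<ge> 0"
    "\<And>u. u \<in> {a..b} \<Longrightarrow> mdist X z (\<sigma> w) \<le> mdist X z (\<sigma> u) + 1"
    "quasi_geodesic X (3 * k) (c + 2 + 5 * C) {a..w + l} \<sigma>\<^sub>1"
    "\<And>t. t \<in> {a..w} \<Longrightarrow> \<sigma>\<^sub>1 t = \<sigma> t" "\<sigma>\<^sub>1 (w + l) = z"
    "quasi_geodesic X (3 * k) (c + 2 + 5 * C) {w - l..b} \<sigma>\<^sub>2"
    "\<And>t. t \<in> {w..b} \<Longrightarrow> \<sigma>\<^sub>2 t = \<sigma> t" "\<sigma>\<^sub>2 (w - l) = z"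
proof -
  let ?S = "(\<lambda>u. mdist X z (\<sigma> u)) ` {a..b}"
  have S: "?S \<noteq> {}" "bdd_below ?S" using \<sigma>(2) by (auto intro!: bdd_belowI2[of _ 0])
  then obtain w where w: "w \<in> {a..b}" "mdist X z (\<sigma> w) < Inf ?S + 1"
    using cInf_less_iff[OF S, of "Inf ?S + 1"] by auto
  have near: "mdist X z (\<sigma> w) \<le> mdist X z (\<sigma> u) + 1" if "u \<in> {a..b}" for u
  proof -
    have "Inf ?S \<le> mdist X z (\<sigma> u)" using that S(2) by (intro cInf_lower) auto
    then show ?thesis using w(2) by linarith
  qed
  obtain l \<zeta> where l: "l \<ge> 0" and \<zeta>: "quasi_geodesic X 1 C {0..l} \<zeta>" "\<zeta> 0 = \<sigma> w" "\<zeta> l = z"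
    using cg z quasi_geodesicD(5)[OF \<sigma>(1) w(1)] unfolding coarsely_geodesic_def by metis
  define \<sigma>\<^sub>1 where "\<sigma>\<^sub>1 t = (if t \<le> w then \<sigma> t else \<zeta> (t - w))" for t
  define \<sigma>\<^sub>2 where "\<sigma>\<^sub>2 t = (if w \<le> t then \<sigma> t else \<zeta> (w - t))" for t
  have "quasi_geodesic X (3 * k) (c + 2 + 5 * C) {a..w + l} \<sigma>\<^sub>1"
    unfolding \<sigma>\<^sub>1_def by (rule quasi_geodesic_detour[OF \<sigma>(1) w(1) \<zeta>(1,2) l]) (use near \<zeta>(3) in simp)
  moreover have "quasi_geodesic X (3 * k) (c + 2 + 5 * C) {w - l..b} \<sigma>\<^sub>2"
  proof -
    have "quasi_geodesic X (3 * k) (c + 2 + 5 * C) {0 - b..(0 - w) + l}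
        (\<lambda>t. if t \<le> 0 - w then \<sigma> (0 - t) else \<zeta> (t - (0 - w)))"
      by (rule quasi_geodesic_detour[OF quasi_geodesic_reflect[OF \<sigma>(1), of 0] _ \<zeta>(1) _ l])
        (use w near \<zeta> in auto)
    from quasi_geodesic_reflect[OF this, of 0] show ?thesis
      by (auto simp: \<sigma>\<^sub>2_def elim!: quasi_geodesic_cong)
  qed
  moreover have "\<sigma>\<^sub>1 (w + l) = z" "\<sigma>\<^sub>2 (w - l) = z" using \<zeta> l by (cases "l = 0"; auto simp: \<sigma>\<^sub>1_def \<sigma>\<^sub>2_def)+
  ultimately show thesis using that[of w l \<sigma>\<^sub>1 \<sigma>\<^sub>2] w(1) l near by (simp add: \<sigma>\<^sub>1_def \<sigma>\<^sub>2_def)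
qed

lemma morseD:
  assumes "morse X M I \<gamma>" "s \<le> t" "{s..t} \<subseteq> I"
    and "a \<le> b" "quasi_geodesic X k c {a..b} \<sigma>" "\<sigma> a = \<gamma> s" "\<sigma> b = \<gamma> t"
  shows "\<sigma> ` {a..b} \<subseteq> nbhd X (M k c) (\<gamma> ` {s..t})"
  using assms unfolding morse_def by blast

text \<open>Cut a quasi-geodesic with endpoints on the two halves at the point nearest to \<open>\<gamma> z\<close>, and
  complete both parts by the detour to \<open>\<gamma> z\<close>.\<close>

lemma morse_glue:
  assumes cg: "coarsely_geodesic X C" and M: "morse_gauge M"
    and I: "is_interval I" "z \<in> I" "\<gamma> \<in> I \<rightarrow> mspace X"
    and halves: "morse X M (I \<inter> {..z}) \<gamma>" "morse X M (I \<inter> {z..}) \<gamma>"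
  shows "morse X (\<lambda>k c. M (3 * k) (c + 2 + 5 * C)) I \<gamma>"
  unfolding morse_def
proof (intro allI impI)
  fix s t k c a b \<sigma>
  assume st: "s \<le> t \<and> {s..t} \<subseteq> I"
    and \<sigma>: "a \<le> b \<and> quasi_geodesic X k c {a..b} \<sigma> \<and> \<sigma> a = \<gamma> s \<and> \<sigma> b = \<gamma> t"
  let ?k = "3 * k" and ?c = "c + 2 + 5 * C"
  have C: "C \<ge> 0" using cg by (simp add: coarsely_geodesic_def)
  have k: "k \<ge> 1" "c \<ge> 0" using \<sigma> quasi_geodesicD by blast+
  then have \<sigma>': "quasi_geodesic X ?k ?c {a..b} \<sigma>"
    using \<sigma> C by (auto intro: quasi_geodesic_mono)
  show "\<sigma> ` {a..b} \<subseteq> nbhd X (M ?k ?c) (\<gamma> ` {s..t})"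
  proof (cases "t \<le> z \<or> z \<le> s")
    case True
    then have "{s..t} \<subseteq> I \<inter> {..z} \<or> {s..t} \<subseteq> I \<inter> {z..}" using st by auto
    then show ?thesis
      using morseD[OF halves(1) _ _ _ \<sigma>'] morseD[OF halves(2) _ _ _ \<sigma>'] st \<sigma> by blast
  next
    case False
    then have sub: "s \<le> z" "z \<le> t" "{s..z} \<subseteq> I \<inter> {..z}" "{z..t} \<subseteq> I \<inter> {z..}" using st by auto
    have \<gamma>z: "\<gamma> z \<in> mspace X" using I by auto
    have \<sigma>ab: "quasi_geodesic X k c {a..b} \<sigma>" "a \<le> b" using \<sigma> by auto
    obtain w l \<sigma>\<^sub>1 \<sigma>\<^sub>2 where w: "w \<in> {a..b}" "l \<ge> 0"
      and 1: "quasi_geodesic X ?k ?c {a..w + l} \<sigma>\<^sub>1" "\<And>t. t \<in> {a..w} \<Longrightarrow> \<sigma>\<^sub>1 t = \<sigma> t" "\<sigma>\<^sub>1 (w + l) = \<gamma> z"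
      and 2: "quasi_geodesic X ?k ?c {w - l..b} \<sigma>\<^sub>2" "\<And>t. t \<in> {w..b} \<Longrightarrow> \<sigma>\<^sub>2 t = \<sigma> t" "\<sigma>\<^sub>2 (w - l) = \<gamma> z"
      by (rule nearest_point_detour[OF cg \<sigma>ab \<gamma>z]) blast
    have "\<sigma>\<^sub>1 ` {a..w + l} \<subseteq> nbhd X (M ?k ?c) (\<gamma> ` {s..z})"
      by (rule morseD[OF halves(1) sub(1,3) _ 1(1)]) (use 1 \<sigma> w in auto)
    moreover have "\<sigma>\<^sub>2 ` {w - l..b} \<subseteq> nbhd X (M ?k ?c) (\<gamma> ` {z..t})"
      by (rule morseD[OF halves(2) sub(2,4) _ 2(1)]) (use 2 \<sigma> w in auto)
    moreover have "nbhd X (M ?k ?c) (\<gamma> ` {s..z}) \<subseteq> nbhd X (M ?k ?c) (\<gamma> ` {s..t})"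
      "nbhd X (M ?k ?c) (\<gamma> ` {z..t}) \<subseteq> nbhd X (M ?k ?c) (\<gamma> ` {s..t})"
      using sub by (auto simp: nbhd_def)
    moreover have "\<sigma> ` {a..b} \<subseteq> \<sigma>\<^sub>1 ` {a..w + l} \<union> \<sigma>\<^sub>2 ` {w - l..b}"
    proof
      fix p assume "p \<in> \<sigma> ` {a..b}"
      then obtain x where x: "x \<in> {a..b}" "p = \<sigma> x" by blast
      show "p \<in> \<sigma>\<^sub>1 ` {a..w + l} \<union> \<sigma>\<^sub>2 ` {w - l..b}"
      proof (cases "x \<le> w")
        case True
        then have "p = \<sigma>\<^sub>1 x" "x \<in> {a..w + l}" using x 1(2)[of x] w by auto
        then show ?thesis by blast
      next
        case False
        then have "p = \<sigma>\<^sub>2 x" "x \<in> {w - l..b}" using x 2(2)[of x] w by auto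
        then show ?thesis by blast
      qed
    qed
    ultimately show ?thesis by (meson Un_least subset_trans)
  qed
qed

lemma morse_reflect:
  assumes "morse X M I \<gamma>" "(\<lambda>t. m - t) ` J \<subseteq> I"
  shows "morse X M J (\<lambda>t. \<gamma> (m - t))"
  unfolding morse_def
proof (intro allI impI)
  fix s t k c a b \<sigma>
  assume st: "s \<le> t \<and> {s..t} \<subseteq> J"
    and \<sigma>: "a \<le> b \<and> quasi_geodesic X k c {a..b} \<sigma> \<and> \<sigma> a = \<gamma> (m - s) \<and> \<sigma> b = \<gamma> (m - t)"
  have im: "(\<lambda>u. m - u) ` {s..t} = {m - t..m - s}" by (simp add: image_diff_atLeastAtMost)
  have "(\<lambda>u. m - u) ` {s..t} \<subseteq> (\<lambda>u. m - u) ` J" using st by (intro image_mono) simp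
  then have "m - t \<le> m - s \<and> {m - t..m - s} \<subseteq> I" using st assms(2) im by simp
  moreover have "quasi_geodesic X k c {0 - b..0 - a} (\<lambda>u. \<sigma> (0 - u))"
    using \<sigma> quasi_geodesic_reflect by blast
  ultimately have "(\<lambda>u. \<sigma> (0 - u)) ` {0 - b..0 - a} \<subseteq> nbhd X (M k c) (\<gamma> ` {m - t..m - s})"
    by (intro morseD[OF assms(1)]) (use \<sigma> in auto)
  moreover have "(\<lambda>u. \<sigma> (0 - u)) ` {0 - b..0 - a} = \<sigma> ` {a..b}"
    by (simp add: image_image[symmetric, of \<sigma> "\<lambda>u. - u"])
  moreover have "\<gamma> ` {m - t..m - s} = (\<lambda>u. \<gamma> (m - u)) ` {s..t}"
    unfolding im[symmetric] by (simp only: image_image)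
  ultimately show "\<sigma> ` {a..b} \<subseteq> nbhd X (M k c) ((\<lambda>u. \<gamma> (m - u)) ` {s..t})" by simp
qed

text \<open>Take the detour from \<open>r\<close> to the end of \<open>p\<close>. It is a quasi-geodesic with the endpoints of the Morse
  path \<open>p\<close>, so the part of \<open>r\<close> before the detour is close to \<open>p\<close>. The detour is not much longer than
  \<open>E\<close>, so it leaves \<open>r\<close> only shortly before the end. The bound does not depend on \<open>E\<close>.\<close>

lemma geodesics_with_common_start_close:
  assumes cg: "coarsely_geodesic X C"
    and p: "quasi_geodesic X 1 C {0..l} p" "l \<ge> 0" "morse X M {0..l} p" "morse_gauge M"
    and r: "quasi_geodesic X 1 C {0..m} r" "m \<ge> 0" "r 0 = p 0"
    and E: "mdist X (r m) (p l) \<le> E"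
    and x: "x \<in> {0..m}" "x \<le> l - E - 1 - 2 * C"
  shows "mdist X (r x) (p x) \<le> 2 * M 3 (6 * C + 2) + 3 * C"
proof -
  note P = quasi_geodesicD[OF p(1)] and Q = quasi_geodesicD[OF r(1)]
  have C: "C \<ge> 0" using cg by (simp add: coarsely_geodesic_def)
  have pl: "p l \<in> mspace X" using P(5) p(2) by auto
  obtain w l' \<sigma>\<^sub>1 where w: "w \<in> {0..m}" "l' \<ge> 0"
    and near: "\<And>u. u \<in> {0..m} \<Longrightarrow> mdist X (p l) (r w) \<le> mdist X (p l) (r u) + 1"
    and 1: "quasi_geodesic X (3 * 1) (C + 2 + 5 * C) {0..w + l'} \<sigma>\<^sub>1"
      "\<And>t. t \<in> {0..w} \<Longrightarrow> \<sigma>\<^sub>1 t = r t" "\<sigma>\<^sub>1 (w + l') = p l"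
    by (rule nearest_point_detour[OF cg r(1,2) pl]) blast
  have w0: "r w \<in> mspace X" "p 0 \<in> mspace X" using Q(5) P(5) w p(2) by auto
  have "mdist X (p l) (r w) \<le> E + 1" using near[of m] r(2) E by (simp add: mdist_commute)
  moreover have "l \<le> mdist X (p 0) (p l) + C" using P(6)[of 0 l] p(2) by simp
  moreover have "mdist X (p 0) (p l) \<le> mdist X (p 0) (r w) + mdist X (p l) (r w)"
    using mdist_triangle[OF w0(2,1) pl] by (simp add: mdist_commute)
  moreover have "mdist X (p 0) (r w) \<le> w + C" using Q(7)[of 0 w] w r by simp
  ultimately have xw: "x \<in> {0..w}" using x by simp
  have "\<sigma>\<^sub>1 0 = p 0" using 1(2)[of 0] w r(3) by simp
  then have "\<sigma>\<^sub>1 ` {0..w + l'} \<subseteq> nbhd X (M (3 * 1) (C + 2 + 5 * C)) (p ` {0..l})"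
    by (intro morseD[OF p(3,2) subset_refl _ 1(1)]) (use 1 w in auto)
  then have "r x \<in> nbhd X (M 3 (6 * C + 2)) (p ` {0..l})"
    using 1(2)[OF xw] xw w(2) by (force simp: algebra_simps)
  then obtain y where y: "y \<in> {0..l}" "mdist X (r x) (p y) \<le> M 3 (6 * C + 2)"
    by (auto simp: nbhd_def)
  have "E \<ge> 0" using E mdist_nonneg[of X "r m" "p l"] by linarith
  then have xl: "x \<in> {0..l}" using x C by auto
  have m: "r x \<in> mspace X" "p y \<in> mspace X" "p x \<in> mspace X" using Q(5) P(5) x y xl by auto
  have a: "x \<le> mdist X (p 0) (r x) + C" "mdist X (p 0) (r x) \<le> x + C"
    "y \<le> mdist X (p 0) (p y) + C" "mdist X (p 0) (p y) \<le> y + C"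
    using Q(6,7)[of 0 x] P(6,7)[of 0 y] x y r(3) by auto
  have "mdist X (p 0) (r x) \<le> mdist X (p 0) (p y) + mdist X (r x) (p y)"
    "mdist X (p 0) (p y) \<le> mdist X (p 0) (r x) + mdist X (r x) (p y)"
    using mdist_triangle[OF w0(2) m(2,1)] mdist_triangle[OF w0(2) m(1,2)] by (auto simp: mdist_commute)
  then have "\<bar>y - x\<bar> \<le> M 3 (6 * C + 2) + 2 * C" using a y by linarith
  moreover have "mdist X (p y) (p x) \<le> \<bar>y - x\<bar> + C" using P(7)[of y x] y xl by simp
  ultimately show ?thesis using mdist_triangle[OF m] y by linarith
qed

text \<open>Both rays are compared with a coarse geodesic that joins the start of one to a far point of
  the other. The resulting shift depends on the far point, but two such shifts differ by a bounded
  amount, since \<open>b\<close> is a quasi-geodesic. The final bound depends on neither \<open>E\<close> nor the distance of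
  the starting points.\<close>

lemma frequently_close_rays_asymptotic:
  assumes cg: "coarsely_geodesic X C" and M: "morse_gauge M"
    and b: "quasi_geodesic X 1 C {0..} b" "morse X M {0..} b"
    and c: "quasi_geodesic X 1 C {0..} c" "morse X M {0..} c"
    and E: "\<And>n. \<exists>N N'. n \<le> N \<and> 0 \<le> N' \<and> mdist X (c N) (b N') \<le> E"
  defines "D \<equiv> 4 * M 3 (6 * C + 2) + 6 * C" and "x\<^sub>0 \<equiv> 2 * mdist X (b 0) (c 0) + 1 + 4 * C"
  shows "\<exists>\<tau>. \<forall>x\<ge>x\<^sub>0. 0 \<le> x + \<tau> \<and> mdist X (c x) (b (x + \<tau>)) \<le> 3 * D + 2 * C"
proof -
  note B = quasi_geodesicD[OF b(1)] and Q = quasi_geodesicD[OF c(1)]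
  have C: "C \<ge> 0" using cg by (simp add: coarsely_geodesic_def)
  have x0: "x\<^sub>0 \<ge> 0" using C by (simp add: x\<^sub>0_def)
  have main: "\<exists>\<tau>. (\<forall>x. x\<^sub>0 \<le> x \<and> x \<le> n \<longrightarrow> 0 \<le> x + \<tau> \<and> mdist X (c x) (b (x + \<tau>)) \<le> D)" for n
  proof -
    obtain N N' where N: "max 0 (max (n + \<bar>E\<bar> + 1 + 2 * C) (2 * n + \<bar>E\<bar> + C)) \<le> N" "0 \<le> N'" "mdist X (c N) (b N') \<le> E"
      using E by metis
    have E0: "E \<ge> 0" using N(3) mdist_nonneg[of X "c N" "b N'"] by linarith
    have m: "c 0 \<in> mspace X" "b N' \<in> mspace X" "b 0 \<in> mspace X" "c N \<in> mspace X" using B(5) Q(5) N by auto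
    obtain l r where l: "l \<ge> 0" and r: "quasi_geodesic X 1 C {0..l} r" "r 0 = c 0" "r l = b N'"
      using cg m unfolding coarsely_geodesic_def by metis
    note R = quasi_geodesicD[OF r(1)]
    have 1: "mdist X (r x) (c x) \<le> 2 * M 3 (6 * C + 2) + 3 * C" if "x \<in> {0..l}" "x \<le> n" for x
    proof (rule geodesics_with_common_start_close[OF cg, where r = r and p = c and m = l and l = N and E = E])
      show "quasi_geodesic X 1 C {0..N} c" using quasi_geodesic_subset[OF c(1)] by auto
      show "morse X M {0..N} c" using morse_subset[OF c(2)] by auto
      show "mdist X (r l) (c N) \<le> E" using N r by (simp add: mdist_commute)
    qed (use N that C E0 l r M in auto)
    have 2: "mdist X (r (l - y)) (b (N' - y)) \<le> 2 * M 3 (6 * C + 2) + 3 * C"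
      if "y \<in> {0..l}" "y \<le> N' - mdist X (b 0) (c 0) - 1 - 2 * C" for y
    proof (rule geodesics_with_common_start_close[OF cg, where r = "\<lambda>y. r (l - y)" and p = "\<lambda>y. b (N' - y)" and m = l and l = N'])
      show "quasi_geodesic X 1 C {0..N'} (\<lambda>y. b (N' - y))"
        using quasi_geodesic_reflect[OF quasi_geodesic_subset[OF b(1)], of 0 N' N'] by simp
      show "quasi_geodesic X 1 C {0..l} (\<lambda>y. r (l - y))"
        using quasi_geodesic_reflect[OF r(1), of l] by simp
      show "morse X M {0..N'} (\<lambda>y. b (N' - y))" by (rule morse_reflect[OF b(2)]) auto
      show "mdist X (r (l - l)) (b (N' - N')) \<le> mdist X (b 0) (c 0)" using r by (simp add: mdist_commute)
    qed (use that N l r M in auto)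
    have ln: "l \<le> mdist X (c 0) (b N') + C" using R(6)[of 0 l] l r by simp
    have tri: "mdist X (c 0) (b N') \<le> mdist X (b 0) (c 0) + (N' + C)"
      using mdist_triangle[OF m(1,3,2)] B(7)[of 0 N'] N by (simp add: mdist_commute)
    have nl: "n \<le> l"
    proof -
      have "N \<le> mdist X (c 0) (c N) + C" using Q(6)[of 0 N] N by simp
      moreover have "mdist X (c 0) (c N) \<le> mdist X (c 0) (b N') + E"
        using mdist_triangle[OF m(1,2,4)] N by (simp add: mdist_commute)
      moreover have "mdist X (c 0) (b N') \<le> l + C" using R(7)[of 0 l] l r by simp
      ultimately show ?thesis using N E0 C by linarith
    qed
    show ?thesis
    proof (intro exI[of _ "N' - l"] allI impI)
      fix x assume x: "x\<^sub>0 \<le> x \<and> x \<le> n"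
      have y: "l - x \<in> {0..l}" "l - x \<le> N' - mdist X (b 0) (c 0) - 1 - 2 * C"
        using x nl x0 ln tri by (auto simp: x\<^sub>0_def)
      have pos: "0 \<le> x + (N' - l)" using y(2) C mdist_nonneg[of X "b 0" "c 0"] by linarith
      have "mdist X (r x) (b (x + (N' - l))) \<le> 2 * M 3 (6 * C + 2) + 3 * C"
        using 2[OF y] by (simp add: algebra_simps)
      moreover have "mdist X (r x) (c x) \<le> 2 * M 3 (6 * C + 2) + 3 * C" using 1 x x0 nl by auto
      moreover have "mdist X (c x) (b (x + (N' - l))) \<le> mdist X (r x) (c x) + mdist X (r x) (b (x + (N' - l)))"
        using mdist_triangle[of "c x" X "r x" "b (x + (N' - l))"] Q(5)[of x] R(5)[of x] B(5)[of "x + (N' - l)"]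
          x x0 nl pos by (simp add: mdist_commute)
      ultimately show "0 \<le> x + (N' - l) \<and> mdist X (c x) (b (x + (N' - l))) \<le> D"
        using pos by (simp add: D_def)
    qed
  qed
  obtain \<tau> where \<tau>: "0 \<le> x\<^sub>0 + \<tau>" "mdist X (c x\<^sub>0) (b (x\<^sub>0 + \<tau>)) \<le> D"
    using main[of x\<^sub>0] by auto
  show ?thesis
  proof (intro exI[of _ \<tau>] allI impI)
    fix x assume x: "x\<^sub>0 \<le> x"
    obtain \<tau>' where \<tau>': "\<And>y. x\<^sub>0 \<le> y \<Longrightarrow> y \<le> x \<Longrightarrow> 0 \<le> y + \<tau>' \<and> mdist X (c y) (b (y + \<tau>')) \<le> D"
      using main[of x] by auto
    have a: "0 \<le> x\<^sub>0 + \<tau>'" "mdist X (c x\<^sub>0) (b (x\<^sub>0 + \<tau>')) \<le> D" "0 \<le> x + \<tau>'" "mdist X (c x) (b (x + \<tau>')) \<le> D"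
      using \<tau>'[of x\<^sub>0] \<tau>'[of x] x by auto
    have "mdist X (b (x\<^sub>0 + \<tau>')) (b (x\<^sub>0 + \<tau>)) \<le> 2 * D"
      using mdist_triangle[of "b (x\<^sub>0 + \<tau>')" X "c x\<^sub>0" "b (x\<^sub>0 + \<tau>)"] a \<tau> B(5) Q(5) x0
      by (simp add: mdist_commute)
    moreover have "\<bar>\<tau>' - \<tau>\<bar> \<le> mdist X (b (x\<^sub>0 + \<tau>')) (b (x\<^sub>0 + \<tau>)) + C"
      using B(6)[of "x\<^sub>0 + \<tau>'" "x\<^sub>0 + \<tau>"] a \<tau> by simp
    moreover have "mdist X (b (x + \<tau>')) (b (x + \<tau>)) \<le> \<bar>\<tau>' - \<tau>\<bar> + C"
      using B(7)[of "x + \<tau>'" "x + \<tau>"] a \<tau> x by simp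
    ultimately have "mdist X (b (x + \<tau>')) (b (x + \<tau>)) \<le> 2 * D + 2 * C" by linarith
    then have "mdist X (c x) (b (x + \<tau>)) \<le> 3 * D + 2 * C"
      using mdist_triangle[of "c x" X "b (x + \<tau>')" "b (x + \<tau>)"] a \<tau> B(5)[of "x + \<tau>'"] B(5)[of "x + \<tau>"] Q(5)[of x] x x0
      by simp
    then show "0 \<le> x + \<tau> \<and> mdist X (c x) (b (x + \<tau>)) \<le> 3 * D + 2 * C" using \<tau>(1) x by simp
  qed
qed

text \<open>If the rays do not diverge linearly, then coarse geodesics between them pass arbitrarily far
  from the start of \<open>b\<close>. The point nearest to the start of \<open>b\<close> on such a coarse geodesic is close
  to both rays, so these meet up to a bounded distance arbitrarily far out.\<close>

lemma asymptotic_or_divergent: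
  assumes cg: "coarsely_geodesic X C" and M: "morse_gauge M"
    and b: "quasi_geodesic X 1 C {0..} b" "morse X M {0..} b"
    and c: "quasi_geodesic X 1 C {0..} c" "morse X M {0..} c"
  defines "D \<equiv> 4 * M 3 (6 * C + 2) + 6 * C" and "x\<^sub>0 \<equiv> 2 * mdist X (b 0) (c 0) + 1 + 4 * C"
  shows "(\<exists>\<tau>. \<forall>x\<ge>x\<^sub>0. 0 \<le> x + \<tau> \<and> mdist X (c x) (b (x + \<tau>)) \<le> 3 * D + 2 * C) \<or>
    (\<exists>K. \<forall>s\<ge>0. \<forall>t\<ge>0. s + t - K \<le> mdist X (b s) (c t))"
proof (rule disjCI)
  note B = quasi_geodesicD[OF b(1)] and Q = quasi_geodesicD[OF c(1)]
  have C: "C \<ge> 0" using cg by (simp add: coarsely_geodesic_def)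
  assume nd: "\<not> (\<exists>K. \<forall>s\<ge>0. \<forall>t\<ge>0. s + t - K \<le> mdist X (b s) (c t))"
  define d where "d = mdist X (b 0) (c 0)"
  define R\<^sub>1 where "R\<^sub>1 = M 3 (6 * C + 2)"
  define R\<^sub>2 where "R\<^sub>2 = M 3 (6 * C + 2 + 2 * d) + d"
  have pos: "d \<ge> 0" "R\<^sub>1 \<ge> 0" "R\<^sub>2 \<ge> 0" using M C by (auto simp: d_def R\<^sub>1_def R\<^sub>2_def morse_gauge_def)
  have "\<exists>N N'. n \<le> N \<and> 0 \<le> N' \<and> mdist X (c N) (b N') \<le> R\<^sub>1 + R\<^sub>2" for n
  proof -
    define K where "K = 2 * \<bar>n\<bar> + 2 * R\<^sub>1 + 2 * R\<^sub>2 + d + 7 * C"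
    obtain s t where st: "s \<ge> 0" "t \<ge> 0" "mdist X (b s) (c t) < s + t - K"
      using nd by (metis not_le)
    have m: "b s \<in> mspace X" "c t \<in> mspace X" "b 0 \<in> mspace X" "c 0 \<in> mspace X" using B(5) Q(5) st by auto
    obtain l r where l: "l \<ge> 0" and r: "quasi_geodesic X 1 C {0..l} r" "r 0 = b s" "r l = c t"
      using cg m unfolding coarsely_geodesic_def by metis
    note R = quasi_geodesicD[OF r(1)]
    obtain w l' \<sigma>\<^sub>1 \<sigma>\<^sub>2 where w: "w \<in> {0..l}" "l' \<ge> 0"
      and 1: "quasi_geodesic X (3 * 1) (C + 2 + 5 * C) {0..w + l'} \<sigma>\<^sub>1"
        "\<And>t. t \<in> {0..w} \<Longrightarrow> \<sigma>\<^sub>1 t = r t" "\<sigma>\<^sub>1 (w + l') = b 0"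
      and 2: "quasi_geodesic X (3 * 1) (C + 2 + 5 * C) {w - l'..l} \<sigma>\<^sub>2"
        "\<And>t. t \<in> {w..l} \<Longrightarrow> \<sigma>\<^sub>2 t = r t" "\<sigma>\<^sub>2 (w - l') = b 0"
      by (rule nearest_point_detour[OF cg r(1) l m(3)]) blast
    have rw: "r w \<in> mspace X" "\<sigma>\<^sub>1 w = r w" "\<sigma>\<^sub>2 w = r w" "\<sigma>\<^sub>1 0 = b s" "\<sigma>\<^sub>2 l = c t"
      using R(5) w 1(2) 2(2) r l by auto
    have z: "mdist X (b 0) (b 0) = 0" "mdist X (b s) (b s) = 0" "mdist X (c t) (c t) = 0"
      using mdist_zero[OF m(3) m(3)] mdist_zero[OF m(1) m(1)] mdist_zero[OF m(2) m(2)] by simp_all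
    obtain s' where s': "s' \<ge> 0" "mdist X (r w) (b s') \<le> R\<^sub>1"
    proof -
      obtain u where "u \<in> {0..}" "mdist X (\<sigma>\<^sub>1 w) (b u) \<le> M (3 * 1) (C + 2 + 5 * C + 2 * 0) + 0"
      proof (rule quasi_geodesic_near_morse[OF b(2) M _ _ _ _ 1(1), of s 0 0 w])
        show "mdist X (\<sigma>\<^sub>1 0) (b s) \<le> 0" "mdist X (\<sigma>\<^sub>1 (w + l')) (b 0) \<le> 0"
          by (simp_all only: z rw 1(3))
      qed (use w st B in auto)
      then show thesis using that[of u] rw by (simp add: R\<^sub>1_def)
    qed
    obtain t' where t': "t' \<ge> 0" "mdist X (r w) (c t') \<le> R\<^sub>2"
    proof -
      obtain u where "u \<in> {0..}" "mdist X (\<sigma>\<^sub>2 w) (c u) \<le> M (3 * 1) (C + 2 + 5 * C + 2 * d) + d"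
      proof (rule quasi_geodesic_near_morse[OF c(2) M _ _ _ _ 2(1), of 0 t d w])
        show "mdist X (\<sigma>\<^sub>2 (w - l')) (c 0) \<le> d" "mdist X (\<sigma>\<^sub>2 l) (c t) \<le> d"
          using pos by (simp_all only: z rw 2(3) d_def)
      qed (use w st Q in auto)
      then show thesis using that[of u] rw by (simp add: R\<^sub>2_def)
    qed
    have m': "b s' \<in> mspace X" "c t' \<in> mspace X" using B(5) Q(5) s' t' by auto
    have E: "mdist X (c t') (b s') \<le> R\<^sub>1 + R\<^sub>2"
      using mdist_triangle[OF m'(2) rw(1) m'(1)] s' t' by (simp add: mdist_commute)
    have "l \<le> mdist X (b s) (c t) + C" using R(6)[of 0 l] l r by simp
    moreover have "mdist X (b s) (r w) \<le> w + C" using R(7)[of 0 w] w r by simp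
    moreover have "mdist X (r w) (c t) \<le> l - w + C" using R(7)[of w l] w r by simp
    moreover have "mdist X (b s) (b s') \<le> mdist X (b s) (r w) + R\<^sub>1"
      using mdist_triangle[OF m(1) rw(1) m'(1)] s' by simp
    moreover have "mdist X (c t) (c t') \<le> mdist X (r w) (c t) + R\<^sub>2"
      using mdist_triangle[OF m(2) rw(1) m'(2)] t' by (simp add: mdist_commute)
    moreover have "\<bar>s - s'\<bar> \<le> mdist X (b s) (b s') + C" "\<bar>t - t'\<bar> \<le> mdist X (c t) (c t') + C"
      using B(6)[of s s'] Q(6)[of t t'] st s' t' by auto
    ultimately have sum: "s' + t' \<ge> K - R\<^sub>1 - R\<^sub>2 - 5 * C" using st by linarith
    have "mdist X (b 0) (b s') \<le> d + mdist X (c 0) (c t') + (R\<^sub>1 + R\<^sub>2)"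
      using mdist_triangle[OF m(3,4) m'(1)] mdist_triangle[OF m(4) m'(2,1)] E by (simp add: d_def)
    moreover have "s' \<le> mdist X (b 0) (b s') + C" "mdist X (c 0) (c t') \<le> t' + C"
      using B(6)[of 0 s'] Q(7)[of 0 t'] s' t' by auto
    ultimately have "n \<le> t'" using sum by (simp add: K_def)
    then show ?thesis using E s' by blast
  qed
  then show "\<exists>\<tau>. \<forall>x\<ge>x\<^sub>0. 0 \<le> x + \<tau> \<and> mdist X (c x) (b (x + \<tau>)) \<le> 3 * D + 2 * C"
    unfolding D_def x\<^sub>0_def by (rule frequently_close_rays_asymptotic[OF cg M b c])
qed

lemma bounded_hausdorff_dist_sym:
  "bounded_hausdorff_dist X S T \<Longrightarrow> bounded_hausdorff_dist X T S"
  unfolding bounded_hausdorff_dist_def by blast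

lemma bounded_hausdorff_dist_trans:
  assumes "bounded_hausdorff_dist X S T" "bounded_hausdorff_dist X T U" "S \<subseteq> mspace X" "U \<subseteq> mspace X"
  shows "bounded_hausdorff_dist X S U"
proof -
  obtain r r' where r: "r \<ge> 0" "S \<subseteq> nbhd X r T" "T \<subseteq> nbhd X r S"
    "r' \<ge> 0" "T \<subseteq> nbhd X r' U" "U \<subseteq> nbhd X r' T"
    using assms(1,2) unfolding bounded_hausdorff_dist_def by blast
  have "S \<subseteq> nbhd X (r + r') U" using nbhd_trans[OF r(2,5) assms(4)] .
  moreover have "U \<subseteq> nbhd X (r' + r) S" using nbhd_trans[OF r(6,3) assms(3)] .
  ultimately show ?thesis using r unfolding bounded_hausdorff_dist_def
    by (intro exI[of _ "r + r'"]) (auto simp: add.commute)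
qed

text \<open>A quasi-geodesic ray in a neighbourhood of another one runs along all of it, by the discrete
  intermediate value theorem.\<close>

lemma quasi_geodesic_ray_near_ray:
  assumes \<eta>: "quasi_geodesic X k c {0..} \<eta>" and \<beta>: "quasi_geodesic X k\<^sub>2 c\<^sub>2 {0..} \<beta>"
    and r: "\<And>x. x \<ge> 0 \<Longrightarrow> r x \<ge> 0 \<and> mdist X (\<beta> x) (\<eta> (r x)) \<le> R"
  shows "bounded_hausdorff_dist X (\<beta> ` {0..}) (\<eta> ` {0..})"
proof -
  note D = quasi_geodesicD[OF \<eta>] and B = quasi_geodesicD[OF \<beta>]
  have R: "R \<ge> 0" using r[of 0] mdist_nonneg[of X "\<beta> 0" "\<eta> (r 0)"] by linarith
  have m: "\<beta> x \<in> mspace X" "\<eta> x \<in> mspace X" "\<eta> (r x) \<in> mspace X" if "x \<ge> 0" for x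
    using that D(5) B(5) r by auto
  define jp where "jp = k * (k\<^sub>2 + c\<^sub>2 + 2 * R + c)"
  have jp: "jp \<ge> 0" using D B R by (simp add: jp_def)
  have dr: "mdist X (\<beta> x) (\<beta> y) \<le> mdist X (\<eta> (r x)) (\<eta> (r y)) + 2 * R"
    "mdist X (\<eta> (r x)) (\<eta> (r y)) \<le> mdist X (\<beta> x) (\<beta> y) + 2 * R" if "x \<ge> 0" "y \<ge> 0" for x y
    using mdist_triangle[of "\<beta> x" X "\<eta> (r x)" "\<beta> y"] mdist_triangle[of "\<eta> (r x)" X "\<eta> (r y)" "\<beta> y"]
      mdist_triangle[of "\<eta> (r x)" X "\<beta> x" "\<eta> (r y)"] mdist_triangle[of "\<beta> x" X "\<beta> y" "\<eta> (r y)"]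
      r[OF that(1)] r[OF that(2)] m that
      mdist_commute[of X "\<eta> (r x)" "\<beta> x"] mdist_commute[of X "\<eta> (r y)" "\<beta> y"] by auto
  have jump: "\<bar>r x - r y\<bar> \<le> jp" if "x \<ge> 0" "y \<ge> 0" "\<bar>x - y\<bar> \<le> 1" for x y
  proof -
    have "k\<^sub>2 * \<bar>x - y\<bar> \<le> k\<^sub>2 * 1" using B(1) that by (intro mult_left_mono) auto
    then have "mdist X (\<eta> (r x)) (\<eta> (r y)) + c \<le> k\<^sub>2 + c\<^sub>2 + 2 * R + c"
      using B(7)[of x y] dr(2)[OF that(1,2)] that by simp
    then have "k * (mdist X (\<eta> (r x)) (\<eta> (r y)) + c) \<le> jp"
      unfolding jp_def using D(1) by (intro mult_left_mono) auto
    then show ?thesis using D(6)[of "r x" "r y"] r that by fastforce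
  qed
  define R' where "R' = k * jp + k * r 0 + c + R"
  have "\<beta> ` {0..} \<subseteq> nbhd X R' (\<eta> ` {0..})"
  proof -
    have "R \<le> R'" unfolding R'_def using D(1,2) jp r[of 0] by simp
    then have "\<exists>y\<in>\<eta> ` {0..}. mdist X (\<beta> x) y \<le> R'" if "x \<ge> 0" for x
      using r[OF that] by (intro bexI[of _ "\<eta> (r x)"]) auto
    then show ?thesis using m by (auto simp: nbhd_def)
  qed
  moreover have "\<eta> ` {0..} \<subseteq> nbhd X R' (\<beta> ` {0..})"
  proof -
    have "\<exists>x\<ge>0. mdist X (\<eta> u) (\<beta> x) \<le> R'" if u: "u \<ge> 0" for u
    proof -
      have fin: ?thesis if x: "x \<ge> 0" "\<bar>r x - u\<bar> \<le> jp + r 0" for x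
      proof -
        have "k * \<bar>u - r x\<bar> \<le> k * (jp + r 0)" using x D(1) by (intro mult_left_mono) auto
        then have "mdist X (\<eta> u) (\<eta> (r x)) \<le> k * (jp + r 0) + c"
          using D(7)[of u "r x"] u r[OF x(1)] by simp
        then have "mdist X (\<eta> u) (\<beta> x) \<le> R'"
          using mdist_triangle[of "\<eta> u" X "\<eta> (r x)" "\<beta> x"] m[OF u] m[OF x(1)] r[OF x(1)]
          by (simp add: R'_def algebra_simps mdist_commute)
        then show ?thesis using x by blast
      qed
      show ?thesis
      proof (cases "u < r 0")
        case True
        then show ?thesis using fin[of 0] u jp by auto
      next
        case False
        define x where "x = k\<^sub>2 * (k * (u + r 0 + 1) + c + 2 * R + c\<^sub>2)"
        have x: "x \<ge> 0" using B D R u r[of 0] by (simp add: x_def)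
        have "k\<^sub>2 * (k * (u + r 0 + 1) + c + 2 * R + c\<^sub>2) \<le> k\<^sub>2 * (mdist X (\<beta> x) (\<beta> 0) + c\<^sub>2)"
          using B(6)[of x 0] x by (simp add: x_def)
        then have "k * (u + r 0 + 1) + c + 2 * R \<le> mdist X (\<beta> x) (\<beta> 0)" using B(1) by simp
        then have "k * (u + r 0 + 1) \<le> k * \<bar>r x - r 0\<bar>"
          using dr(1)[OF x, of 0] D(7)[of "r x" "r 0"] r x by fastforce
        then have "u + r 0 + 1 \<le> \<bar>r x - r 0\<bar>" using D(1) by simp
        then have ux: "u \<le> r x" using u r[of 0] r[OF x] by (auto simp: abs_if split: if_splits)
        have "\<exists>y\<in>{0..x}. \<bar>r y - u\<bar> \<le> jp"
          by (rule intermediate_value_up_to_jumps) (use x jump ux False in auto)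
        then obtain y where "y \<ge> 0" "\<bar>r y - u\<bar> \<le> jp" by auto
        then show ?thesis using fin[of y] r[of 0] by auto
      qed
    qed
    then show ?thesis using m unfolding nbhd_def by blast
  qed
  moreover have "R' \<ge> 0" using D(1,2) jp r[of 0] R by (simp add: R'_def)
  ultimately show ?thesis unfolding bounded_hausdorff_dist_def by blast
qed


section \<open>Invariance of the local-to-global property under quasi-isometries\<close>

lemma mdist_self [simp]: "x \<in> mspace X \<Longrightarrow> mdist X x x = 0"
  using mdist_zero[of x X x] by simp

text \<open>Transport local Morse paths to \<open>Y\<close> by \<open>\<phi>\<close>, apply the local-to-global property there, and transport
  the result back. The scale \<open>B\<close> is the same in both spaces, because the parametrisation does not
  change.\<close>

lemma morse_local_to_global_space_quasi_isometric:
  fixes X :: "'p metric" and Y :: "'q metric"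
  assumes Y: "morse_local_to_global_space Y"
    and \<phi>: "quasi_isometric_embedding X Y K C \<phi>" and \<psi>: "quasi_isometric_embedding Y X K C \<psi>"
    and R: "\<And>p. p \<in> mspace X \<Longrightarrow> mdist X (\<psi> (\<phi> p)) p \<le> R" "R \<ge> 0"
  shows "morse_local_to_global_space X"
  unfolding morse_local_to_global_space_def
proof (intro allI impI)
  fix M :: "real \<Rightarrow> real \<Rightarrow> real" and k c :: real
  assume M: "morse_gauge M \<and> k \<ge> 1 \<and> c \<ge> 0"
  have K: "K \<ge> 1" "C \<ge> 0" "\<phi> \<in> mspace X \<rightarrow> mspace Y" "\<psi> \<in> mspace Y \<rightarrow> mspace X"
    using \<phi> \<psi> by (auto simp: quasi_isometric_embedding_def)
  define k\<^sub>0 where "k\<^sub>0 = K * k"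
  define c\<^sub>0 where "c\<^sub>0 = K * c + C"
  define M\<^sub>0 where "M\<^sub>0 = transported_gauge k c k\<^sub>0 c\<^sub>0 K C R M"
  have kc0: "k\<^sub>0 \<ge> 1" "c\<^sub>0 \<ge> 0" using K M mult_mono[of 1 K 1 k] by (auto simp: k\<^sub>0_def c\<^sub>0_def)
  have "morse_gauge M\<^sub>0" unfolding M\<^sub>0_def using M K kc0 R by (intro morse_gauge_transported) auto
  then obtain B M\<^sub>1 k\<^sub>1 c\<^sub>1 where B: "B \<ge> 0" "morse_gauge M\<^sub>1" "k\<^sub>1 \<ge> 1" "c\<^sub>1 \<ge> 0"
    and global: "\<And>I \<gamma>. local_morse_quasi_geodesic Y B M\<^sub>0 k\<^sub>0 c\<^sub>0 I \<gamma> \<Longrightarrow> morse_quasi_geodesic Y M\<^sub>1 k\<^sub>1 c\<^sub>1 I \<gamma>"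
    using Y kc0 unfolding morse_local_to_global_space_def by blast
  define k\<^sub>2 where "k\<^sub>2 = K * k\<^sub>1"
  define c\<^sub>2 where "c\<^sub>2 = K * c\<^sub>1 + C + 2 * R"
  define M\<^sub>2 where "M\<^sub>2 = transported_gauge k\<^sub>1 c\<^sub>1 k\<^sub>2 c\<^sub>2 K C 0 M\<^sub>1"
  have kc2: "k\<^sub>2 \<ge> 1" "c\<^sub>2 \<ge> 0" using K B R mult_mono[of 1 K 1 k\<^sub>1] by (auto simp: k\<^sub>2_def c\<^sub>2_def)
  have M2: "morse_gauge M\<^sub>2" unfolding M\<^sub>2_def using B K kc2 by (intro morse_gauge_transported) auto
  have "morse_quasi_geodesic X M\<^sub>2 k\<^sub>2 c\<^sub>2 I \<gamma>"
    if loc: "local_morse_quasi_geodesic X B M k c I \<gamma>" for I \<gamma>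
  proof -
    have I: "closed I" "is_interval I" "\<gamma> \<in> I \<rightarrow> mspace X"
      using loc by (auto simp: local_morse_quasi_geodesic_def)
    have "local_morse_quasi_geodesic Y B M\<^sub>0 k\<^sub>0 c\<^sub>0 I (\<lambda>t. \<phi> (\<gamma> t))"
      unfolding local_morse_quasi_geodesic_def
    proof (intro conjI allI impI)
      show "(\<lambda>t. \<phi> (\<gamma> t)) \<in> I \<rightarrow> mspace Y" using I K by auto
      fix s t assume st: "s \<le> t \<and> {s..t} \<subseteq> I \<and> \<bar>s - t\<bar> \<le> B"
      then have \<gamma>: "quasi_geodesic X k c {s..t} \<gamma>" "morse X M {s..t} \<gamma>"
        using loc by (auto simp: local_morse_quasi_geodesic_def morse_quasi_geodesic_def)
      have q: "quasi_geodesic Y k\<^sub>0 c\<^sub>0 {s..t} (\<lambda>t. \<phi> (\<gamma> t))"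
        unfolding k\<^sub>0_def c\<^sub>0_def by (rule quasi_geodesic_quasi_isometric_image[OF \<gamma>(1) \<phi>])
      moreover have "morse Y M\<^sub>0 {s..t} (\<lambda>t. \<phi> (\<gamma> t))"
        unfolding M\<^sub>0_def
      proof (rule morse_transport[OF \<gamma> _ _ _ _ _ _ \<psi>, where r = "\<lambda>x. x"])
        show "(\<lambda>t. \<phi> (\<gamma> t)) \<in> {s..t} \<rightarrow> mspace Y" using quasi_geodesicD(5)[OF q] by auto
        show "mdist X (\<psi> (\<phi> (\<gamma> x))) (\<gamma> x) \<le> R" if "x \<in> {s..t}" for x
          using R(1) quasi_geodesicD(5)[OF \<gamma>(1) that] .
        show "mdist Y (\<phi> (\<gamma> x)) (\<phi> (\<gamma> y)) \<le> k\<^sub>0 * \<bar>x - y\<bar> + c\<^sub>0" if "x \<in> {s..t}" "y \<in> {s..t}" for x y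
          using quasi_geodesicD(7)[OF q that] .
      qed (use M kc0 R in auto)
      ultimately show "morse_quasi_geodesic Y M\<^sub>0 k\<^sub>0 c\<^sub>0 {s..t} (\<lambda>t. \<phi> (\<gamma> t))"
        by (simp add: morse_quasi_geodesic_def)
    qed (use I in auto)
    from global[OF this] have \<gamma>: "quasi_geodesic Y k\<^sub>1 c\<^sub>1 I (\<lambda>t. \<phi> (\<gamma> t))" "morse Y M\<^sub>1 I (\<lambda>t. \<phi> (\<gamma> t))"
      by (auto simp: morse_quasi_geodesic_def)
    have q: "quasi_geodesic X k\<^sub>2 c\<^sub>2 I \<gamma>"
      unfolding k\<^sub>2_def c\<^sub>2_def
    proof (rule quasi_geodesic_perturb[OF quasi_geodesic_quasi_isometric_image[OF \<gamma>(1) \<psi>] I(3)])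
      fix t assume "t \<in> I"
      then have "\<gamma> t \<in> mspace X" using I by auto
      then show "mdist X (\<gamma> t) (\<psi> (\<phi> (\<gamma> t))) \<le> R" using R(1) by (simp add: mdist_commute)
    qed (rule R)
    moreover have "morse X M\<^sub>2 I \<gamma>"
      unfolding M\<^sub>2_def
    proof (rule morse_transport[OF \<gamma> _ _ _ _ _ _ \<phi>, where r = "\<lambda>x. x"])
      show "mdist X (\<gamma> x) (\<gamma> y) \<le> k\<^sub>2 * \<bar>x - y\<bar> + c\<^sub>2" if "x \<in> I" "y \<in> I" for x y
        using quasi_geodesicD(7)[OF q that] .
      show "mdist Y (\<phi> (\<gamma> x)) (\<phi> (\<gamma> x)) \<le> 0" if "x \<in> I" for x
        using I K that by (auto simp: Pi_iff)
    qed (use B kc2 I in auto)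
    ultimately show ?thesis by (simp add: morse_quasi_geodesic_def)
  qed
  then show "\<exists>B M' k' c'. B \<ge> 0 \<and> morse_gauge M' \<and> k' \<ge> 1 \<and> c' \<ge> 0 \<and>
      (\<forall>I \<gamma>. local_morse_quasi_geodesic X B M k c I \<gamma> \<longrightarrow> morse_quasi_geodesic X M' k' c' I \<gamma>)"
    using B M2 kc2 by blast
qed

lemma geodesic_near_morse_quasi_geodesic:
  assumes \<gamma>: "quasi_geodesic X k c {0..l} \<gamma>" "l \<ge> 0" "morse X M {0..l} \<gamma>" "morse_gauge M"
    and \<beta>: "geodesic X {0..m} \<beta>" "m \<ge> 0" "\<beta> 0 = \<gamma> 0" "\<beta> m = \<gamma> l"
  shows "\<And>x. x \<in> {0..m} \<Longrightarrow> \<exists>u\<in>{0..l}. mdist X (\<beta> x) (\<gamma> u) \<le> M 1 0"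
    and "morse X (transported_gauge k c 1 0 1 0 (M 1 0) M) {0..m} \<beta>"
proof -
  show *: "\<exists>u\<in>{0..l}. mdist X (\<beta> x) (\<gamma> u) \<le> M 1 0" if "x \<in> {0..m}" for x
  proof -
    have "\<beta> ` {0..m} \<subseteq> nbhd X (M 1 0) (\<gamma> ` {0..l})"
      by (rule morseD[OF \<gamma>(3,2) _ \<beta>(2,1,3,4)]) auto
    then have "\<beta> x \<in> nbhd X (M 1 0) (\<gamma> ` {0..l})" using that by blast
    then show ?thesis by (auto simp: nbhd_def)
  qed
  then obtain r where r: "\<And>x. x \<in> {0..m} \<Longrightarrow> r x \<in> {0..l} \<and> mdist X (\<beta> x) (\<gamma> (r x)) \<le> M 1 0"
    by metis
  show "morse X (transported_gauge k c 1 0 1 0 (M 1 0) M) {0..m} \<beta>"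
    by (rule morse_transport[OF \<gamma>(1,3,4) _ _ _ _ _ quasi_isometric_embedding_id, where r = r])
      (use r \<gamma>(4) quasi_geodesicD[OF \<beta>(1)] in \<open>auto simp: morse_gauge_def\<close>)
qed

section \<open>Cayley graphs\<close>

text \<open>An endpoint of an edge that contains \<open>p\<close>, hence at distance at most 1 from \<open>p\<close>.\<close>

definition nearby_vertex :: "('v \<Rightarrow> real) \<Rightarrow> 'v" where
  "nearby_vertex p = (SOME v. v \<in> support p)"

lemma nearby_vertex_vertex [simp]: "nearby_vertex (vertex g) = g"
  by (auto simp: nearby_vertex_def support_def vertex_def indicator_def)

text \<open>As quasi-geodesics may be discontinuous, a sequence of vertices need not be completed by edges.
  This is only done for the geodesics that must be genuine points of the boundary.\<close>

definition step_path :: "(nat \<Rightarrow> 'v) \<Rightarrow> real \<Rightarrow> 'v \<Rightarrow> real" where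
  "step_path f t = vertex (f (nat \<lfloor>t\<rfloor>))"

lemma step_path_of_nat [simp]: "step_path f (real n) = vertex (f n)"
  by (simp add: step_path_def)

definition edge_path :: "(nat \<Rightarrow> 'v) \<Rightarrow> real \<Rightarrow> 'v \<Rightarrow> real" where
  "edge_path f t = edge_point (f (nat \<lfloor>t\<rfloor>)) (f (Suc (nat \<lfloor>t\<rfloor>))) (frac t)"

lemma edge_path_of_nat [simp]: "edge_path f (real n) = vertex (f n)"
  by (auto simp: edge_path_def edge_point_def frac_def)

lemma edge_path_0 [simp]: "edge_path f 0 = vertex (f 0)"
  using edge_path_of_nat[of f 0] by simp

lemma edge_path_cong:
  assumes "\<And>i. i \<le> n \<Longrightarrow> f i = g i" "0 \<le> t" "t \<le> real n"
  shows "edge_path f t = edge_path g t"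
proof (cases "t = real n")
  case True
  then show ?thesis using assms(1) by simp
next
  case False
  then have "nat \<lfloor>t\<rfloor> < n" using assms by linarith
  then show ?thesis using assms(1) by (simp add: edge_path_def)
qed

locale cayley = group G for G (structure) +
  fixes A
  assumes fgs: "finite_generating_set G A"
begin

sublocale connected_graph "carrier G" "cayley_edges G A"
  by (rule connected_graph_cayley[OF is_group fgs])

abbreviation "X \<equiv> cayley_graph G A"

lemma mspace_X: "mspace X = realization (carrier G) (cayley_edges G A)"
  by (rule mspace_cayley_graph[OF is_group fgs])

lemma vertex_in_X [simp]: "g \<in> carrier G \<Longrightarrow> vertex g \<in> mspace X"
proof -
  assume "g \<in> carrier G"
  moreover have "vertex g = edge_point g g 0" by (simp add: edge_point_def)
  ultimately show ?thesis unfolding mspace_X realization_def by force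
qed

lemma mdist_vertices:
  "g \<in> carrier G \<Longrightarrow> h \<in> carrier G \<Longrightarrow> mdist X (vertex g) (vertex h) = real (gd g h)"
  unfolding cayley_graph_def by (rule mdist_vertex)

lemma nearby_vertex_support: "p \<in> mspace X \<Longrightarrow> nearby_vertex p \<in> support p"
  unfolding nearby_vertex_def mspace_X using support_nonempty[of p] by (simp add: some_in_eq)

lemma nearby_vertex_carrier [simp]: "p \<in> mspace X \<Longrightarrow> nearby_vertex p \<in> carrier G"
  using nearby_vertex_support support_V unfolding mspace_X by blast

lemma mdist_on_common_edge:
  assumes "p \<in> mspace X" "q \<in> mspace X" "on_common_edge (cayley_edges G A) p q"
  shows "mdist X p q = sd p q"
  using assms rdist_eq[of p q] unfolding mspace_X by (simp add: cayley_graph_def mdist_metric_graph)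

lemma mdist_nearby_vertex:
  assumes "p \<in> mspace X" shows "mdist X p (vertex (nearby_vertex p)) \<le> 1"
proof -
  let ?v = "nearby_vertex p"
  have supp: "support (vertex ?v) = {?v}" by (auto simp: support_def vertex_def indicator_def)
  have pR: "p \<in> R" using assms unfolding mspace_X .
  have "on_common_edge (cayley_edges G A) p (vertex ?v)"
    using pR
  proof (cases rule: point_cases)
    case (vertex u)
    then show ?thesis unfolding on_common_edge_def supp using nearby_vertex_support[OF assms] by auto
  next
    case (edge u v)
    then show ?thesis unfolding on_common_edge_def supp using nearby_vertex_support[OF assms] by auto
  qed
  then have "mdist X p (vertex ?v) = sd p (vertex ?v)"
    using mdist_on_common_edge assms by simp
  also have "\<dots> \<le> 1" using sd_le_1[OF pR, of "vertex ?v"] vertex_in_X[of ?v] assms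
    unfolding mspace_X[symmetric] by simp
  finally show ?thesis .
qed

lemma gd_nearby_vertex:
  assumes "p \<in> mspace X" "q \<in> mspace X"
  shows "real (gd (nearby_vertex p) (nearby_vertex q)) \<le> mdist X p q + 2"
    and "mdist X p q \<le> real (gd (nearby_vertex p) (nearby_vertex q)) + 2"
proof -
  let ?p = "vertex (nearby_vertex p)" and ?q = "vertex (nearby_vertex q)"
  have m: "?p \<in> mspace X" "?q \<in> mspace X" using assms by auto
  have "mdist X ?p ?q = real (gd (nearby_vertex p) (nearby_vertex q))"
    using assms by (intro mdist_vertices) auto
  then show "real (gd (nearby_vertex p) (nearby_vertex q)) \<le> mdist X p q + 2"
    "mdist X p q \<le> real (gd (nearby_vertex p) (nearby_vertex q)) + 2"
    using mdist_triangle[OF m(1) assms(1) m(2)] mdist_triangle[OF assms(1,2) m(2)]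
      mdist_triangle[OF assms(1) m(1) assms(2)] mdist_triangle[OF m assms(2)]
      mdist_nearby_vertex[OF assms(1)] mdist_nearby_vertex[OF assms(2)]
      mdist_commute[of X p ?p] mdist_commute[of X q ?q] by linarith+
qed

lemma edge_left_mult:
  assumes "k \<in> carrier G" "(g, h) \<in> cayley_edges G A"
  shows "(k \<otimes> g, k \<otimes> h) \<in> cayley_edges G A"
proof -
  have c: "g \<in> carrier G" "h \<in> carrier G" "inv g \<otimes> h \<in> A"
    using assms by (auto simp: cayley_edges_def)
  have "inv (k \<otimes> g) \<otimes> (k \<otimes> h) = inv g \<otimes> h"
    using c(1,2) assms(1) by (simp add: inv_mult_group m_assoc inv_solve_left')
  then show ?thesis using c assms by (simp add: cayley_edges_def)
qed

lemma gd_left_mult_le: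
  assumes "k \<in> carrier G" "g \<in> carrier G" "h \<in> carrier G"
  shows "gd (k \<otimes> g) (k \<otimes> h) \<le> gd g h"
proof -
  have "(k \<otimes> g, k \<otimes> h') \<in> cayley_edges G A ^^ n" if "(g, h') \<in> cayley_edges G A ^^ n" for n h'
    using that
  proof (induction n arbitrary: h')
    case (Suc n)
    then obtain z where "(g, z) \<in> cayley_edges G A ^^ n" "(z, h') \<in> cayley_edges G A" by auto
    then show ?case using Suc.IH[of z] edge_left_mult[OF assms(1)] by auto
  qed simp
  then show ?thesis using gd_path[OF assms(2,3)] gd_le by blast
qed

lemma gd_left_mult [simp]:
  assumes "k \<in> carrier G" "g \<in> carrier G" "h \<in> carrier G"
  shows "gd (k \<otimes> g) (k \<otimes> h) = gd g h"
proof (rule antisym)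
  have "inv k \<otimes> (k \<otimes> g) = g" "inv k \<otimes> (k \<otimes> h) = h"
    using assms by (simp_all add: m_assoc[symmetric])
  then show "gd g h \<le> gd (k \<otimes> g) (k \<otimes> h)"
    using gd_left_mult_le[of "inv k" "k \<otimes> g" "k \<otimes> h"] assms by simp
qed (rule gd_left_mult_le[OF assms])

lemma gd_one:
  assumes "g \<in> carrier G" "h \<in> carrier G"
  shows "gd \<one> (inv g \<otimes> h) = gd g h"
proof -
  have "g \<otimes> (inv g \<otimes> h) = h" using assms by (simp add: m_assoc[symmetric])
  then show ?thesis using gd_left_mult[of g \<one> "inv g \<otimes> h"] assms by simp
qed

lemma finite_ball: "finite {g \<in> carrier G. gd \<one> g \<le> n}"
proof (induction n)
  case 0
  have "{g \<in> carrier G. gd \<one> g \<le> 0} \<subseteq> {\<one>}" using gd_eq_0[of \<one>] by auto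
  then show ?case using finite_subset by blast
next
  case (Suc n)
  let ?B = "{g \<in> carrier G. gd \<one> g \<le> n}"
  have "{g \<in> carrier G. gd \<one> g \<le> Suc n} \<subseteq> insert \<one> ((\<lambda>(g, a). g \<otimes> a) ` (?B \<times> A))"
  proof
    fix g assume g: "g \<in> {g \<in> carrier G. gd \<one> g \<le> Suc n}"
    show "g \<in> insert \<one> ((\<lambda>(g, a). g \<otimes> a) ` (?B \<times> A))"
    proof (cases "gd \<one> g")
      case 0
      then show ?thesis using gd_eq_0[of \<one> g] g by auto
    next
      case (Suc m)
      then obtain z where z: "(\<one>, z) \<in> cayley_edges G A ^^ m" "(z, g) \<in> cayley_edges G A"
        using gd_path[of \<one> g] g by auto
      then have "z \<in> ?B" using gd_le[OF z(1)] g Suc by (auto simp: cayley_edges_def)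
      moreover have "inv z \<otimes> g \<in> A" "g = z \<otimes> (inv z \<otimes> g)"
        using z(2) by (auto simp: cayley_edges_def m_assoc[symmetric])
      ultimately show ?thesis by force
    qed
  qed
  moreover have "finite (?B \<times> A)" using Suc fgs by (auto simp: finite_generating_set_def)
  ultimately show ?case using finite_subset by blast
qed

lemma step_path_in_X: "(\<And>n. f n \<in> carrier G) \<Longrightarrow> step_path f t \<in> mspace X"
  by (simp add: step_path_def)

text \<open>The error 2 is that of the vertices next to the points of a geodesic. The notion is preserved by
  translations, by reversal and by pointwise limits.\<close>

definition rough_geodesic :: "nat set \<Rightarrow> (nat \<Rightarrow> 'a) \<Rightarrow> bool" where
  "rough_geodesic N f \<longleftrightarrow> (\<forall>n. f n \<in> carrier G) \<and>
     (\<forall>i\<in>N. \<forall>j\<in>N. \<bar>real (gd (f i) (f j)) - \<bar>real i - real j\<bar>\<bar> \<le> 2)"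

lemma quasi_geodesic_step_path:
  assumes "rough_geodesic N f" "closed I" "is_interval I" "\<And>t. t \<in> I \<Longrightarrow> 0 \<le> t \<and> nat \<lfloor>t\<rfloor> \<in> N"
  shows "quasi_geodesic X 1 4 I (step_path f)"
proof (rule quasi_geodesicI)
  have f: "\<And>n. f n \<in> carrier G" using assms(1) by (simp add: rough_geodesic_def)
  show "step_path f \<in> I \<rightarrow> mspace X" using f by (simp add: step_path_in_X)
  fix s t assume st: "s \<in> I" "t \<in> I" "s \<le> t"
  let ?i = "nat \<lfloor>s\<rfloor>" and ?j = "nat \<lfloor>t\<rfloor>"
  have "\<bar>real (gd (f ?i) (f ?j)) - \<bar>real ?i - real ?j\<bar>\<bar> \<le> 2"
    using assms(1) assms(4)[OF st(1)] assms(4)[OF st(2)] unfolding rough_geodesic_def by blast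
  moreover have "\<bar>real ?i - real ?j\<bar> = of_int \<lfloor>t\<rfloor> - of_int \<lfloor>s\<rfloor>"
    using assms(4)[OF st(1)] assms(4)[OF st(2)] floor_mono[OF st(3)] by simp
  ultimately have "\<bar>real (gd (f ?i) (f ?j)) - (of_int \<lfloor>t\<rfloor> - of_int \<lfloor>s\<rfloor>)\<bar> \<le> 2" by simp
  moreover have "\<bar>of_int \<lfloor>t\<rfloor> - of_int \<lfloor>s\<rfloor> - (t - s)\<bar> \<le> 1" by linarith
  moreover have "mdist X (step_path f s) (step_path f t) = real (gd (f ?i) (f ?j))"
    using f by (simp add: step_path_def mdist_vertices)
  ultimately have "\<bar>mdist X (step_path f s) (step_path f t) - (t - s)\<bar> \<le> 4" by linarith
  then show "t - s \<le> 1 * (mdist X (step_path f s) (step_path f t) + 4)"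
    "mdist X (step_path f s) (step_path f t) \<le> 1 * (t - s) + 4" unfolding abs_le_iff by simp_all
qed (use assms in auto)

lemma exact_geodesic:
  assumes g: "g \<in> carrier G" "h \<in> carrier G"
  obtains f where "f 0 = g" "f (gd g h) = h" "\<And>n. f n \<in> carrier G"
    "\<And>i j. i \<le> gd g h \<Longrightarrow> j \<le> gd g h \<Longrightarrow> real (gd (f i) (f j)) = \<bar>real i - real j\<bar>"
proof -
  let ?n = "gd g h"
  obtain f0 where f0: "f0 0 = g" "f0 ?n = h" "\<And>i. i < ?n \<Longrightarrow> (f0 i, f0 (Suc i)) \<in> cayley_edges G A"
    using gd_path[OF g] unfolding relpow_fun_conv by auto
  define f where "f i = f0 (min i ?n)" for i
  have f: "f 0 = g" "f ?n = h" "\<And>i. i < ?n \<Longrightarrow> (f i, f (Suc i)) \<in> cayley_edges G A"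
    using f0 by (auto simp: f_def)
  have car: "f i \<in> carrier G" for i
  proof (cases "min i ?n")
    case 0
    then show ?thesis using f0(1) g by (simp add: f_def)
  next
    case (Suc m)
    then have "(f0 m, f0 (Suc m)) \<in> cayley_edges G A" using f0(3)[of m] by linarith
    then show ?thesis using Suc by (simp add: f_def cayley_edges_def)
  qed
  have le: "gd (f i) (f (i + m)) \<le> m" if "i + m \<le> ?n" for i m
    using that
  proof (induction m)
    case (Suc m)
    have "gd (f (i + m)) (f (i + Suc m)) \<le> 1" using f(3)[of "i + m"] Suc.prems gd_edge by simp
    then show ?case
      using gd_triangle[of "f i" "f (i + m)" "f (i + Suc m)"] car Suc.IH Suc.prems
      by simp
  qed simp
  have eq: "gd (f i) (f j) = j - i" if "i \<le> j" "j \<le> ?n" for i j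
  proof -
    have "?n \<le> gd (f 0) (f i) + gd (f i) (f j) + gd (f j) (f ?n)"
      using gd_triangle[of "f 0" "f i" "f j"] gd_triangle[of "f 0" "f j" "f ?n"] car f(1,2) g by simp
    then show ?thesis using le[of 0 i] le[of i "j - i"] le[of j "?n - j"] that by simp
  qed
  have "real (gd (f i) (f j)) = \<bar>real i - real j\<bar>" if "i \<le> ?n" "j \<le> ?n" for i j
  proof (cases "i \<le> j")
    case True
    then show ?thesis using eq[of i j] that by simp
  next
    case False
    then show ?thesis using eq[of j i] that gd_commute[of "f i" "f j"] by simp
  qed
  then show thesis using that f car by blast
qed

text \<open>Take a geodesic between vertices next to the two points and redefine it at its ends. The
  interval is one longer than the geodesic, so that it does not degenerate when both points are next to
  the same vertex.\<close>

lemma coarsely_geodesic_X: "coarsely_geodesic X 4"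
  unfolding coarsely_geodesic_def
proof (intro conjI ballI)
  fix p q assume pq: "p \<in> mspace X" "q \<in> mspace X"
  let ?g = "nearby_vertex p" and ?h = "nearby_vertex q"
  let ?n = "gd ?g ?h"
  obtain f where f: "f 0 = ?g" "f ?n = ?h" "\<And>n. f n \<in> carrier G"
    "\<And>i j. i \<le> ?n \<Longrightarrow> j \<le> ?n \<Longrightarrow> real (gd (f i) (f j)) = \<bar>real i - real j\<bar>"
    using exact_geodesic[of ?g ?h] pq by (metis nearby_vertex_carrier)
  define l where "l = real ?n + 1"
  define \<zeta> where "\<zeta> t = (if t \<le> 0 then p else if t \<ge> l then q else step_path f t)" for t
  have l: "l > 0" by (simp add: l_def)
  have z: "\<zeta> 0 = p" "\<zeta> l = q" using l by (auto simp: \<zeta>_def)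
  have in_m: "\<zeta> t \<in> mspace X" for t using pq step_path_in_X[OF f(3)] by (simp add: \<zeta>_def)
  define s where "s t = min (nat \<lfloor>t\<rfloor>) ?n" for t :: real
  have near: "mdist X (\<zeta> t) (vertex (f (s t))) \<le> (if t = 0 \<or> t = l then 1 else 0)" if t: "t \<in> {0..l}" for t
  proof -
    consider "t = 0" | "t = l" | "0 < t" "t < l" using t by fastforce
    then show ?thesis
    proof cases
      case 1
      then show ?thesis using mdist_nearby_vertex[OF pq(1)] f by (simp add: s_def z)
    next
      case 2
      moreover have "nat \<lfloor>l\<rfloor> = ?n + 1" unfolding l_def by linarith
      ultimately show ?thesis using mdist_nearby_vertex[OF pq(2)] f by (simp add: s_def z)
    next
      case 3
      then have "nat \<lfloor>t\<rfloor> \<le> ?n" unfolding l_def by linarith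
      then have "\<zeta> t = vertex (f (s t))" using 3 by (simp add: \<zeta>_def step_path_def s_def)
      then show ?thesis using 3 f(3) by simp
    qed
  qed
  have "quasi_geodesic X 1 4 {0..l} \<zeta>"
  proof (rule quasi_geodesicI)
    fix a b assume ab: "a \<in> {0..l}" "b \<in> {0..l}" "a \<le> b"
    have m: "vertex (f (s a)) \<in> mspace X" "vertex (f (s b)) \<in> mspace X" using f by auto
    have sl: "\<bar>real (s t) - t\<bar> \<le> 1" if "t \<in> {0..l}" for t
      using that unfolding s_def l_def by (auto simp: min_def) linarith+
    have "mdist X (vertex (f (s a))) (vertex (f (s b))) = \<bar>real (s a) - real (s b)\<bar>"
      using mdist_vertices f by (simp add: s_def)
    moreover have "s a \<le> s b" using ab unfolding s_def by (auto simp: min_def) linarith+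
    ultimately have 1: "\<bar>mdist X (vertex (f (s a))) (vertex (f (s b))) - (b - a)\<bar> \<le> 2"
      using sl[OF ab(1)] sl[OF ab(2)] by linarith
    have 2: "\<bar>mdist X (\<zeta> a) (\<zeta> b) - mdist X (vertex (f (s a))) (vertex (f (s b)))\<bar> \<le> 2"
      using mdist_triangle[OF in_m[of a] m(1) in_m[of b]] mdist_triangle[OF m in_m[of b]]
        mdist_triangle[OF m(1) in_m[of a] m(2)] mdist_triangle[OF in_m[of a] in_m[of b] m(2)]
        near[OF ab(1)] near[OF ab(2)] mdist_commute[of X "\<zeta> a" "vertex (f (s a))"]
        mdist_commute[of X "\<zeta> b" "vertex (f (s b))"] by (auto split: if_splits)
    show "b - a \<le> 1 * (mdist X (\<zeta> a) (\<zeta> b) + 4)" "mdist X (\<zeta> a) (\<zeta> b) \<le> 1 * (b - a) + 4"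
      using 1 2 unfolding abs_le_iff by simp_all
  qed (use in_m in auto)
  then show "\<exists>l \<zeta>. l \<ge> 0 \<and> quasi_geodesic X 1 4 {0..l} \<zeta> \<and> \<zeta> 0 = p \<and> \<zeta> l = q"
    using z l by (intro exI[of _ l] exI[of _ \<zeta>]) simp
qed simp

lemma edge_path_in_X:
  assumes "\<And>n. f n \<in> carrier G" "gd (f (nat \<lfloor>t\<rfloor>)) (f (Suc (nat \<lfloor>t\<rfloor>))) = 1"
  shows "edge_path f t \<in> mspace X"
proof -
  let ?u = "f (nat \<lfloor>t\<rfloor>)" and ?v = "f (Suc (nat \<lfloor>t\<rfloor>))"
  have "(?u, ?v) \<in> cayley_edges G A" using gd_path[of ?u ?v] assms by simp
  moreover have "0 \<le> frac t" "frac t \<le> 1" using frac_lt_1[of t] by auto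
  ultimately show ?thesis
    unfolding mspace_X realization_def edge_path_def using assms(1) by blast
qed

end


context cayley begin

lemma mdist_edge_points:
  assumes uv: "(u, v) \<in> cayley_edges G A" and ab: "a \<in> {0..1}" "b \<in> {0..1}"
  shows "mdist X (edge_point u v a) (edge_point u v b) \<le> \<bar>a - b\<bar>"
proof -
  have c: "u \<in> carrier G" "v \<in> carrier G" using uv by (auto simp: cayley_edges_def)
  have m: "edge_point u v t \<in> mspace X" if "t \<in> {0..1}" for t
  proof -
    have "0 \<le> t" "t \<le> 1" using that by auto
    then show ?thesis unfolding mspace_X realization_def using c uv by blast
  qed
  have "support (edge_point u v t) \<subseteq> {u, v}" for t
    by (auto simp: support_def edge_point_def vertex_def indicator_def)
  then have "on_common_edge (cayley_edges G A) (edge_point u v a) (edge_point u v b)"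
    unfolding on_common_edge_def using uv by blast
  then have "mdist X (edge_point u v a) (edge_point u v b) = sd (edge_point u v a) (edge_point u v b)"
    using mdist_on_common_edge m ab by blast
  also have "\<dots> \<le> \<bar>a - b\<bar>"
    by (rule sd_least) (auto simp: edge_point_def vertex_def indicator_def)
  finally show ?thesis .
qed

lemma edge_path_on_edge:
  assumes "real i \<le> t" "t \<le> real i + 1"
  shows "edge_path f t = edge_point (f i) (f (Suc i)) (t - real i)"
proof (cases "t = real i + 1")
  case True
  then have t: "t = real (Suc i)" by simp
  show ?thesis unfolding t edge_path_of_nat by (simp add: edge_point_def)
next
  case False
  then have "\<lfloor>t\<rfloor> = int i" using assms by linarith
  then show ?thesis by (simp add: edge_path_def frac_def)
qed

text \<open>The path has speed at most 1, and it cannot be shorter than the distance of its endpoints.\<close>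

lemma geodesic_edge_path:
  assumes f: "\<And>n. f n \<in> carrier G"
    and ex: "\<And>i j. i \<le> n \<Longrightarrow> j \<le> n \<Longrightarrow> real (gd (f i) (f j)) = \<bar>real i - real j\<bar>"
  shows "geodesic X {0..real n} (edge_path f)"
proof -
  have E: "(f i, f (Suc i)) \<in> cayley_edges G A" if "i < n" for i
    using gd_path[OF f f, of i "Suc i"] ex[of i "Suc i"] that by simp
  have inX: "edge_path f t \<in> mspace X" if t: "t \<in> {0..real n}" for t
  proof (cases "t = real n")
    case True
    then show ?thesis using f by simp
  next
    case False
    then have "nat \<lfloor>t\<rfloor> < n" using t by auto linarith
    then show ?thesis using edge_path_in_X[OF f] ex[of "nat \<lfloor>t\<rfloor>" "Suc (nat \<lfloor>t\<rfloor>)"] by simp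
  qed
  have on_edge: "mdist X (edge_path f s) (edge_path f t) \<le> \<bar>s - t\<bar>"
    if "i < n" "s \<in> {real i..real i + 1}" "t \<in> {real i..real i + 1}" for i s t
    using mdist_edge_points[OF E[OF that(1)], of "s - real i" "t - real i"] that
      edge_path_on_edge[of i s f] edge_path_on_edge[of i t f] by simp
  have up: "mdist X (edge_path f s) (edge_path f t) \<le> t - s"
    if st: "s \<in> {0..real n}" "t \<in> {0..real n}" "s \<le> t" for s t
  proof (cases "t = s \<or> \<lfloor>s\<rfloor> = \<lfloor>t\<rfloor>")
    case True
    then show ?thesis
    proof
      assume "\<lfloor>s\<rfloor> = \<lfloor>t\<rfloor>"
      then have "of_int \<lfloor>s\<rfloor> \<le> s" "t < of_int \<lfloor>s\<rfloor> + 1" by linarith+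
      then have fl: "real (nat \<lfloor>s\<rfloor>) \<le> s" "t < real (nat \<lfloor>s\<rfloor>) + 1" using st by auto
      show ?thesis
      proof (cases "nat \<lfloor>s\<rfloor> < n")
        case True
        then show ?thesis using on_edge[OF True, of s t] fl st by auto
      next
        case False
        then have "s = t" using fl st by auto
        then show ?thesis using inX st by simp
      qed
    qed (use inX st in simp)
  next
    case False
    define i j where "i = nat \<lfloor>s\<rfloor>" and "j = nat \<lfloor>t\<rfloor>"
    have "\<lfloor>s\<rfloor> < \<lfloor>t\<rfloor>" using False floor_mono[OF st(3)] by linarith
    then have ij: "i < j" "real i \<le> s" "s \<le> real i + 1" "real j \<le> t" "t \<le> real j + 1" "i < n"
    proof -
      have "real i = of_int \<lfloor>s\<rfloor>" "real j = of_int \<lfloor>t\<rfloor>" using st by (auto simp: i_def j_def)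
      moreover have "of_int \<lfloor>s\<rfloor> + 1 \<le> (of_int \<lfloor>t\<rfloor> :: real)" using \<open>\<lfloor>s\<rfloor> < \<lfloor>t\<rfloor>\<close> by linarith
      moreover have "of_int \<lfloor>s\<rfloor> \<le> s" "s \<le> of_int \<lfloor>s\<rfloor> + 1" "of_int \<lfloor>t\<rfloor> \<le> t" "t \<le> of_int \<lfloor>t\<rfloor> + 1"
        by linarith+
      ultimately have *: "real i + 1 \<le> real j" "real i \<le> s" "s \<le> real i + 1" "real j \<le> t" "t \<le> real j + 1"
        by linarith+
      then have "real i + 1 \<le> real n" using st by auto
      then show "i < j" "real i \<le> s" "s \<le> real i + 1" "real j \<le> t" "t \<le> real j + 1" "i < n"
        using * by linarith+
    qed
    have jn: "j \<le> n" using ij st by auto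
    have v: "vertex (f (Suc i)) \<in> mspace X" "vertex (f j) \<in> mspace X" using f by auto
    have "mdist X (edge_path f s) (vertex (f (Suc i))) \<le> real i + 1 - s"
      using on_edge[OF ij(6), of s "real (Suc i)"] ij edge_path_of_nat[of f "Suc i"] by simp
    moreover have "mdist X (vertex (f (Suc i))) (vertex (f j)) = real j - real i - 1"
      using mdist_vertices[OF f f] ex[of "Suc i" j] ij jn by simp
    moreover have "mdist X (vertex (f j)) (edge_path f t) \<le> t - real j"
    proof (cases "j < n")
      case True
      then show ?thesis using on_edge[OF True, of "real j" t] ij by simp
    next
      case False
      then have "t = real j" using jn st ij by simp
      then show ?thesis using f by simp
    qed
    ultimately show ?thesis
      using mdist_triangle[OF inX[OF st(1)] v(1) inX[OF st(2)]] mdist_triangle[OF v inX[OF st(2)]]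
      by linarith
  qed
  have "t - s \<le> mdist X (edge_path f s) (edge_path f t)"
    if st: "s \<in> {0..real n}" "t \<in> {0..real n}" "s \<le> t" for s t
  proof -
    have e: "(0::real) \<in> {0..real n}" "real n \<in> {0..real n}" by auto
    have "mdist X (edge_path f 0) (edge_path f (real n)) = real n"
      using mdist_vertices[OF f f] ex[of 0 n] by simp
    then show ?thesis
      using mdist_triangle[OF inX[OF e(1)] inX[OF st(1)] inX[OF e(2)]]
        mdist_triangle[OF inX[OF st(1)] inX[OF st(2)] inX[OF e(2)]]
        up[OF e(1) st(1)] up[OF st(2) e(2)] st by auto
  qed
  then show ?thesis using up inX by (intro quasi_geodesicI) auto
qed

lemma geodesic_ray_edge_path:
  assumes f: "\<And>n. f n \<in> carrier G"
    and ex: "\<And>i j. real (gd (f i) (f j)) = \<bar>real i - real j\<bar>"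
  shows "geodesic X {0..} (edge_path f)"
proof (rule quasi_geodesicI)
  have geo: "geodesic X {0..real n} (edge_path f)" for n
    by (rule geodesic_edge_path[OF f]) (rule ex)
  show "edge_path f \<in> {0..} \<rightarrow> mspace X"
  proof
    fix t :: real assume "t \<in> {0..}"
    then have "t \<in> {0..real (nat \<lceil>t\<rceil>)}" by auto
    then show "edge_path f t \<in> mspace X" using quasi_geodesicD(5)[OF geo] by blast
  qed
  fix s t :: real assume "s \<in> {0..}" "t \<in> {0..}" "s \<le> t"
  then have "s \<in> {0..real (nat \<lceil>t\<rceil>)}" "t \<in> {0..real (nat \<lceil>t\<rceil>)}" "\<bar>s - t\<bar> = t - s" by auto linarith+
  then show "t - s \<le> 1 * (mdist X (edge_path f s) (edge_path f t) + 0)"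
    "mdist X (edge_path f s) (edge_path f t) \<le> 1 * (t - s) + 0"
    using quasi_geodesicD(6,7)[OF geo, of s "nat \<lceil>t\<rceil>" t] by simp_all
qed (auto simp: is_interval_ci)

text \<open>Left translations and changes of generators are only needed up to bounded error, so it
  suffices to move vertices.\<close>

lemma quasi_isometric_embedding_of_vertices:
  assumes A': "finite_generating_set G A'" and k: "k \<in> carrier G" and K: "K \<ge> 1"
    and le: "\<And>g h. g \<in> carrier G \<Longrightarrow> h \<in> carrier G \<Longrightarrow>
      real (combinatorial_dist (cayley_edges G A') g h) \<le> K * real (gd g h) \<and>
      real (gd g h) \<le> K * real (combinatorial_dist (cayley_edges G A') g h)"
  shows "quasi_isometric_embedding X (cayley_graph G A') K (2 * K) (\<lambda>p. vertex (k \<otimes> nearby_vertex p))"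
proof -
  interpret B: cayley G A' by unfold_locales (rule A')
  show ?thesis
    unfolding quasi_isometric_embedding_def
  proof (intro conjI ballI)
    fix p q assume pq: "p \<in> mspace X" "q \<in> mspace X"
    let ?g = "nearby_vertex p" and ?h = "nearby_vertex q"
    have c: "?g \<in> carrier G" "?h \<in> carrier G" using pq by auto
    have d: "mdist B.X (vertex (k \<otimes> ?g)) (vertex (k \<otimes> ?h)) = real (B.gd ?g ?h)"
      using B.mdist_vertices k c by simp
    have "K * real (gd ?g ?h) \<le> K * (mdist X p q + 2)"
      using gd_nearby_vertex[OF pq] K by (intro mult_left_mono) auto
    then show "mdist B.X (vertex (k \<otimes> ?g)) (vertex (k \<otimes> ?h)) \<le> K * mdist X p q + 2 * K"
      using le[OF c] d by (simp add: algebra_simps)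
    show "mdist X p q \<le> K * mdist B.X (vertex (k \<otimes> ?g)) (vertex (k \<otimes> ?h)) + 2 * K"
      using le[OF c] d gd_nearby_vertex(2)[OF pq] K by simp
  qed (use k K in auto)
qed

lemma quasi_isometric_embedding_translation:
  assumes "k \<in> carrier G"
  shows "quasi_isometric_embedding X X 1 2 (\<lambda>p. vertex (k \<otimes> nearby_vertex p))"
  using quasi_isometric_embedding_of_vertices[OF fgs assms, of 1] by simp

lemma word_metrics_comparable:
  assumes "finite_generating_set G A'"
  shows "\<exists>K. \<forall>g\<in>carrier G. \<forall>h\<in>carrier G. combinatorial_dist (cayley_edges G A') g h \<le> K * gd g h"
proof -
  interpret B: cayley G A' by unfold_locales (rule assms)
  have A: "finite A" "A \<subseteq> carrier G" using fgs by (auto simp: finite_generating_set_def)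
  define K where "K = (\<Sum>a\<in>A. B.gd \<one> a)"
  have "B.gd g h \<le> K * n" if "(g, h) \<in> cayley_edges G A ^^ n" "g \<in> carrier G" for g h n
    using that
  proof (induction n arbitrary: h)
    case (Suc n)
    then obtain z where z: "(g, z) \<in> cayley_edges G A ^^ n" "(z, h) \<in> cayley_edges G A" by auto
    then have c: "z \<in> carrier G" "h \<in> carrier G" "inv z \<otimes> h \<in> A" by (auto simp: cayley_edges_def)
    have "B.gd z h \<le> K"
      using B.gd_one[OF c(1,2)] member_le_sum[of "inv z \<otimes> h" A "\<lambda>a. B.gd \<one> a"] A c by (simp add: K_def)
    then show ?case using B.gd_triangle[of g z h] Suc.IH[OF z(1)] Suc.prems c by simp
  qed simp
  then show ?thesis using gd_path by blast
qed

lemma quasi_isometric_embedding_change_of_generators: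
  assumes "finite_generating_set G A'"
  shows "\<exists>K. \<forall>k\<in>carrier G.
    quasi_isometric_embedding X (cayley_graph G A') K (2 * K) (\<lambda>p. vertex (k \<otimes> nearby_vertex p)) \<and>
    quasi_isometric_embedding (cayley_graph G A') X K (2 * K) (\<lambda>p. vertex (k \<otimes> nearby_vertex p))"
proof -
  interpret B: cayley G A' by unfold_locales (rule assms)
  obtain K\<^sub>1 where K1: "\<And>g h. g \<in> carrier G \<Longrightarrow> h \<in> carrier G \<Longrightarrow> B.gd g h \<le> K\<^sub>1 * gd g h"
    using word_metrics_comparable[OF assms] by blast
  obtain K\<^sub>2 where K2: "\<And>g h. g \<in> carrier G \<Longrightarrow> h \<in> carrier G \<Longrightarrow> gd g h \<le> K\<^sub>2 * B.gd g h"
    using B.word_metrics_comparable[OF fgs] by blast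
  define K where "K = real (max 1 (max K\<^sub>1 K\<^sub>2))"
  have K: "K \<ge> 1" by (simp add: K_def)
  have le1: "real (B.gd g h) \<le> K * real (gd g h)" if "g \<in> carrier G" "h \<in> carrier G" for g h
  proof -
    have "real (B.gd g h) \<le> real K\<^sub>1 * real (gd g h)" using K1[OF that] by (metis of_nat_mono of_nat_mult)
    also have "\<dots> \<le> K * real (gd g h)" by (intro mult_right_mono) (auto simp: K_def)
    finally show ?thesis .
  qed
  have le2: "real (gd g h) \<le> K * real (B.gd g h)" if "g \<in> carrier G" "h \<in> carrier G" for g h
  proof -
    have "real (gd g h) \<le> real K\<^sub>2 * real (B.gd g h)" using K2[OF that] by (metis of_nat_mono of_nat_mult)
    also have "\<dots> \<le> K * real (B.gd g h)" by (intro mult_right_mono) (auto simp: K_def)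
    finally show ?thesis .
  qed
  have "quasi_isometric_embedding X B.X K (2 * K) (\<lambda>p. vertex (k \<otimes> nearby_vertex p))"
    "quasi_isometric_embedding B.X X K (2 * K) (\<lambda>p. vertex (k \<otimes> nearby_vertex p))"
    if "k \<in> carrier G" for k
    using quasi_isometric_embedding_of_vertices[OF assms that K]
      B.quasi_isometric_embedding_of_vertices[OF fgs that K] le1 le2 by blast+
  then show ?thesis by blast
qed

lemma quasi_isometric_embedding_cong:
  assumes "quasi_isometric_embedding Y Z K C \<psi>" "\<And>p. p \<in> mspace Y \<Longrightarrow> \<psi> p = \<psi>' p"
  shows "quasi_isometric_embedding Y Z K C \<psi>'"
  using assms unfolding quasi_isometric_embedding_def by (auto simp: Pi_iff)

lemma local_to_global_X:
  assumes "morse_local_to_global_group G"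
  shows "morse_local_to_global_space X"
proof -
  obtain A' where A': "finite_generating_set G A'" "morse_local_to_global_space (cayley_graph G A')"
    using assms unfolding morse_local_to_global_group_def by blast
  interpret B: cayley G A' by unfold_locales (rule A')
  obtain K where K: "quasi_isometric_embedding X B.X K (2 * K) (\<lambda>p. vertex (\<one> \<otimes> nearby_vertex p))"
    "quasi_isometric_embedding B.X X K (2 * K) (\<lambda>p. vertex (\<one> \<otimes> nearby_vertex p))"
    using quasi_isometric_embedding_change_of_generators[OF A'(1)] by blast
  have "quasi_isometric_embedding X B.X K (2 * K) (\<lambda>p. vertex (nearby_vertex p))"
    by (rule quasi_isometric_embedding_cong[OF K(1)]) simp
  moreover have "quasi_isometric_embedding B.X X K (2 * K) (\<lambda>p. vertex (nearby_vertex p))"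
    by (rule quasi_isometric_embedding_cong[OF K(2)]) simp
  ultimately show ?thesis
  proof (rule morse_local_to_global_space_quasi_isometric[OF A'(2)])
    show "mdist X (vertex (nearby_vertex (vertex (nearby_vertex p)))) p \<le> 1" if "p \<in> mspace X" for p
      using mdist_nearby_vertex[OF that] by (simp add: mdist_commute)
  qed simp
qed

end

text \<open>Koenig's lemma: the values of \<open>f\<close> are fixed one after the other, each time keeping infinitely many
  indices.\<close>

lemma pointwise_limit_exists:
  fixes F :: "nat \<Rightarrow> nat \<Rightarrow> 'b"
  assumes "\<And>m. finite (range (\<lambda>k. F k m))"
  shows "\<exists>f. \<forall>n. infinite {k. \<forall>m\<le>n. F k m = f m}"
proof -
  have step: "\<exists>v. infinite {k \<in> K. F k m = v}" if "infinite K" for K m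
  proof -
    have "finite ((\<lambda>k. F k m) ` K)" using assms[of m] by (rule finite_subset[rotated]) auto
    from pigeonhole_infinite[OF that this] show ?thesis by blast
  qed
  define P where "P n g \<longleftrightarrow> infinite {k. \<forall>m\<le>n. F k m = g m}" for n and g :: "nat \<Rightarrow> 'b"
  have "\<exists>g. \<forall>n. P n (g n) \<and> (\<forall>m\<le>n. g (Suc n) m = g n m)"
  proof (rule dependent_nat_choice)
    obtain v where "infinite {k \<in> UNIV. F k 0 = v}" using step[of UNIV 0] by auto
    then have "P 0 (\<lambda>_. v)" by (simp add: P_def)
    then show "\<exists>g. P 0 g" by blast
    fix g n assume "P n g"
    then obtain v where v: "infinite {k \<in> {k. \<forall>m\<le>n. F k m = g m}. F k (Suc n) = v}"
      using step unfolding P_def by blast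
    have "{k \<in> {k. \<forall>m\<le>n. F k m = g m}. F k (Suc n) = v} = {k. \<forall>m\<le>Suc n. F k m = (g(Suc n := v)) m}"
      by (auto simp: le_Suc_eq)
    then show "\<exists>g'. P (Suc n) g' \<and> (\<forall>m\<le>n. g' m = g m)"
      using v by (intro exI[of _ "g(Suc n := v)"]) (simp add: P_def)
  qed
  then obtain g where g: "\<And>n. P n (g n)" "\<And>n m. m \<le> n \<Longrightarrow> g (Suc n) m = g n m" by blast
  have eq: "g n m = g m m" if "m \<le> n" for m n
    using that by (induction n rule: dec_induct) (auto simp: g(2))
  then have "{k. \<forall>m\<le>n. F k m = g n m} = {k. \<forall>m\<le>n. F k m = g m m}" for n
  proof (intro Collect_cong)
    show "(\<forall>m\<le>n. F k m = g n m) \<longleftrightarrow> (\<forall>m\<le>n. F k m = g m m)" for k using eq[of _ n] by metis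
  qed
  then have "infinite {k. \<forall>m\<le>n. F k m = g m m}" for n using g(1)[of n] unfolding P_def by simp
  then show ?thesis by (intro exI[of _ "\<lambda>m. g m m"] allI)
qed

lemma pointwise_limit_subsequence:
  fixes F :: "nat \<Rightarrow> nat \<Rightarrow> 'b"
  assumes "\<And>m. finite (range (\<lambda>k. F k m))"
  obtains f \<kappa> where "\<And>n. n \<le> \<kappa> n" "\<And>n m. m \<le> n \<Longrightarrow> F (\<kappa> n) m = f m"
proof -
  obtain f where "\<And>n. infinite {k. \<forall>m\<le>n. F k m = f m}"
    using pointwise_limit_exists[of F] assms by blast
  then have "\<exists>k. n \<le> k \<and> (\<forall>m\<le>n. F k m = f m)" for n
    unfolding infinite_nat_iff_unbounded_le by blast
  then show thesis using that by metis
qed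

section \<open>Limits in the Morse boundary\<close>

lemma compact_open_nbhd_contains_agreeing:
  assumes "openin (compact_open_topology X F) W" "\<beta> \<in> W"
  shows "\<exists>n::nat. \<forall>\<gamma>\<in>F. (\<forall>t\<in>{0..real n}. \<gamma> t = \<beta> t) \<longrightarrow> \<gamma> \<in> W"
proof -
  let ?S = "{{\<gamma> \<in> F. \<gamma> ` K \<subseteq> U} | K U. compact K \<and> K \<subseteq> {0..} \<and> openin (mtopology_of X) U}"
  have "generate_topology_on ?S W"
    using assms(1) unfolding compact_open_topology_def openin_topology_generated_by_iff .
  then show ?thesis using assms(2)
  proof induction
    case Empty
    then show ?case by simp
  next
    case (Int a b)
    then obtain n m where n: "\<forall>\<gamma>\<in>F. (\<forall>t\<in>{0..real n}. \<gamma> t = \<beta> t) \<longrightarrow> \<gamma> \<in> a"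
      and m: "\<forall>\<gamma>\<in>F. (\<forall>t\<in>{0..real m}. \<gamma> t = \<beta> t) \<longrightarrow> \<gamma> \<in> b" by blast
    show ?case
    proof (intro exI[of _ "max n m"] ballI impI)
      fix \<gamma> assume g: "\<gamma> \<in> F" "\<forall>t\<in>{0..real (max n m)}. \<gamma> t = \<beta> t"
      then have "\<forall>t\<in>{0..real n}. \<gamma> t = \<beta> t" "\<forall>t\<in>{0..real m}. \<gamma> t = \<beta> t" by auto
      then show "\<gamma> \<in> a \<inter> b" using n m g(1) by blast
    qed
  next
    case (UN K)
    then obtain k where k: "k \<in> K" "\<beta> \<in> k" by blast
    then obtain n where "\<forall>\<gamma>\<in>F. (\<forall>t\<in>{0..real n}. \<gamma> t = \<beta> t) \<longrightarrow> \<gamma> \<in> k" using UN.IH by blast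
    then show ?case using k(1) by blast
  next
    case (Basis s)
    then obtain K U where s: "s = {\<gamma> \<in> F. \<gamma> ` K \<subseteq> U}" "compact K" "K \<subseteq> {0..}" by blast
    obtain b where b: "\<And>x. x \<in> K \<Longrightarrow> \<bar>x\<bar> \<le> b"
      using compact_imp_bounded[OF s(2)] unfolding bounded_iff by auto
    show ?case
    proof (intro exI[of _ "nat \<lceil>b\<rceil>"] ballI impI)
      fix \<gamma> assume g: "\<gamma> \<in> F" "\<forall>t\<in>{0..real (nat \<lceil>b\<rceil>)}. \<gamma> t = \<beta> t"
      have "K \<subseteq> {0..real (nat \<lceil>b\<rceil>)}"
      proof
        fix x assume "x \<in> K"
        then have "0 \<le> x" "x \<le> b" using s(3) b[of x] by auto
        then show "x \<in> {0..real (nat \<lceil>b\<rceil>)}" by auto linarith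
      qed
      then have "\<gamma> ` K = \<beta> ` K" using g(2) by (intro image_cong) auto
      then show "\<gamma> \<in> s" using g(1) Basis.prems unfolding s(1) by auto
    qed
  qed
qed

text \<open>A neighbourhood in the compact-open topology constrains a ray only on a compact interval, so
  agreement on longer and longer intervals is convergence within the stratum of the common
  gauge, and a neighbourhood in the direct limit topology restricts to one in the stratum.\<close>

lemma in_closure_of_morse_boundary:
  assumes M: "morse_gauge M" and \<beta>: "\<beta> \<in> morse_rays_of_gauge X e M"
    and approx: "\<And>n::nat. \<exists>\<gamma>\<in>morse_rays_of_gauge X e M.
      (\<forall>t\<in>{0..real n}. \<gamma> t = \<beta> t) \<and> asymptotic X e `` {\<gamma>} \<in> S"
  shows "asymptotic X e `` {\<beta>} \<in> morse_boundary X e closure_of S"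
  unfolding in_closure_of
proof (intro conjI allI impI)
  have st: "asymptotic X e `` {\<gamma>} \<in> boundary_stratum X e M" if "\<gamma> \<in> morse_rays_of_gauge X e M" for \<gamma>
    using asymptotic_class_in_stratum[OF M that] .
  then show "asymptotic X e `` {\<beta>} \<in> topspace (morse_boundary X e)"
    using \<beta> by (auto simp: boundary_stratum_def)
  fix U assume U: "asymptotic X e `` {\<beta>} \<in> U \<and> openin (morse_boundary X e) U"
  let ?W = "{\<gamma> \<in> morse_rays_of_gauge X e M. asymptotic X e `` {\<gamma>} \<in> U \<inter> boundary_stratum X e M}"
  have "openin (compact_open_topology X (morse_rays_of_gauge X e M)) ?W"
    using U M unfolding openin_morse_boundary openin_stratum_topology by blast
  moreover have "\<beta> \<in> ?W" using \<beta> U st by blast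
  ultimately obtain n :: nat where
    n: "\<forall>\<gamma>\<in>morse_rays_of_gauge X e M. (\<forall>t\<in>{0..real n}. \<gamma> t = \<beta> t) \<longrightarrow> \<gamma> \<in> ?W"
    using compact_open_nbhd_contains_agreeing by blast
  obtain \<gamma> where "\<gamma> \<in> morse_rays_of_gauge X e M" "\<forall>t\<in>{0..real n}. \<gamma> t = \<beta> t"
      "asymptotic X e `` {\<gamma>} \<in> S"
    using approx by blast
  then show "\<exists>y. y \<in> S \<and> y \<in> U" using n by blast
qed

text \<open>The gauge depends only on the gauge of \<open>\<alpha>\<close> and on the distance \<open>R\<close>, so all rays at a given distance
  lie in one stratum.\<close>

lemma geodesic_ray_near_morse_ray:
  assumes M: "morse_gauge M" and \<alpha>: "\<alpha> \<in> morse_rays_of_gauge X e M"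
    and \<beta>: "geodesic X {0..} \<beta>" "\<beta> 0 = e"
    and near: "\<And>x. x \<ge> 0 \<Longrightarrow> \<exists>u\<ge>0. mdist X (\<beta> x) (\<alpha> u) \<le> R"
  shows "restrict \<beta> {0..} \<in> morse_rays_of_gauge X e (transported_gauge 1 0 1 0 1 0 R M)"
    and "(\<alpha>, restrict \<beta> {0..}) \<in> asymptotic X e"
    and "morse_gauge (transported_gauge 1 0 1 0 1 0 R M)"
proof -
  let ?\<beta> = "restrict \<beta> {0..}" and ?M = "transported_gauge 1 0 1 0 1 0 R M"
  have geo: "geodesic X {0..} \<alpha>" "morse X M {0..} \<alpha>"
    using \<alpha> by (auto simp: morse_rays_of_gauge_def geodesic_rays_def)
  have \<beta>': "geodesic X {0..} ?\<beta>" using \<beta>(1) by (auto simp: quasi_geodesic_def Pi_iff)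
  obtain r where r: "\<And>x. x \<ge> 0 \<Longrightarrow> r x \<ge> 0 \<and> mdist X (\<beta> x) (\<alpha> (r x)) \<le> R"
    using near by metis
  have R: "R \<ge> 0" using r[of 0] mdist_nonneg[of X "\<beta> 0" "\<alpha> (r 0)"] by linarith
  show gauge: "morse_gauge ?M" using M R by (intro morse_gauge_transported) auto
  have "morse X ?M {0..} ?\<beta>"
    by (rule morse_transport[OF geo M _ _ _ _ _ quasi_isometric_embedding_id, where r = r])
      (use r R quasi_geodesicD[OF \<beta>'] in auto)
  then show ray: "?\<beta> \<in> morse_rays_of_gauge X e ?M"
    using \<beta> \<beta>' by (auto simp: morse_rays_of_gauge_def geodesic_rays_def quasi_geodesic_def)
  have "bounded_hausdorff_dist X (?\<beta> ` {0..}) (\<alpha> ` {0..})"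
    by (rule quasi_geodesic_ray_near_ray[OF geo(1) \<beta>', of r R]) (use r in auto)
  then show "(\<alpha>, ?\<beta>) \<in> asymptotic X e"
    using bounded_hausdorff_dist_sym ray \<alpha> M gauge by (auto simp: asymptotic_def morse_rays_def)
qed


section \<open>Discretised Morse rays and limits of geodesics\<close>

context cayley begin

abbreviation "e \<equiv> vertex \<one>"

text \<open>A Morse ray is replaced by the sequence of vertices next to its points at integer times.\<close>

lemma discretise_morse_ray:
  assumes M: "morse_gauge M" and \<alpha>: "\<alpha> \<in> morse_rays_of_gauge X e M"
  obtains f where "rough_geodesic UNIV f" "f 0 = \<one>"
    "\<And>t. t \<ge> 0 \<Longrightarrow> mdist X (step_path f t) (\<alpha> t) \<le> 2"
    "morse X (transported_gauge 1 0 1 4 1 0 2 M) {0..} (step_path f)"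
proof -
  have geo: "geodesic X {0..} \<alpha>" "morse X M {0..} \<alpha>" "\<alpha> 0 = e"
    using \<alpha> by (auto simp: morse_rays_of_gauge_def geodesic_rays_def)
  note D = quasi_geodesicD[OF geo(1)]
  define f where "f n = nearby_vertex (\<alpha> (real n))" for n
  have f: "f n \<in> carrier G" for n using D(5) by (simp add: f_def)
  have vf: "vertex (f n) \<in> mspace X" for n using f by simp
  have near: "mdist X (vertex (f n)) (\<alpha> (real n)) \<le> 1" for n
    using mdist_nearby_vertex[OF D(5), of "real n"] by (simp add: f_def mdist_commute)
  have rough: "rough_geodesic UNIV f"
    unfolding rough_geodesic_def
  proof (intro conjI allI ballI)
    fix i j
    have m: "\<alpha> (real i) \<in> mspace X" "\<alpha> (real j) \<in> mspace X" using D(5) by auto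
    have "mdist X (\<alpha> (real i)) (\<alpha> (real j)) = \<bar>real i - real j\<bar>"
      using D(6)[of "real i" "real j"] D(7)[of "real i" "real j"] by simp
    moreover have "mdist X (vertex (f i)) (vertex (f j)) = real (gd (f i) (f j))"
      using mdist_vertices f by simp
    ultimately show "\<bar>real (gd (f i) (f j)) - \<bar>real i - real j\<bar>\<bar> \<le> 2"
      using gd_nearby_vertex[OF m] unfolding f_def by linarith
  qed (rule f)
  have close: "mdist X (step_path f t) (\<alpha> t) \<le> 2" if t: "t \<ge> 0" for t
  proof -
    let ?n = "nat \<lfloor>t\<rfloor>"
    have n: "real ?n \<le> t" "t \<le> real ?n + 1" using t by auto
    have "\<bar>real ?n - t\<bar> \<le> 1" using n by linarith
    moreover have "mdist X (\<alpha> (real ?n)) (\<alpha> t) \<le> 1 * \<bar>real ?n - t\<bar> + 0"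
      by (rule D(7)) (use t in auto)
    ultimately have "mdist X (\<alpha> (real ?n)) (\<alpha> t) \<le> 1"
      by (simp only: mult_1 add_0_right)
    then show ?thesis
      using mdist_triangle[OF vf D(5) D(5), of "real ?n" t ?n] near[of ?n] t unfolding step_path_def by simp
  qed
  have q: "quasi_geodesic X 1 4 {0..} (step_path f)"
    by (rule quasi_geodesic_step_path[OF rough]) (auto simp: is_interval_ci)
  have "morse X (transported_gauge 1 0 1 4 1 0 2 M) {0..} (step_path f)"
    by (rule morse_transport[OF geo(1,2) M _ _ _ _ _ quasi_isometric_embedding_id, where r = "\<lambda>x. x"])
      (use quasi_geodesicD[OF q] close in auto)
  moreover have "f 0 = \<one>" by (simp add: f_def geo)
  ultimately show thesis using that rough close by blast
qed

text \<open>By local finiteness, geodesics from the identity to the ends of longer and longer uniformly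
  Morse quasi-geodesics subconverge to a geodesic ray.\<close>

lemma limit_of_geodesics:
  fixes h :: "nat \<Rightarrow> 'a"
  assumes M: "morse_gauge M"
    and qg: "\<And>n. quasi_geodesic X k c {0..l n} (\<eta> n)" "\<And>n. morse X M {0..l n} (\<eta> n)"
    and ends: "\<And>n. \<eta> n 0 = e" "\<And>n. \<eta> n (l n) = vertex (h n)" "\<And>n. h n \<in> carrier G"
    and long: "\<And>n. real n \<le> l n"
  obtains w \<kappa> v where "\<And>n. n \<le> \<kappa> n" "\<And>n. n \<le> gd \<one> (h (\<kappa> n))"
    "w 0 = \<one>" "\<And>n. w n \<in> carrier G" "\<And>i j. real (gd (w i) (w j)) = \<bar>real i - real j\<bar>"
    "\<And>n x. x \<in> {0..real n} \<Longrightarrow> edge_path (v n) x = edge_path w x"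
    "\<And>n. geodesic_segment X (real (gd \<one> (h (\<kappa> n)))) (edge_path (v n)) e (vertex (h (\<kappa> n)))"
    "\<And>n. morse X (transported_gauge k c 1 0 1 0 (M 1 0) M) {0..real (gd \<one> (h (\<kappa> n)))} (edge_path (v n))"
    "\<And>n x. x \<in> {0..real n} \<Longrightarrow> \<exists>u\<in>{0..l (\<kappa> n)}.
       mdist X (edge_path w x) (\<eta> (\<kappa> n) u) \<le> M 1 0 \<and> u \<le> k * (x + M 1 0 + c)"
proof -
  have k: "k \<ge> 1" "c \<ge> 0" using quasi_geodesicD[OF qg(1)[of 0]] by auto
  define \<sigma> where "\<sigma> n = nat \<lceil>k * (real n + c)\<rceil>" for n
  \<comment> \<open>Passing to the indices \<open>\<sigma> n\<close> makes the \<open>n\<close>-th geodesic at least \<open>n\<close> long.\<close>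
  have \<sigma>: "k * (real n + c) \<le> real (\<sigma> n)" for n unfolding \<sigma>_def by linarith
  have \<sigma>n: "n \<le> \<sigma> n" for n
  proof -
    have "real n + c \<le> k * (real n + c)" using k mult_right_mono[of 1 k "real n + c"] by simp
    then show ?thesis using \<sigma>[of n] k by linarith
  qed
  define g where "g n = gd \<one> (h (\<sigma> n))" for n
  have gn: "n \<le> g n" for n
  proof -
    have 1: "real (\<sigma> n) \<le> l (\<sigma> n)" using long by simp
    have "mdist X e (vertex (h (\<sigma> n))) = real (g n)" using mdist_vertices ends by (simp add: g_def)
    then have "l (\<sigma> n) \<le> k * (real (g n) + c)"
      using quasi_geodesicD(6)[OF qg(1)[of "\<sigma> n"], of 0 "l (\<sigma> n)"] 1 ends by simp
    then have "k * (real n + c) \<le> k * (real (g n) + c)" using \<sigma>[of n] 1 by linarith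
    then show ?thesis using k by simp
  qed
  have "\<exists>v. v 0 = \<one> \<and> v (g n) = h (\<sigma> n) \<and> (\<forall>i. v i \<in> carrier G) \<and>
      (\<forall>i j. i \<le> g n \<longrightarrow> j \<le> g n \<longrightarrow> real (gd (v i) (v j)) = \<bar>real i - real j\<bar>)" for n
    unfolding g_def using exact_geodesic[OF one_closed ends(3)] by metis
  then obtain v where v: "\<And>n. v n 0 = \<one>" "\<And>n. v n (g n) = h (\<sigma> n)" "\<And>n i. v n i \<in> carrier G"
    "\<And>n i j. i \<le> g n \<Longrightarrow> j \<le> g n \<Longrightarrow> real (gd (v n i) (v n j)) = \<bar>real i - real j\<bar>" by metis
  define F where "F n m = v n (min m (g n))" for n m
  have fin: "finite (range (\<lambda>n. F n m))" for m
  proof (rule finite_subset)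
    show "range (\<lambda>n. F n m) \<subseteq> {x \<in> carrier G. gd \<one> x \<le> m}"
    proof
      fix x assume "x \<in> range (\<lambda>n. F n m)"
      then obtain n where x: "x = v n (min m (g n))" by (auto simp: F_def)
      have "real (gd (v n 0) (v n (min m (g n)))) = \<bar>real 0 - real (min m (g n))\<bar>" by (rule v(4)) auto
      then show "x \<in> {x \<in> carrier G. gd \<one> x \<le> m}" using v(1,3) x by simp
    qed
  qed (rule finite_ball)
  obtain w \<kappa> where \<kappa>: "\<And>n. n \<le> \<kappa> n" and w: "\<And>n m. m \<le> n \<Longrightarrow> F (\<kappa> n) m = w m"
    by (rule pointwise_limit_subsequence[of F, OF fin]) blast
  have g\<kappa>: "n \<le> g (\<kappa> n)" for n using \<kappa>[of n] gn[of "\<kappa> n"] by linarith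
  have vw: "v (\<kappa> n) m = w m" if "m \<le> n" for n m
    using w[OF that] g\<kappa>[of n] that by (simp add: F_def min_absorb1)
  have wc: "w n \<in> carrier G" for n using vw[of n n] v(3)[of "\<kappa> n" n] by simp
  have exact: "real (gd (w i) (w j)) = \<bar>real i - real j\<bar>" for i j
    using v(4)[of i "\<kappa> (max i j)" j] vw[of i "max i j"] vw[of j "max i j"] g\<kappa>[of "max i j"] by simp
  have w0: "w 0 = \<one>" using vw[of 0 0] v(1) by simp
  have cong: "edge_path (v (\<kappa> n)) x = edge_path w x" if "x \<in> {0..real n}" for n x
    by (rule edge_path_cong[of n]) (use vw that in auto)
  have seg: "geodesic_segment X (real (g (\<kappa> n))) (edge_path (v (\<kappa> n))) e (vertex (h (\<sigma> (\<kappa> n))))" for n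
    unfolding geodesic_segment_def using geodesic_edge_path[OF v(3) v(4), of "g (\<kappa> n)"] v(1,2) by simp
  have ends': "\<eta> (\<sigma> (\<kappa> n)) 0 = edge_path (v (\<kappa> n)) 0" 
    "\<eta> (\<sigma> (\<kappa> n)) (l (\<sigma> (\<kappa> n))) = edge_path (v (\<kappa> n)) (real (g (\<kappa> n)))" for n
    using ends v by simp_all
  have l0: "0 \<le> l n" for n using long[of n] by linarith
  have geo: "geodesic X {0..real (g (\<kappa> n))} (edge_path (v (\<kappa> n)))" for n
    using seg[of n] by (simp add: geodesic_segment_def)
  have mor: "morse X (transported_gauge k c 1 0 1 0 (M 1 0) M) {0..real (g (\<kappa> n))} (edge_path (v (\<kappa> n)))" for n
    by (rule geodesic_near_morse_quasi_geodesic(2)[OF qg(1)[of "\<sigma> (\<kappa> n)"] l0 qg(2) M geo])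
      (simp_all add: ends' del: edge_path_of_nat)
  have close: "\<exists>u\<in>{0..l (\<sigma> (\<kappa> n))}. mdist X (edge_path w x) (\<eta> (\<sigma> (\<kappa> n)) u) \<le> M 1 0 \<and> u \<le> k * (x + M 1 0 + c)"
    if x: "x \<in> {0..real n}" for n x
  proof -
    have xg: "x \<in> {0..real (g (\<kappa> n))}" using x g\<kappa>[of n] by auto
    obtain u where u: "u \<in> {0..l (\<sigma> (\<kappa> n))}" "mdist X (edge_path (v (\<kappa> n)) x) (\<eta> (\<sigma> (\<kappa> n)) u) \<le> M 1 0"
      using geodesic_near_morse_quasi_geodesic(1)[OF qg(1)[of "\<sigma> (\<kappa> n)"] l0 qg(2) M geo[of n] _ ends'(1)[symmetric] ends'(2)[symmetric] xg]
      by auto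
    have m: "edge_path w x \<in> mspace X" "\<eta> (\<sigma> (\<kappa> n)) u \<in> mspace X"
      using quasi_geodesicD(5)[OF geo xg] quasi_geodesicD(5)[OF qg(1) u(1)] cong[OF x] by simp_all
    have "mdist X e (edge_path w x) \<le> x"
      using quasi_geodesicD(7)[OF geo, of 0 n x] xg v(1) cong[OF x] by simp
    then have d: "mdist X e (\<eta> (\<sigma> (\<kappa> n)) u) \<le> x + M 1 0"
      using mdist_triangle[of e X "edge_path w x" "\<eta> (\<sigma> (\<kappa> n)) u"] m u(2) cong[OF x] by simp
    have "u \<le> k * (mdist X e (\<eta> (\<sigma> (\<kappa> n)) u) + c)"
      using quasi_geodesicD(6)[OF qg(1)[of "\<sigma> (\<kappa> n)"], of 0 u] u(1) ends by simp
    also have "\<dots> \<le> k * (x + M 1 0 + c)" using d k by (intro mult_left_mono) auto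
    finally show ?thesis using u cong[OF x] by auto
  qed
  have "n \<le> \<sigma> (\<kappa> n)" "n \<le> gd \<one> (h (\<sigma> (\<kappa> n)))" for n
    using \<kappa>[of n] \<sigma>n[of "\<kappa> n"] g\<kappa>[of n] by (auto simp: g_def)
  then show thesis
    using that[of "\<lambda>n. \<sigma> (\<kappa> n)" w "\<lambda>n. v (\<kappa> n)"] w0 wc exact cong seg mor close unfolding g_def by blast
qed

text \<open>The paths \<open>\<eta>\<close> end in \<open>H\<close> and follow \<open>\<alpha>\<close> longer and longer, so the geodesics between their
  endpoints subconverge to a ray near \<open>\<alpha>\<close>; they are uniformly Morse, as the \<open>\<eta>\<close> are.\<close>

lemma in_limit_set_if_followed:
  assumes M: "morse_gauge M" and \<alpha>: "\<alpha> \<in> morse_rays_of_gauge X e M"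
    and M': "morse_gauge M'" and H: "H \<subseteq> carrier G"
    and follow: "\<And>n::nat. \<exists>h\<in>H. \<exists>l \<eta>. quasi_geodesic X k c {0..l} \<eta> \<and> morse X M' {0..l} \<eta> \<and>
        \<eta> 0 = e \<and> \<eta> l = vertex h \<and> real n \<le> l \<and> (\<forall>t\<in>{0..real n}. mdist X (\<eta> t) (\<alpha> t) \<le> \<rho>)"
  shows "asymptotic X e `` {\<alpha>} \<in> limit_set G A H"
proof -
  obtain h l \<eta> where h: "\<And>n. h n \<in> H" and \<eta>: "\<And>n. quasi_geodesic X k c {0..l n} (\<eta> n)"
      "\<And>n. morse X M' {0..l n} (\<eta> n)" "\<And>n. \<eta> n 0 = e" "\<And>n. \<eta> n (l n) = vertex (h n)"
      "\<And>n. real n \<le> l n" "\<And>n t. t \<in> {0..real n} \<Longrightarrow> mdist X (\<eta> n t) (\<alpha> t) \<le> \<rho>"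
    using follow by metis
  have hc: "h n \<in> carrier G" for n using h H by blast
  have k: "k \<ge> 1" "c \<ge> 0" using quasi_geodesicD[OF \<eta>(1)[of 0]] by auto
  obtain w \<kappa> v where \<kappa>: "\<And>n. n \<le> \<kappa> n" "\<And>n. n \<le> gd \<one> (h (\<kappa> n))"
    and w: "w 0 = \<one>" "\<And>n. w n \<in> carrier G" "\<And>i j. real (gd (w i) (w j)) = \<bar>real i - real j\<bar>"
    and v: "\<And>n x. x \<in> {0..real n} \<Longrightarrow> edge_path (v n) x = edge_path w x"
      "\<And>n. geodesic_segment X (real (gd \<one> (h (\<kappa> n)))) (edge_path (v n)) e (vertex (h (\<kappa> n)))"
      "\<And>n. morse X (transported_gauge k c 1 0 1 0 (M' 1 0) M') {0..real (gd \<one> (h (\<kappa> n)))} (edge_path (v n))"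
    and close: "\<And>n x. x \<in> {0..real n} \<Longrightarrow> \<exists>u\<in>{0..l (\<kappa> n)}.
       mdist X (edge_path w x) (\<eta> (\<kappa> n) u) \<le> M' 1 0 \<and> u \<le> k * (x + M' 1 0 + c)"
    by (rule limit_of_geodesics[OF M' \<eta>(1-4) hc \<eta>(5)]) blast
  have geo: "geodesic X {0..} (edge_path w)" by (rule geodesic_ray_edge_path[OF w(2,3)])
  have M'0: "M' 1 0 \<ge> 0" using M' by (simp add: morse_gauge_def)
  have \<alpha>m: "\<alpha> t \<in> mspace X" if "t \<ge> 0" for t
    using \<alpha> that by (auto simp: morse_rays_of_gauge_def geodesic_rays_def)
  have near: "\<exists>u\<ge>0. mdist X (edge_path w x) (\<alpha> u) \<le> M' 1 0 + \<rho>" if x: "x \<ge> 0" for x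
  proof -
    define n where "n = nat \<lceil>max x (k * (x + M' 1 0 + c))\<rceil>"
    have n: "x \<le> real n" "k * (x + M' 1 0 + c) \<le> real n" unfolding n_def by linarith+
    obtain u where u: "u \<in> {0..l (\<kappa> n)}" "mdist X (edge_path w x) (\<eta> (\<kappa> n) u) \<le> M' 1 0"
        "u \<le> k * (x + M' 1 0 + c)"
      using close[of x n] x n by auto
    have "u \<le> real (\<kappa> n)" using u(3) n(2) \<kappa>(1)[of n] by linarith
    then have "mdist X (\<eta> (\<kappa> n) u) (\<alpha> u) \<le> \<rho>" using \<eta>(6) u(1) by simp
    then have "mdist X (edge_path w x) (\<alpha> u) \<le> M' 1 0 + \<rho>"
      using mdist_triangle[of "edge_path w x" X "\<eta> (\<kappa> n) u" "\<alpha> u"] u(1,2) x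
        quasi_geodesicD(5)[OF geo] quasi_geodesicD(5)[OF \<eta>(1) u(1)] \<alpha>m[of u] by simp
    then show ?thesis using u(1) by auto
  qed
  have e0: "edge_path w 0 = e" using w(1) by simp
  note ray = geodesic_ray_near_morse_ray[OF M \<alpha> geo e0 near]
  let ?x = "asymptotic X e `` {\<alpha>}"
  have top: "?x \<in> topspace (cayley_boundary G A)"
    using asymptotic_class_in_stratum[OF M \<alpha>] by (auto simp: boundary_stratum_def)
  have conv: "segments_converge X (\<lambda>n. real (gd \<one> (h (\<kappa> n)))) (\<lambda>n. edge_path (v n)) (restrict (edge_path w) {0..})"
    unfolding segments_converge_def
  proof (intro allI impI)
    fix T \<epsilon> :: real assume T: "T \<ge> 0" "\<epsilon> > 0"
    show "\<forall>\<^sub>F n in sequentially. T \<le> real (gd \<one> (h (\<kappa> n))) \<and>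
        (\<forall>t\<in>{0..T}. mdist X (edge_path (v n) t) (restrict (edge_path w) {0..} t) < \<epsilon>)"
    proof (rule eventually_sequentiallyI[of "nat \<lceil>T\<rceil>"])
      fix n assume n: "nat \<lceil>T\<rceil> \<le> n"
      then have Tn: "T \<le> real n" by linarith
      have "T \<le> real (gd \<one> (h (\<kappa> n)))" using Tn \<kappa>(2)[of n] by linarith
      moreover have "mdist X (edge_path (v n) t) (restrict (edge_path w) {0..} t) < \<epsilon>" if "t \<in> {0..T}" for t
        using v(1)[of t n] that Tn T quasi_geodesicD(5)[OF geo, of t] by simp
      ultimately show "T \<le> real (gd \<one> (h (\<kappa> n))) \<and>
        (\<forall>t\<in>{0..T}. mdist X (edge_path (v n) t) (restrict (edge_path w) {0..} t) < \<epsilon>)" by blast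
    qed
  qed
  let ?M = "transported_gauge k c 1 0 1 0 (M' 1 0) M'"
  have "morse_gauge ?M" by (rule morse_gauge_transported[OF M' k]) (use M'0 in auto)
  moreover have "restrict (edge_path w) {0..} \<in> ?x" using ray(2) by simp
  ultimately show ?thesis
    unfolding limit_set_def using top h v(2,3) conv
    by (intro CollectI conjI exI[of _ ?M] exI[of _ "\<lambda>n. h (\<kappa> n)"]
        exI[of _ "\<lambda>n. real (gd \<one> (h (\<kappa> n)))"] exI[of _ "\<lambda>n. edge_path (v n)"]) auto
qed

section \<open>Morse elements from quasi-axes\<close>

text \<open>A geodesic from the identity to \<open>g\<^sup>q\<close>, in any Cayley graph, is compared with the
  Morse ray \<open>\<eta>\<close> after a change of generators; for a negative power it is first translated by the
  inverse, so that it ends at the identity.\<close>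

lemma morse_element_if_powers_along_morse_ray:
  assumes M: "morse_gauge M" and \<eta>: "quasi_geodesic X k c {0..} \<eta>" "morse X M {0..} \<eta>" "\<eta> 0 = e"
    and g: "g \<in> carrier G"
    and pow: "\<And>q::nat. \<exists>t\<ge>0. mdist X (vertex (g [^] q)) (\<eta> t) \<le> \<rho>"
      "\<And>t. t \<ge> 0 \<Longrightarrow> \<exists>q::nat. mdist X (\<eta> t) (vertex (g [^] q)) \<le> \<rho>"
  shows "morse_element G g" "infinite (generate G {g})"
proof -
  note D = quasi_geodesicD[OF \<eta>(1)]
  obtain q\<^sub>0 :: nat where "mdist X (\<eta> 0) (vertex (g [^] q\<^sub>0)) \<le> \<rho>" using pow(2)[of 0] by auto
  then have \<rho>: "\<rho> \<ge> 0" using mdist_nonneg[of X "\<eta> 0" "vertex (g [^] q\<^sub>0)"] by linarith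
  have gen: "generate G {g} = {g [^] z | z. z \<in> (UNIV :: int set)}" using generate_pow[OF g] by simp
  have nat_pow: "g [^] (q::nat) \<in> generate G {g}" "inv (g [^] q) \<in> generate G {g}" for q
  proof -
    show "g [^] q \<in> generate G {g}" unfolding gen using int_pow_int[of G g q]
      by (intro CollectI exI[of _ "int q"]) simp
    show "inv (g [^] q) \<in> generate G {g}" unfolding gen using int_pow_neg_int[OF g, of q]
      by (intro CollectI exI[of _ "- int q"]) simp
  qed
  have int_cases: "\<exists>q::nat. z = g [^] q \<or> z = inv (g [^] q)" if z: "z \<in> generate G {g}" for z
  proof -
    obtain i :: int where i: "z = g [^] i" using z gen by auto
    show ?thesis
    proof (cases "i \<ge> 0")
      case True
      then have "z = g [^] (nat i)" using i int_pow_int[of G g "nat i"] by simp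
      then show ?thesis by blast
    next
      case False
      then have "z = inv (g [^] (nat (- i)))" using i int_pow_neg_int[OF g, of "nat (- i)"] by simp
      then show ?thesis by blast
    qed
  qed
  have sub: "subgroup (generate G {g}) G" using generate_is_subgroup g by simp
  then have subc: "generate G {g} \<subseteq> carrier G" by (rule subgroup.subset)
  have "\<exists>M' K'. morse_gauge M' \<and> K' \<ge> 0 \<and> stable_in_cayley G A' M' K' (generate G {g})"
    if A': "finite_generating_set G A'" for A'
  proof -
    interpret B: cayley G A' by unfold_locales (rule A')
    obtain K where \<psi>: "\<And>j. j \<in> carrier G \<Longrightarrow>
        quasi_isometric_embedding B.X X K (2 * K) (\<lambda>p. vertex (j \<otimes> nearby_vertex p))"
      using quasi_isometric_embedding_change_of_generators[OF A'] by blast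
    have K: "K \<ge> 1" using \<psi>[OF one_closed] by (simp add: quasi_isometric_embedding_def)
    define N where "N = M K (2 * K + 2 * \<rho>) + \<rho>"
    have N: "N \<ge> 0" using M K \<rho> by (simp add: N_def morse_gauge_def)
    define K' where "K' = K * (N + \<rho>) + 2 * K"
    let ?M' = "transported_gauge k c 1 0 K (2 * K) N M"
    have st: "morse B.X ?M' {0..l} \<gamma> \<and> \<gamma> ` {0..l} \<subseteq> nbhd B.X K' (vertex ` generate G {g})"
      if seg: "geodesic_segment B.X l \<gamma> e (vertex z)" and z: "z \<in> generate G {g}" for l \<gamma> z
    proof -
      have l: "l \<ge> 0" and \<gamma>: "geodesic B.X {0..l} \<gamma>" "\<gamma> 0 = e" "\<gamma> l = vertex z"
        using seg by (auto simp: geodesic_segment_def)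
      note \<Gamma> = quasi_geodesicD[OF \<gamma>(1)]
      obtain j s t where j: "j \<in> generate G {g}" and s0: "s \<ge> 0" "t \<ge> 0"
        and st: "mdist X (vertex j) (\<eta> s) \<le> \<rho>" "mdist X (vertex (j \<otimes> z)) (\<eta> t) \<le> \<rho>"
      proof -
        have 0: "mdist X (vertex \<one>) (\<eta> 0) \<le> \<rho>" using \<rho> \<eta>(3) by simp
        obtain q :: nat where q: "z = g [^] q \<or> z = inv (g [^] q)" using int_cases[OF z] by blast
        obtain t where t: "t \<ge> 0" "mdist X (vertex (g [^] q)) (\<eta> t) \<le> \<rho>" using pow(1) by blast
        have gq: "g [^] q \<in> carrier G" using g by simp
        from q show thesis
        proof
          assume "z = g [^] q"
          then show thesis using that[of \<one> 0 t] 0 t gq subgroup.one_closed[OF sub] by simp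
        next
          assume "z = inv (g [^] q)"
          then show thesis using that[of "g [^] q" t 0] 0 t gq nat_pow by simp
        qed
      qed
      have jc: "j \<in> carrier G" using j subc by blast
      have zc: "z \<in> carrier G" using z subc by blast
      let ?\<psi> = "\<lambda>p. vertex (j \<otimes> nearby_vertex p)"
      have \<psi>\<gamma>: "quasi_geodesic X K (2 * K) {0..l} (\<lambda>x. ?\<psi> (\<gamma> x))"
        using quasi_geodesic_quasi_isometric_image[OF \<gamma>(1) \<psi>[OF jc]] by simp
      have close: "\<exists>u\<ge>0. mdist X (?\<psi> (\<gamma> x)) (\<eta> u) \<le> N" if x: "x \<in> {0..l}" for x
      proof -
        obtain u where "u \<in> {0..}" "mdist X (?\<psi> (\<gamma> x)) (\<eta> u) \<le> M K (2 * K + 2 * \<rho>) + \<rho>"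
        proof (rule quasi_geodesic_near_morse[OF \<eta>(2) M _ _ _ _ \<psi>\<gamma>, of s t \<rho> x])
          show "mdist X (?\<psi> (\<gamma> 0)) (\<eta> s) \<le> \<rho>" "mdist X (?\<psi> (\<gamma> l)) (\<eta> t) \<le> \<rho>"
            using st \<gamma> jc by simp_all
        qed (use s0 l x D in auto)
        then show ?thesis by (auto simp: N_def)
      qed
      then obtain r where r: "\<And>x. x \<in> {0..l} \<Longrightarrow> r x \<ge> 0 \<and> mdist X (?\<psi> (\<gamma> x)) (\<eta> (r x)) \<le> N"
        by metis
      have "morse B.X ?M' {0..l} \<gamma>"
        by (rule morse_transport[OF \<eta>(1,2) M _ _ _ _ _ \<psi>[OF jc], where r = r])
          (use r N \<Gamma> in auto)
      moreover have "\<gamma> x \<in> nbhd B.X K' (vertex ` generate G {g})" if x: "x \<in> {0..l}" for x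
      proof -
        obtain q :: nat where q: "mdist X (\<eta> (r x)) (vertex (g [^] q)) \<le> \<rho>" using pow(2) r[OF x] by blast
        let ?z = "inv j \<otimes> g [^] q"
        have gq: "g [^] q \<in> carrier G" using g by simp
        have zg: "?z \<in> generate G {g}"
          using sub j nat_pow(1) by (intro subgroup.m_closed[OF sub] subgroup.m_inv_closed[OF sub])
        then have zc: "?z \<in> carrier G" using subc by blast
        have jz: "?\<psi> (vertex ?z) = vertex (g [^] q)" using jc gq by (simp add: m_assoc[symmetric])
        have \<gamma>x: "\<gamma> x \<in> mspace B.X" using \<Gamma>(5) x by blast
        have "mdist X (?\<psi> (\<gamma> x)) (vertex (g [^] q)) \<le> N + \<rho>"
          using mdist_triangle[of "?\<psi> (\<gamma> x)" X "\<eta> (r x)" "vertex (g [^] q)"] r[OF x] q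
            D(5)[of "r x"] gq jc \<gamma>x by simp
        then have "K * mdist X (?\<psi> (\<gamma> x)) (?\<psi> (vertex ?z)) + 2 * K \<le> K'"
          unfolding K'_def jz using K by (simp add: mult_left_mono)
        moreover have "mdist B.X (\<gamma> x) (vertex ?z) \<le> K * mdist X (?\<psi> (\<gamma> x)) (?\<psi> (vertex ?z)) + 2 * K"
          using \<psi>[OF jc] \<gamma>x B.vertex_in_X[OF zc] unfolding quasi_isometric_embedding_def by blast
        ultimately show ?thesis using zg \<gamma>x unfolding nbhd_def by force
      qed
      ultimately show ?thesis by blast
    qed
    have "morse_gauge ?M'" using M D K N by (intro morse_gauge_transported) auto
    moreover have "K' \<ge> 0" using K N \<rho> by (simp add: K'_def)
    ultimately show ?thesis using st unfolding stable_in_cayley_def by blast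
  qed
  then show "morse_element G g" unfolding morse_element_def stable_subgroup_def using g sub by blast
  show "infinite (generate G {g})"
  proof
    assume fin: "finite (generate G {g})"
    define B where "B = Max ((\<lambda>z. real (gd \<one> z)) ` generate G {g})"
    have B: "real (gd \<one> (g [^] q)) \<le> B" for q :: nat
      unfolding B_def by (rule Max_ge) (use fin nat_pow in auto)
    define t where "t = k * (B + \<rho> + c) + 1"
    have B0: "B \<ge> 0" using B[of 0] by linarith
    have t: "t \<ge> 0" using D(1,2) B0 \<rho> by (simp add: t_def)
    obtain q :: nat where q: "mdist X (\<eta> t) (vertex (g [^] q)) \<le> \<rho>" using pow(2)[OF t] by blast
    have gq: "g [^] q \<in> carrier G" using g by simp
    have "mdist X e (\<eta> t) \<le> B + \<rho>"
      using mdist_triangle[of e X "vertex (g [^] q)" "\<eta> t"] q B[of q] gq D(5)[of t] t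
        mdist_vertices[of \<one> "g [^] q"] by (simp add: mdist_commute)
    then have "k * (mdist X e (\<eta> t) + c) \<le> k * (B + \<rho> + c)" using D(1) by (intro mult_left_mono) auto
    then show False using D(6)[of 0 t] t \<eta>(3) by (simp add: t_def)
  qed
qed

lemma attracting_point_eq_class:
  assumes "\<beta> \<in> morse_rays X e" "g \<in> carrier G"
    and "bounded_hausdorff_dist X (\<beta> ` {0..}) (range (\<lambda>n::nat. vertex (g [^] n)))"
  shows "attracting_point G A g = asymptotic X e `` {\<beta>}"
proof -
  have sub: "\<gamma> ` {0..} \<subseteq> mspace X" if "\<gamma> \<in> morse_rays X e" for \<gamma>
    using that by (auto simp: morse_rays_def morse_rays_of_gauge_def geodesic_rays_def)
  have p: "range (\<lambda>n::nat. vertex (g [^] n)) \<subseteq> mspace X" using assms(2) by auto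
  have "\<gamma> \<in> attracting_point G A g \<longleftrightarrow> (\<beta>, \<gamma>) \<in> asymptotic X e" for \<gamma>
  proof
    assume "\<gamma> \<in> attracting_point G A g"
    then have \<gamma>: "\<gamma> \<in> morse_rays X e"
      "bounded_hausdorff_dist X (\<gamma> ` {0..}) (range (\<lambda>n::nat. vertex (g [^] n)))"
      by (auto simp: attracting_point_def)
    show "(\<beta>, \<gamma>) \<in> asymptotic X e"
      using bounded_hausdorff_dist_trans[OF assms(3) bounded_hausdorff_dist_sym[OF \<gamma>(2)]
          sub[OF assms(1)] sub[OF \<gamma>(1)]] \<gamma>(1) assms(1) by (simp add: asymptotic_def)
  next
    assume "(\<beta>, \<gamma>) \<in> asymptotic X e"
    then have \<gamma>: "\<gamma> \<in> morse_rays X e" "bounded_hausdorff_dist X (\<beta> ` {0..}) (\<gamma> ` {0..})"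
      by (auto simp: asymptotic_def)
    show "\<gamma> \<in> attracting_point G A g"
      using bounded_hausdorff_dist_trans[OF bounded_hausdorff_dist_sym[OF \<gamma>(2)] assms(3)
          sub[OF \<gamma>(1)] p] \<gamma>(1) by (simp add: attracting_point_def)
  qed
  then show ?thesis by blast
qed

end


section \<open>Density of attracting fixed points\<close>

context cayley begin

text \<open>Short pieces of the paths that are pasted together below are translates of pieces of a given
  Morse path, forwards or backwards; \<open>r\<close> is the reindexing and \<open>j\<close> the translation.\<close>

lemma morse_window:
  assumes \<gamma>: "quasi_geodesic X 1 c I \<gamma>" "morse X M I \<gamma>" "morse_gauge M"
    and \<eta>: "\<And>n. \<eta> n \<in> carrier G" and j: "j \<in> carrier G"
    and st: "0 \<le> s" "\<And>u. u \<in> {s..t} \<Longrightarrow> nat \<lfloor>u\<rfloor> \<in> N"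
    and r: "\<And>n. n \<in> N \<Longrightarrow> r n \<in> I \<and> \<gamma> (r n) = vertex (j \<otimes> \<eta> n)"
      "\<And>n m. n \<in> N \<Longrightarrow> m \<in> N \<Longrightarrow> \<bar>r n - r m\<bar> = \<bar>real n - real m\<bar>"
  shows "morse_quasi_geodesic X (transported_gauge 1 c 1 (c + 1) 1 2 0 M) 1 (c + 1) {s..t} (step_path \<eta>)"
proof -
  note D = quasi_geodesicD[OF \<gamma>(1)]
  have q: "quasi_geodesic X 1 (c + 1) {s..t} (step_path \<eta>)"
  proof (rule quasi_geodesicI)
    show "step_path \<eta> \<in> {s..t} \<rightarrow> mspace X" using step_path_in_X[OF \<eta>] by simp
    fix u v assume uv: "u \<in> {s..t}" "v \<in> {s..t}" "u \<le> v"
    let ?n = "nat \<lfloor>u\<rfloor>" and ?m = "nat \<lfloor>v\<rfloor>"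
    have nm: "?n \<in> N" "?m \<in> N" using st(2) uv by auto
    have "mdist X (step_path \<eta> u) (step_path \<eta> v) = mdist X (\<gamma> (r ?n)) (\<gamma> (r ?m))"
      using r(1)[OF nm(1)] r(1)[OF nm(2)] \<eta> j by (simp add: step_path_def mdist_vertices)
    moreover have "\<bar>real ?n - real ?m\<bar> = of_int \<lfloor>v\<rfloor> - of_int \<lfloor>u\<rfloor>"
      using uv st(1) floor_mono[OF uv(3)] by simp
    then have "\<bar>r ?n - r ?m\<bar> = of_int \<lfloor>v\<rfloor> - of_int \<lfloor>u\<rfloor>" using r(2)[OF nm] by linarith
    moreover have "\<bar>r ?n - r ?m\<bar> \<le> 1 * (mdist X (\<gamma> (r ?n)) (\<gamma> (r ?m)) + c)"
      "mdist X (\<gamma> (r ?n)) (\<gamma> (r ?m)) \<le> 1 * \<bar>r ?n - r ?m\<bar> + c"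
      using D(6,7)[of "r ?n" "r ?m"] r(1) nm by auto
    moreover have "of_int \<lfloor>v\<rfloor> - of_int \<lfloor>u\<rfloor> \<le> v - u + 1" "v - u \<le> of_int \<lfloor>v\<rfloor> - of_int \<lfloor>u\<rfloor> + 1"
      by linarith+
    ultimately show "v - u \<le> 1 * (mdist X (step_path \<eta> u) (step_path \<eta> v) + (c + 1))"
      "mdist X (step_path \<eta> u) (step_path \<eta> v) \<le> 1 * (v - u) + (c + 1)" by simp_all
  qed (use D in auto)
  have "morse X (transported_gauge 1 c 1 (c + 1) 1 2 0 M) {s..t} (step_path \<eta>)"
  proof (rule morse_transport[OF \<gamma> _ _ _ _ _ quasi_isometric_embedding_translation[OF j],
        where r = "\<lambda>u. r (nat \<lfloor>u\<rfloor>)"])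
    show "(\<lambda>u. r (nat \<lfloor>u\<rfloor>)) \<in> {s..t} \<rightarrow> I" using st r by auto
    show "mdist X (vertex (j \<otimes> nearby_vertex (step_path \<eta> u))) (\<gamma> (r (nat \<lfloor>u\<rfloor>))) \<le> 0"
      if "u \<in> {s..t}" for u
      using r(1)[OF st(2)[OF that]] \<eta> j by (simp add: step_path_def)
  qed (use quasi_geodesicD[OF q] in auto)
  then show ?thesis using q by (simp add: morse_quasi_geodesic_def)
qed

lemma rough_geodesic_carrier: "rough_geodesic N f \<Longrightarrow> f n \<in> carrier G"
  by (simp add: rough_geodesic_def)

lemma quasi_geodesic_step_ray:
  "rough_geodesic UNIV f \<Longrightarrow> quasi_geodesic X 1 4 {0..} (step_path f)"
  by (rule quasi_geodesic_step_path) (auto simp: is_interval_ci)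

text \<open>There are finitely many words of bounded length, so along a rough geodesic ray some word is
  repeated.\<close>

lemma repeated_window:
  assumes f: "rough_geodesic UNIV f"
  shows "\<exists>i j. N \<le> i \<and> i + L < j \<and>
    (\<forall>m\<le>L. inv (f i) \<otimes> f (i + m) = inv (f j) \<otimes> f (j + m))"
proof -
  have fc: "\<And>n. f n \<in> carrier G" using rough_geodesic_carrier[OF f] .
  let ?w = "\<lambda>i. map (\<lambda>m. inv (f i) \<otimes> f (i + m)) [0..<Suc L]"
  let ?B = "{g \<in> carrier G. gd \<one> g \<le> L + 2}"
  have "?w i \<in> {xs. set xs \<subseteq> ?B \<and> length xs = Suc L}" for i
  proof -
    have "inv (f i) \<otimes> f (i + m) \<in> ?B" if "m \<le> L" for m
    proof -
      have "\<bar>real (gd (f i) (f (i + m))) - \<bar>real i - real (i + m)\<bar>\<bar> \<le> 2"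
        using f unfolding rough_geodesic_def by blast
      then have "gd (f i) (f (i + m)) \<le> L + 2" using that by simp
      then show ?thesis using fc gd_one[of "f i" "f (i + m)"] by simp
    qed
    then show ?thesis by (auto simp del: upt_Suc)
  qed
  then have "?w ` {N..} \<subseteq> {xs. set xs \<subseteq> ?B \<and> length xs = Suc L}" by (rule image_subsetI)
  then have "finite (?w ` {N..})" using finite_lists_length_eq[OF finite_ball] finite_subset by blast
  from pigeonhole_infinite[OF infinite_Ici this] obtain i where i: "i \<in> {N..}" "infinite {j \<in> {N..}. ?w j = ?w i}"
    by blast
  then obtain j where j: "i + L < j" "?w j = ?w i"
    unfolding infinite_nat_iff_unbounded by blast
  have "inv (f i) \<otimes> f (i + m) = inv (f j) \<otimes> f (j + m)" if "m \<le> L" for m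
  proof -
    have "?w k ! m = inv (f k) \<otimes> f (k + m)" for k using that by (simp del: upt_Suc)
    then show ?thesis using j(2) by metis
  qed
  then show ?thesis using i(1) j(1) by auto
qed

text \<open>Follow \<open>f\<close> up to time \<open>j\<close> and then repeat the piece between \<open>i\<close> and \<open>j\<close> forever.\<close>

definition periodic_extension :: "nat \<Rightarrow> nat \<Rightarrow> (nat \<Rightarrow> 'a) \<Rightarrow> nat \<Rightarrow> 'a" where
  "periodic_extension i j f n =
     (if n < i then f n
      else (f j \<otimes> inv (f i)) [^] ((n - i) div (j - i)) \<otimes> f (i + (n - i) mod (j - i)))"

lemma periodic_extension:
  assumes f: "\<And>n. f n \<in> carrier G" and ij: "i + L < j"
    and rep: "\<And>m. m \<le> L \<Longrightarrow> inv (f i) \<otimes> f (i + m) = inv (f j) \<otimes> f (j + m)"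
  defines "y \<equiv> f j \<otimes> inv (f i)" and "\<eta> \<equiv> periodic_extension i j f"
  shows "\<eta> n \<in> carrier G" "n < j \<Longrightarrow> \<eta> n = f n" "\<eta> (i + q * (j - i)) = y [^] q \<otimes> f i"
    "\<exists>(q::nat) r. r \<le> j \<and> \<eta> n = y [^] q \<otimes> f r"
    "\<exists>k\<in>carrier G. \<exists>n'. \<forall>m\<le>L. \<eta> (n + m) = k \<otimes> f (n' + m)"
proof -
  define P where "P = j - i"
  have P: "L < P" using ij by (simp add: P_def)
  have y: "y \<in> carrier G" using f by (simp add: y_def)
  have \<eta>: "\<eta> n = (if n < i then f n else y [^] ((n - i) div P) \<otimes> f (i + (n - i) mod P))" for n
    by (simp add: \<eta>_def periodic_extension_def P_def y_def)
  have per: "\<eta> (i + (q * P + r)) = y [^] q \<otimes> f (i + r)" if "r < P" for q r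
    using that by (simp add: \<eta>)
  show "\<eta> n \<in> carrier G" using f y by (simp add: \<eta>)
  have start: "\<eta> n = f n" if "n < j" for n
    using that f by (simp add: \<eta> P_def)
  show "n < j \<Longrightarrow> \<eta> n = f n" by (rule start)
  show "\<eta> (i + q * (j - i)) = y [^] q \<otimes> f i" using per[of 0 q] P by (simp add: P_def)
  have split: "n = i + ((n - i) div P * P + (n - i) mod P)" "(n - i) mod P < P" if "i \<le> n" for n
    using that P by auto
  show "\<exists>(q::nat) r. r \<le> j \<and> \<eta> n = y [^] q \<otimes> f r"
  proof (cases "n < j")
    case True
    then have "n \<le> j \<and> \<eta> n = y [^] (0::nat) \<otimes> f n" using start f by simp
    then show ?thesis by blast
  next
    case False
    then have "\<eta> n = y [^] ((n - i) div P) \<otimes> f (i + (n - i) mod P)" using ij by (simp add: \<eta>)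
    moreover have "i + (n - i) mod P \<le> j" using split(2)[of n] False ij unfolding P_def by linarith
    ultimately show ?thesis by blast
  qed
  show "\<exists>k\<in>carrier G. \<exists>n'. \<forall>m\<le>L. \<eta> (n + m) = k \<otimes> f (n' + m)"
  proof (cases "n < i")
    case True
    then have "\<forall>m\<le>L. \<eta> (n + m) = \<one> \<otimes> f (n + m)" using start ij f by simp
    then show ?thesis by blast
  next
    case False
    define q r where "q = (n - i) div P" and "r = (n - i) mod P"
    have n: "n = i + (q * P + r)" "r < P" using split[of n] False by (auto simp: q_def r_def)
    have "\<eta> (n + m) = y [^] q \<otimes> f (i + r + m)" if m: "m \<le> L" for m
    proof (cases "r + m < P")
      case True
      then show ?thesis using per[OF True, of q] n by (simp add: add.assoc)
    next
      case False
      define m' where "m' = r + m - P"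
      have m': "m' \<le> L" "m' < P" "r + m = P + m'" using False m n(2) P by (auto simp: m'_def)
      have "n + m = i + (Suc q * P + m')" using n(1) m'(3) by simp
      then have "\<eta> (n + m) = y [^] Suc q \<otimes> f (i + m')" using per[OF m'(2)] by metis
      also have "\<dots> = y [^] q \<otimes> (f j \<otimes> (inv (f i) \<otimes> f (i + m')))"
        using f y by (simp add: y_def m_assoc)
      also have "f j \<otimes> (inv (f i) \<otimes> f (i + m')) = f (j + m')"
        using rep[OF m'(1)] f by (simp add: m_assoc[symmetric])
      also have "j + m' = i + r + m" using m'(3) ij by (simp add: P_def)
      finally show ?thesis .
    qed
    then show ?thesis using y by blast
  qed
qed

text \<open>Every interval of length \<open>B\<close> lies in one of the windows, where the path is a translate of a
  piece of \<open>f\<close>.\<close>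

lemma local_morse_if_windows:
  assumes f: "rough_geodesic UNIV f" "morse X M {0..} (step_path f)" "morse_gauge M"
    and \<eta>: "\<And>n. \<eta> n \<in> carrier G"
      "\<And>n. \<exists>k\<in>carrier G. \<exists>n'. \<forall>m\<le>L. \<eta> (n + m) = k \<otimes> f (n' + m)"
    and L: "B + 2 \<le> real L"
  shows "local_morse_quasi_geodesic X B (transported_gauge 1 4 1 5 1 2 0 M) 1 5 {0..} (step_path \<eta>)"
  unfolding local_morse_quasi_geodesic_def
proof (intro conjI allI impI)
  show "step_path \<eta> \<in> {0..} \<rightarrow> mspace X" using step_path_in_X[OF \<eta>(1)] by simp
  fix s t :: real assume st: "s \<le> t \<and> {s..t} \<subseteq> {0..} \<and> \<bar>s - t\<bar> \<le> B"
  then have s0: "0 \<le> s" by auto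
  define n where "n = nat \<lfloor>s\<rfloor>"
  obtain k n' where k: "k \<in> carrier G" "\<And>m. m \<le> L \<Longrightarrow> \<eta> (n + m) = k \<otimes> f (n' + m)" using \<eta>(2) by blast
  have fc: "\<And>n. f n \<in> carrier G" using rough_geodesic_carrier[OF f(1)] .
  have "morse_quasi_geodesic X (transported_gauge 1 4 1 (4 + 1) 1 2 0 M) 1 (4 + 1) {s..t} (step_path \<eta>)"
  proof (rule morse_window[OF quasi_geodesic_step_ray[OF f(1)] f(2,3) \<eta>(1) inv_closed[OF k(1)] s0,
        where N = "{n..n + L}" and r = "\<lambda>i. real (n' + (i - n))"])
    fix u assume u: "u \<in> {s..t}"
    have "\<lfloor>s\<rfloor> \<le> \<lfloor>u\<rfloor>" using u by (intro floor_mono) auto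
    moreover have "0 \<le> \<lfloor>s\<rfloor>" using s0 by simp
    moreover have "u \<le> s + B" using u st by auto
    then have "\<lfloor>u\<rfloor> \<le> \<lfloor>s\<rfloor> + int L" using L by linarith
    ultimately show "nat \<lfloor>u\<rfloor> \<in> {n..n + L}" unfolding n_def by auto
  next
    fix i assume "i \<in> {n..n + L}"
    then have "n + (i - n) = i" "i - n \<le> L" by auto
    then have "\<eta> i = k \<otimes> f (n' + (i - n))" using k(2)[of "i - n"] by simp
    then have "inv k \<otimes> \<eta> i = f (n' + (i - n))" using k(1) fc by (simp add: m_assoc[symmetric])
    then show "real (n' + (i - n)) \<in> {0..} \<and> step_path f (real (n' + (i - n))) = vertex (inv k \<otimes> \<eta> i)"
      unfolding step_path_of_nat by simp
  qed (auto simp: of_nat_diff)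
  then show "morse_quasi_geodesic X (transported_gauge 1 4 1 5 1 2 0 M) 1 5 {s..t} (step_path \<eta>)" by simp
qed (auto simp: is_interval_ci)

text \<open>The geodesic ray with vertices \<open>w\<close> is \<open>M\<close>-Morse and represents \<open>g\<^sup>+\<close>.\<close>

definition attracting_ray :: "(real \<Rightarrow> real \<Rightarrow> real) \<Rightarrow> 'a \<Rightarrow> (nat \<Rightarrow> 'a) \<Rightarrow> bool" where
  "attracting_ray M g w \<longleftrightarrow> morse_element G g \<and> infinite (generate G {g}) \<and>
    w 0 = \<one> \<and> (\<forall>n. w n \<in> carrier G) \<and> (\<forall>i j. real (gd (w i) (w j)) = \<bar>real i - real j\<bar>) \<and>
    restrict (edge_path w) {0..} \<in> morse_rays_of_gauge X e M \<and>
    asymptotic X e `` {restrict (edge_path w) {0..}} = attracting_point G A g"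

text \<open>The gauge and the distance are obtained before \<open>n\<close> is chosen: the local constants of the
  periodic path are those of \<open>\<alpha>\<close>, and the local-to-global property turns them into global ones.\<close>

lemma attracting_rays_follow_morse_ray:
  assumes ltg: "morse_local_to_global_space X"
    and M: "morse_gauge M" and \<alpha>: "\<alpha> \<in> morse_rays_of_gauge X e M"
  shows "\<exists>M' \<rho>. morse_gauge M' \<and> (\<forall>n::nat. \<exists>g w. attracting_ray M' g w \<and>
    (\<forall>x\<in>{0..real n}. \<exists>u\<ge>0. mdist X (edge_path w x) (\<alpha> u) \<le> \<rho>))"
proof -
  obtain f where f: "rough_geodesic UNIV f" "f 0 = \<one>"
    and f\<alpha>: "\<And>t. t \<ge> 0 \<Longrightarrow> mdist X (step_path f t) (\<alpha> t) \<le> 2"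
    and fM: "morse X (transported_gauge 1 0 1 4 1 0 2 M) {0..} (step_path f)"
    by (rule discretise_morse_ray[OF M \<alpha>]) blast
  define M\<^sub>1 where "M\<^sub>1 = transported_gauge 1 0 1 4 1 0 2 M"
  define M\<^sub>2 where "M\<^sub>2 = transported_gauge 1 4 1 5 1 2 0 M\<^sub>1"
  have M1: "morse_gauge M\<^sub>1" unfolding M\<^sub>1_def by (rule morse_gauge_transported[OF M]) auto
  have M2: "morse_gauge M\<^sub>2" unfolding M\<^sub>2_def by (rule morse_gauge_transported[OF M1]) auto
  have fc: "\<And>n. f n \<in> carrier G" using rough_geodesic_carrier[OF f(1)] .
  have "\<exists>B M' k' c'. B \<ge> 0 \<and> morse_gauge M' \<and> k' \<ge> 1 \<and> c' \<ge> 0 \<and>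
      (\<forall>I \<gamma>. local_morse_quasi_geodesic X B M\<^sub>2 1 5 I \<gamma> \<longrightarrow> morse_quasi_geodesic X M' k' c' I \<gamma>)"
    using ltg M2 unfolding morse_local_to_global_space_def by simp
  then obtain B M\<^sub>3 k c where B: "B \<ge> 0" "morse_gauge M\<^sub>3" "k \<ge> 1" "c \<ge> 0"
    and global: "\<And>I \<gamma>. local_morse_quasi_geodesic X B M\<^sub>2 1 5 I \<gamma> \<Longrightarrow> morse_quasi_geodesic X M\<^sub>3 k c I \<gamma>"
    by blast
  define M' where "M' = transported_gauge k c 1 0 1 0 (M\<^sub>3 1 0) M\<^sub>3"
  have M30: "M\<^sub>3 1 0 \<ge> 0" using B by (simp add: morse_gauge_def)
  have M': "morse_gauge M'" unfolding M'_def using B M30 by (intro morse_gauge_transported) auto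
  have "\<exists>g w. attracting_ray M' g w \<and>
    (\<forall>x\<in>{0..real n}. \<exists>u\<ge>0. mdist X (edge_path w x) (\<alpha> u) \<le> M\<^sub>3 1 0 + 2)" for n
  proof -
    \<comment> \<open>A step path visits at most \<open>B + 2\<close> vertices during an interval of length \<open>B\<close>.\<close>
    define L where "L = nat \<lceil>B\<rceil> + 2"
    have L: "B + 2 \<le> real L" unfolding L_def by linarith
    \<comment> \<open>The geodesics up to time \<open>n\<close> are close to the path up to time \<open>N\<close>, where it still agrees with \<open>f\<close>.\<close>
    define N where "N = nat \<lceil>k * (real n + M\<^sub>3 1 0 + c)\<rceil>"
    obtain i j where ij: "N \<le> i" "i + L < j"
      and rep: "\<And>m. m \<le> L \<Longrightarrow> inv (f i) \<otimes> f (i + m) = inv (f j) \<otimes> f (j + m)"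
      using repeated_window[OF f(1), of N L] by blast
    define y where "y = f j \<otimes> inv (f i)"
    define \<eta> where "\<eta> = periodic_extension i j f"
    note per = periodic_extension[of f i L j, OF fc ij(2) rep, folded y_def \<eta>_def]
    have y: "y \<in> carrier G" using fc by (simp add: y_def)
    have "local_morse_quasi_geodesic X B M\<^sub>2 1 5 {0..} (step_path \<eta>)"
      unfolding M\<^sub>2_def M\<^sub>1_def
      by (rule local_morse_if_windows[OF f(1) fM M1[unfolded M\<^sub>1_def] per(1) per(5) L])
    from global[OF this] have \<eta>: "quasi_geodesic X k c {0..} (step_path \<eta>)" "morse X M\<^sub>3 {0..} (step_path \<eta>)"
      by (auto simp: morse_quasi_geodesic_def)
    have \<eta>0: "step_path \<eta> 0 = e" using per(2)[of 0] ij f(2) by (simp add: step_path_def)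
    have q1: "quasi_geodesic X k c {0..real n} (step_path \<eta>)" for n
      by (rule quasi_geodesic_subset[OF \<eta>(1)]) auto
    have q2: "morse X M\<^sub>3 {0..real n} (step_path \<eta>)" for n by (rule morse_subset[OF \<eta>(2)]) auto
    obtain w \<kappa> where w: "w 0 = \<one>" "\<And>n. w n \<in> carrier G"
        "\<And>i j. real (gd (w i) (w j)) = \<bar>real i - real j\<bar>"
      and near: "\<And>n x. x \<in> {0..real n} \<Longrightarrow> \<exists>u\<in>{0..real (\<kappa> n)}.
        mdist X (edge_path w x) (step_path \<eta> u) \<le> M\<^sub>3 1 0 \<and> u \<le> k * (x + M\<^sub>3 1 0 + c)"
    proof (rule limit_of_geodesics[OF B(2) q1 q2 \<eta>0 step_path_of_nat per(1) order_refl])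
      fix w \<kappa>
      assume "w 0 = \<one>" "\<And>n. w n \<in> carrier G" "\<And>i j. real (gd (w i) (w j)) = \<bar>real i - real j\<bar>"
        "\<And>n x. x \<in> {0..real n} \<Longrightarrow> \<exists>u\<in>{0..real (\<kappa> n)}.
          mdist X (edge_path w x) (step_path \<eta> u) \<le> M\<^sub>3 1 0 \<and> u \<le> k * (x + M\<^sub>3 1 0 + c)"
      then show thesis by (rule that)
    qed
    have geo: "geodesic X {0..} (edge_path w)" by (rule geodesic_ray_edge_path[OF w(2,3)])
    have near': "\<exists>u\<ge>0. mdist X (edge_path w x) (step_path \<eta> u) \<le> M\<^sub>3 1 0 \<and> u \<le> k * (x + M\<^sub>3 1 0 + c)" if "x \<ge> 0" for x
    proof -
      have "x \<in> {0..real (nat \<lceil>x\<rceil>)}" using that by auto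
      then obtain u where "u \<in> {0..real (\<kappa> (nat \<lceil>x\<rceil>))}" "mdist X (edge_path w x) (step_path \<eta> u) \<le> M\<^sub>3 1 0"
          "u \<le> k * (x + M\<^sub>3 1 0 + c)"
        using near by blast
      then show ?thesis by auto
    qed
    then obtain r where r: "\<And>x. x \<ge> 0 \<Longrightarrow> r x \<ge> 0 \<and> mdist X (edge_path w x) (step_path \<eta> (r x)) \<le> M\<^sub>3 1 0"
      by metis
    have "morse X M' {0..} (edge_path w)"
      unfolding M'_def
      by (rule morse_transport[OF \<eta> B(2) _ _ _ _ _ quasi_isometric_embedding_id, where r = r])
        (use r M30 quasi_geodesicD[OF geo] in auto)
    then have "morse X M' {0..} (restrict (edge_path w) {0..})" by (rule morse_cong) simp
    moreover have "geodesic X {0..} (restrict (edge_path w) {0..})" 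
      by (rule quasi_geodesic_cong[OF geo]) simp
    ultimately have ray: "restrict (edge_path w) {0..} \<in> morse_rays_of_gauge X e M'"
      using w(1) quasi_geodesicD(5)[OF geo] by (auto simp: morse_rays_of_gauge_def geodesic_rays_def)
    then have mray: "restrict (edge_path w) {0..} \<in> morse_rays X e" using M' by (auto simp: morse_rays_def)
    \<comment> \<open>The powers of \<open>y\<close> and the path \<open>\<eta>\<close> are within distance \<open>j + 2\<close> of each other.\<close>
    have gf: "real (gd (f r) \<one>) \<le> real j + 2" if "r \<le> j" for r
    proof -
      have "\<bar>real (gd (f r) (f 0)) - \<bar>real r - real 0\<bar>\<bar> \<le> 2"
        using f(1) unfolding rough_geodesic_def by blast
      then show ?thesis using f(2) that by simp
    qed
    have yc: "y [^] (q::nat) \<in> carrier G" for q using y by simp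
    have dist: "mdist X (vertex (y [^] q \<otimes> f r)) (vertex (y [^] q)) \<le> real j + 2"
      if "r \<le> j" for q r :: nat
      using gd_left_mult[OF yc[of q] fc[of r] one_closed] gf[OF that] yc fc by (simp add: mdist_vertices)
    have p1: "\<exists>t\<ge>0. mdist X (vertex (y [^] q)) (step_path \<eta> t) \<le> real j + 2" for q :: nat
      using dist[of i q] ij per(3)[of q]
      by (intro exI[of _ "real (i + q * (j - i))"]) (simp add: mdist_commute step_path_def del: of_nat_add of_nat_mult)
    have p2: "\<exists>q::nat. mdist X (step_path \<eta> t) (vertex (y [^] q)) \<le> real j + 2" if "t \<ge> 0" for t
    proof -
      obtain q r :: nat where "r \<le> j" "\<eta> (nat \<lfloor>t\<rfloor>) = y [^] q \<otimes> f r" using per(4) by blast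
      then show ?thesis using dist[of r q] by (auto simp: step_path_def)
    qed
    note me = morse_element_if_powers_along_morse_ray[OF B(2) \<eta> \<eta>0 y p1 p2]
    have "bounded_hausdorff_dist X (edge_path w ` {0..}) (step_path \<eta> ` {0..})"
      by (rule quasi_geodesic_ray_near_ray[OF \<eta>(1) geo, of r "M\<^sub>3 1 0"]) (use r in auto)
    then have h1: "bounded_hausdorff_dist X (restrict (edge_path w) {0..} ` {0..}) (step_path \<eta> ` {0..})"
      by simp
    have h2: "bounded_hausdorff_dist X (step_path \<eta> ` {0..}) (range (\<lambda>q::nat. vertex (y [^] q)))"
      unfolding bounded_hausdorff_dist_def
    proof (intro exI[of _ "real j + 2"] conjI)
      show "step_path \<eta> ` {0..} \<subseteq> nbhd X (real j + 2) (range (\<lambda>q::nat. vertex (y [^] q)))"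
        using p2 quasi_geodesicD(5)[OF \<eta>(1)] by (auto simp: nbhd_def)
      show "range (\<lambda>q::nat. vertex (y [^] q)) \<subseteq> nbhd X (real j + 2) (step_path \<eta> ` {0..})"
      proof
        fix p assume "p \<in> range (\<lambda>q::nat. vertex (y [^] q))"
        then obtain q :: nat where q: "p = vertex (y [^] q)" by blast
        obtain t where "t \<ge> 0" "mdist X p (step_path \<eta> t) \<le> real j + 2" using p1 q by blast
        then show "p \<in> nbhd X (real j + 2) (step_path \<eta> ` {0..})" using yc q unfolding nbhd_def by auto
      qed
    qed simp
    have "bounded_hausdorff_dist X (restrict (edge_path w) {0..} ` {0..}) (range (\<lambda>q::nat. vertex (y [^] q)))"
      by (rule bounded_hausdorff_dist_trans[OF h1 h2]) (use quasi_geodesicD(5)[OF geo] yc in auto)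
    from attracting_point_eq_class[OF mray y this]
    have cls: "asymptotic X e `` {restrict (edge_path w) {0..}} = attracting_point G A y" by simp
    have follow: "\<exists>u\<ge>0. mdist X (edge_path w x) (\<alpha> u) \<le> M\<^sub>3 1 0 + 2" if x: "x \<in> {0..real n}" for x
    proof -
      obtain u where u: "u \<ge> 0" "mdist X (edge_path w x) (step_path \<eta> u) \<le> M\<^sub>3 1 0" "u \<le> k * (x + M\<^sub>3 1 0 + c)"
        using near' x by auto
      have "k * (x + M\<^sub>3 1 0 + c) \<le> k * (real n + M\<^sub>3 1 0 + c)" using x B(3) by (intro mult_left_mono) auto
      also have "\<dots> \<le> real N" unfolding N_def by linarith
      finally have "u \<le> real N" using u(3) by linarith
      then have "nat \<lfloor>u\<rfloor> \<le> N" by linarith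
      then have "step_path \<eta> u = step_path f u" using per(2) ij unfolding step_path_def by simp
      moreover have "\<alpha> u \<in> mspace X"
        using \<alpha> u(1) by (auto simp: morse_rays_of_gauge_def geodesic_rays_def)
      ultimately have "mdist X (edge_path w x) (\<alpha> u) \<le> M\<^sub>3 1 0 + 2"
        using mdist_triangle[of "edge_path w x" X "step_path \<eta> u" "\<alpha> u"] u f\<alpha>[OF u(1)]
          quasi_geodesicD(5)[OF geo, of x] quasi_geodesicD(5)[OF \<eta>(1), of u] x by auto
      then show ?thesis using u(1) by blast
    qed
    show ?thesis using me w ray cls follow unfolding attracting_ray_def by blast
  qed
  then show ?thesis using M' by blast
qed

text \<open>The rays of the previous lemma subconverge to a ray close to \<open>\<alpha>\<close>, which is then another
  representative of the class of \<open>\<alpha>\<close>.\<close>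

lemma attracting_points_dense:
  assumes ltg: "morse_local_to_global_space X"
  shows "cayley_boundary G A closure_of
           {attracting_point G A g | g. morse_element G g \<and> infinite (generate G {g})}
         = topspace (cayley_boundary G A)"
    (is "_ closure_of ?S = _")
proof
  show "cayley_boundary G A closure_of ?S \<subseteq> topspace (cayley_boundary G A)"
    by (rule closure_of_subset_topspace)
  show "topspace (cayley_boundary G A) \<subseteq> cayley_boundary G A closure_of ?S"
  proof
    fix x assume "x \<in> topspace (cayley_boundary G A)"
    then obtain \<alpha> where \<alpha>': "\<alpha> \<in> morse_rays X e" "x = asymptotic X e `` {\<alpha>}"
      by (auto simp: morse_boundary_set_def elim: quotientE)
    then obtain M where M: "morse_gauge M" "\<alpha> \<in> morse_rays_of_gauge X e M" by (auto simp: morse_rays_def)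
    obtain M' \<rho> where M': "morse_gauge M'" and "\<forall>n::nat. \<exists>g w. attracting_ray M' g w \<and>
        (\<forall>x\<in>{0..real n}. \<exists>u\<ge>0. mdist X (edge_path w x) (\<alpha> u) \<le> \<rho>)"
      using attracting_rays_follow_morse_ray[OF ltg M] by blast
    then obtain g w where gw: "\<And>n. attracting_ray M' (g n) (w n)"
      and near: "\<And>n x. x \<in> {0..real n} \<Longrightarrow> \<exists>u\<ge>0. mdist X (edge_path (w n) x) (\<alpha> u) \<le> \<rho>"
      by metis
    have g: "morse_element G (g n) \<and> infinite (generate G {g n})"
      and w: "w n 0 = \<one>" "w n i \<in> carrier G" "real (gd (w n i) (w n j)) = \<bar>real i - real j\<bar>"
      and ray: "restrict (edge_path (w n)) {0..} \<in> morse_rays_of_gauge X e M'"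
      and cls: "asymptotic X e `` {restrict (edge_path (w n)) {0..}} = attracting_point G A (g n)" for n i j
      using gw[of n] by (auto simp: attracting_ray_def)
    have fin: "finite (range (\<lambda>n. w n m))" for m
    proof (rule finite_subset[OF _ finite_ball[of m]])
      show "range (\<lambda>n. w n m) \<subseteq> {x \<in> carrier G. gd \<one> x \<le> m}"
        using w(1,2) w(3)[of _ 0 m] by auto
    qed
    obtain v \<kappa> where \<kappa>: "\<And>n. n \<le> \<kappa> n" and v: "\<And>n m. m \<le> n \<Longrightarrow> w (\<kappa> n) m = v m"
      by (rule pointwise_limit_subsequence[of w, OF fin]) blast
    have vc: "v n \<in> carrier G" for n using v[of n n] w(2) by (metis order_refl)
    have vex: "real (gd (v i) (v j)) = \<bar>real i - real j\<bar>" for i j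
      using w(3)[of "\<kappa> (max i j)" i j] v[of i "max i j"] v[of j "max i j"] by simp
    have v0: "edge_path v 0 = e" using v[of 0 0] w(1) by simp
    have geo: "geodesic X {0..} (edge_path v)" by (rule geodesic_ray_edge_path[OF vc vex])
    have agree: "edge_path (w (\<kappa> n)) x = edge_path v x" if "x \<in> {0..real n}" for n x
      by (rule edge_path_cong[of n]) (use v that in auto)
    have "\<exists>u\<ge>0. mdist X (edge_path v x) (\<alpha> u) \<le> \<rho>" if x: "x \<ge> 0" for x
    proof -
      have "x \<in> {0..real (nat \<lceil>x\<rceil>)}" using x by auto
      moreover from this have "x \<in> {0..real (\<kappa> (nat \<lceil>x\<rceil>))}" using \<kappa>[of "nat \<lceil>x\<rceil>"] by auto
      ultimately show ?thesis using near agree by metis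
    qed
    note \<beta> = geodesic_ray_near_morse_ray[OF M geo v0 this]
    let ?M = "transported_gauge 1 0 1 0 1 0 \<rho> M"
    \<comment> \<open>All the rays lie in one common stratum.\<close>
    define M'' where "M'' = (\<lambda>k c. max (?M k c) (M' k c))"
    have M'': "morse_gauge M''" using M' by (auto simp: morse_gauge_def M''_def le_max_iff_disj)
    have in1: "\<gamma> \<in> morse_rays_of_gauge X e M''" if "\<gamma> \<in> morse_rays_of_gauge X e ?M" for \<gamma>
      using that morse_mono[of X ?M "{0..}" \<gamma> M''] by (auto simp: morse_rays_of_gauge_def M''_def)
    have in2: "\<gamma> \<in> morse_rays_of_gauge X e M''" if "\<gamma> \<in> morse_rays_of_gauge X e M'" for \<gamma>
      using that morse_mono[of X M' "{0..}" \<gamma> M''] by (auto simp: morse_rays_of_gauge_def M''_def)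
    have "asymptotic X e `` {restrict (edge_path v) {0..}} \<in> cayley_boundary G A closure_of ?S"
    proof (rule in_closure_of_morse_boundary[OF M'' in1[OF \<beta>(1)]])
      fix n :: nat
      show "\<exists>\<gamma>\<in>morse_rays_of_gauge X e M''. (\<forall>t\<in>{0..real n}. \<gamma> t = restrict (edge_path v) {0..} t) \<and>
          asymptotic X e `` {\<gamma>} \<in> ?S"
      proof (intro bexI[of _ "restrict (edge_path (w (\<kappa> n))) {0..}"] conjI ballI)
        show "restrict (edge_path (w (\<kappa> n))) {0..} t = restrict (edge_path v) {0..} t" if "t \<in> {0..real n}" for t
          using agree[OF that] that by simp
        show "asymptotic X e `` {restrict (edge_path (w (\<kappa> n))) {0..}} \<in> ?S" using cls g by blast
      qed (rule in2[OF ray])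
    qed
    moreover have "asymptotic X e `` {restrict (edge_path v) {0..}} = x"
      unfolding \<alpha>' using equiv_class_eq[OF equiv_asymptotic \<beta>(2)] by simp
    ultimately show "x \<in> cayley_boundary G A closure_of ?S" by simp
  qed
qed

end


section \<open>Translates of a Morse ray\<close>

context cayley begin

abbreviation "window_gauge \<equiv> transported_gauge 1 4 1 5 1 2 0"

lemma translated_rough_geodesic:
  assumes b: "rough_geodesic UNIV b" "morse X M {0..} (step_path b)" "morse_gauge M"
    and g: "g \<in> carrier G"
  shows "rough_geodesic UNIV (\<lambda>n. g \<otimes> b n)"
    and "morse X (window_gauge M) {0..} (step_path (\<lambda>n. g \<otimes> b n))"
proof -
  have bc: "\<And>n. b n \<in> carrier G" using rough_geodesic_carrier[OF b(1)] .
  show "rough_geodesic UNIV (\<lambda>n. g \<otimes> b n)"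
    using b(1) g by (simp add: rough_geodesic_def)
  show "morse X (window_gauge M) {0..} (step_path (\<lambda>n. g \<otimes> b n))"
  proof (rule morse_if_compact_pieces)
    fix s t :: real assume st: "s \<le> t" "{s..t} \<subseteq> {0..}"
    have "morse_quasi_geodesic X (transported_gauge 1 4 1 (4 + 1) 1 2 0 M) 1 (4 + 1) {s..t} (step_path (\<lambda>n. g \<otimes> b n))"
      by (rule morse_window[OF quasi_geodesic_step_ray[OF b(1)] b(2,3) _ inv_closed[OF g], where N = UNIV and r = real])
        (use st g bc in \<open>auto simp: m_assoc[symmetric]\<close>)
    then show "morse X (window_gauge M) {s..t} (step_path (\<lambda>n. g \<otimes> b n))"
      by (simp add: morse_quasi_geodesic_def)
  qed
qed

text \<open>The ways back from later and later points subconverge by local finiteness. Every piece of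
  the limit is a translate of a reversed piece of \<open>f\<close>, so the limit is Morse with a controlled
  gauge.\<close>

lemma backward_limit:
  assumes f: "rough_geodesic UNIV f" "morse X M {0..} (step_path f)" "morse_gauge M"
  obtains b \<kappa> where "rough_geodesic UNIV b" "b 0 = \<one>" "morse X (window_gauge M) {0..} (step_path b)"
    "\<And>n. n \<le> \<kappa> n" "\<And>n m. m \<le> n \<Longrightarrow> b m = inv (f (\<kappa> n)) \<otimes> f (\<kappa> n - m)"
proof -
  have fc: "\<And>n. f n \<in> carrier G" using rough_geodesic_carrier[OF f(1)] .
  have fd: "\<bar>real (gd (f i) (f j)) - \<bar>real i - real j\<bar>\<bar> \<le> 2" for i j
    using f(1) unfolding rough_geodesic_def by blast
  define F where "F k m = inv (f k) \<otimes> f (k - m)" for k m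
  have fin: "finite (range (\<lambda>k. F k m))" for m
  proof (rule finite_subset[OF _ finite_ball[of "m + 2"]])
    have "gd (f k) (f (k - m)) \<le> m + 2" for k using fd[of k "k - m"] by linarith
    then show "range (\<lambda>k. F k m) \<subseteq> {x \<in> carrier G. gd \<one> x \<le> m + 2}"
      using fc gd_one by (auto simp: F_def)
  qed
  obtain b \<kappa> where \<kappa>: "\<And>n. n \<le> \<kappa> n" and lim: "\<And>n m. m \<le> n \<Longrightarrow> F (\<kappa> n) m = b m"
    by (rule pointwise_limit_subsequence[of F, OF fin]) blast
  have b: "b m = inv (f (\<kappa> n)) \<otimes> f (\<kappa> n - m)" if "m \<le> n" for n m
    using lim[OF that] by (simp add: F_def)
  have bc: "b n \<in> carrier G" for n using b[of n n] fc by simp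
  have rough: "rough_geodesic UNIV b"
    unfolding rough_geodesic_def
  proof (intro conjI allI ballI)
    fix i j
    let ?k = "\<kappa> (max i j)"
    have "gd (b i) (b j) = gd (f (?k - i)) (f (?k - j))"
      using b[of i "max i j"] b[of j "max i j"] fc by simp
    moreover have "i \<le> ?k" "j \<le> ?k" using \<kappa>[of "max i j"] by auto
    then have "\<bar>real (?k - i) - real (?k - j)\<bar> = \<bar>real i - real j\<bar>" by (simp add: of_nat_diff)
    ultimately show "\<bar>real (gd (b i) (b j)) - \<bar>real i - real j\<bar>\<bar> \<le> 2"
      using fd[of "?k - i" "?k - j"] by simp
  qed (rule bc)
  have "morse X (window_gauge M) {0..} (step_path b)"
  proof (rule morse_if_compact_pieces)
    fix s t :: real assume st: "s \<le> t" "{s..t} \<subseteq> {0..}"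
    define n where "n = nat \<lfloor>t\<rfloor>"
    have s0: "0 \<le> s" using st by auto
    have "morse_quasi_geodesic X (transported_gauge 1 4 1 (4 + 1) 1 2 0 M) 1 (4 + 1) {s..t} (step_path b)"
    proof (rule morse_window[OF quasi_geodesic_step_ray[OF f(1)] f(2,3) bc fc[of "\<kappa> n"] s0,
          where N = "{..n}" and r = "\<lambda>m. real (\<kappa> n - m)"])
      fix u assume "u \<in> {s..t}"
      then have "\<lfloor>u\<rfloor> \<le> \<lfloor>t\<rfloor>" by (intro floor_mono) auto
      then show "nat \<lfloor>u\<rfloor> \<in> {..n}" by (simp add: n_def nat_mono)
    next
      fix m assume "m \<in> {..n}"
      then have "f (\<kappa> n) \<otimes> b m = f (\<kappa> n - m)" using b[of m n] fc by (simp add: m_assoc[symmetric])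
      then show "real (\<kappa> n - m) \<in> {0..} \<and> step_path f (real (\<kappa> n - m)) = vertex (f (\<kappa> n) \<otimes> b m)"
        unfolding step_path_of_nat by simp
    next
      fix m m' assume "m \<in> {..n}" "m' \<in> {..n}"
      then have "m \<le> \<kappa> n" "m' \<le> \<kappa> n" using \<kappa>[of n] by auto
      then show "\<bar>real (\<kappa> n - m) - real (\<kappa> n - m')\<bar> = \<bar>real m - real m'\<bar>"
        by (simp add: of_nat_diff abs_minus_commute)
    qed
    then show "morse X (window_gauge M) {s..t} (step_path b)" by (simp add: morse_quasi_geodesic_def)
  qed
  moreover have "b 0 = \<one>" using b[of 0 0] fc by simp
  ultimately show thesis using that rough \<kappa> b by blast
qed

end

text \<open>A ray all of whose translates are Morse for one gauge. Only vertices are translated, so no action on the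
  points of the graph has to be set up.\<close>

locale morse_ray_translates = cayley +
  fixes b :: "nat \<Rightarrow> 'a" and M :: "real \<Rightarrow> real \<Rightarrow> real"
  assumes b: "rough_geodesic UNIV b"
    and M: "morse_gauge M"
    and translates: "\<And>g. g \<in> carrier G \<Longrightarrow> morse X M {0..} (step_path (\<lambda>n. g \<otimes> b n))"
begin

definition ray :: "'a \<Rightarrow> real \<Rightarrow> 'a \<Rightarrow> real" where
  "ray g = step_path (\<lambda>n. g \<otimes> b n)"

lemma ray_of_nat [simp]: "ray g (real n) = vertex (g \<otimes> b n)"
  by (simp add: ray_def)

lemma morse_ray: "g \<in> carrier G \<Longrightarrow> morse X M {0..} (ray g)"
  unfolding ray_def by (rule translates)

lemma b_carrier [simp]: "b n \<in> carrier G" using rough_geodesic_carrier[OF b] .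

lemma quasi_geodesic_ray: "g \<in> carrier G \<Longrightarrow> quasi_geodesic X 1 4 {0..} (ray g)"
  unfolding ray_def using b by (intro quasi_geodesic_step_ray) (simp add: rough_geodesic_def)

lemma ray_in_X [simp]: "g \<in> carrier G \<Longrightarrow> ray g t \<in> mspace X"
  by (simp add: ray_def step_path_def)

lemma mdist_ray_translate:
  assumes "k \<in> carrier G" "g \<in> carrier G" "h \<in> carrier G"
  shows "mdist X (ray (k \<otimes> g) s) (ray (k \<otimes> h) t) = mdist X (ray g s) (ray h t)"
  using assms by (simp add: ray_def step_path_def mdist_vertices m_assoc)

text \<open>The error in the dichotomy for two translates of the ray, where the graph is coarsely geodesic with
  constant 4.\<close>

definition close :: real where "close = 3 * (4 * M 3 26 + 24) + 8"

text \<open>The coarse translation length of an isometry that fixes the end of the ray. It only makes sense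
  far out, but there the error \<open>\<delta>\<close> can be made independent of \<open>g\<close>.\<close>

definition shifts :: "real \<Rightarrow> 'a \<Rightarrow> real \<Rightarrow> bool" where
  "shifts \<delta> g \<tau> \<longleftrightarrow>
     (\<exists>T\<ge>0. \<forall>t\<ge>T. 0 \<le> t + \<tau> \<and> mdist X (ray g t) (ray \<one> (t + \<tau>)) \<le> \<delta>)"

definition divergent :: "real \<Rightarrow> 'a \<Rightarrow> 'a \<Rightarrow> bool" where
  "divergent K g h \<longleftrightarrow> (\<forall>s\<ge>0. \<forall>t\<ge>0. s + t - K \<le> mdist X (ray g s) (ray h t))"

lemma shifts_or_divergent:
  assumes "g \<in> carrier G" "h \<in> carrier G"
  shows "(\<exists>\<tau>. shifts close (inv g \<otimes> h) \<tau>) \<or> (\<exists>K. divergent K g h)"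
proof -
  let ?T = "2 * mdist X (ray g 0) (ray h 0) + 1 + 4 * 4"
  have T: "?T \<ge> 0" using mdist_nonneg[of X "ray g 0" "ray h 0"] by linarith
  have "(\<exists>\<tau>. \<forall>x\<ge>?T. 0 \<le> x + \<tau> \<and> mdist X (ray h x) (ray g (x + \<tau>)) \<le> close) \<or> (\<exists>K. divergent K g h)"
    using asymptotic_or_divergent[OF coarsely_geodesic_X M quasi_geodesic_ray morse_ray
        quasi_geodesic_ray morse_ray, OF assms(1,1,2,2)]
    unfolding divergent_def close_def by simp
  moreover have "mdist X (ray h x) (ray g y) = mdist X (ray (inv g \<otimes> h) x) (ray \<one> y)" for x y
    using mdist_ray_translate[of g "inv g \<otimes> h" \<one> x y] assms by (simp add: m_assoc[symmetric])
  ultimately show ?thesis unfolding shifts_def using T by metis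
qed

lemma ray_dist:
  assumes "g \<in> carrier G" "s \<ge> 0" "t \<ge> 0"
  shows "mdist X (ray g s) (ray g t) \<le> \<bar>s - t\<bar> + 4" "\<bar>s - t\<bar> \<le> mdist X (ray g s) (ray g t) + 4"
  using quasi_geodesicD(6,7)[OF quasi_geodesic_ray[OF assms(1)], of s t] assms by auto

lemma shift_unique:
  assumes "g \<in> carrier G" "shifts \<delta> g \<tau>" "shifts \<delta>' g \<tau>'"
  shows "\<bar>\<tau> - \<tau>'\<bar> \<le> \<delta> + \<delta>' + 4"
proof -
  obtain T T' where T: "T \<ge> 0" "\<And>t. t \<ge> T \<Longrightarrow> 0 \<le> t + \<tau> \<and> mdist X (ray g t) (ray \<one> (t + \<tau>)) \<le> \<delta>"
    and T': "T' \<ge> 0" "\<And>t. t \<ge> T' \<Longrightarrow> 0 \<le> t + \<tau>' \<and> mdist X (ray g t) (ray \<one> (t + \<tau>')) \<le> \<delta>'"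
    using assms(2,3) unfolding shifts_def by blast
  let ?t = "max T T'"
  have "mdist X (ray \<one> (?t + \<tau>)) (ray \<one> (?t + \<tau>')) \<le> \<delta> + \<delta>'"
    using mdist_triangle[of "ray \<one> (?t + \<tau>)" X "ray g ?t" "ray \<one> (?t + \<tau>')"] T(2)[of ?t] T'(2)[of ?t]
      assms(1) by (simp add: mdist_commute)
  then show ?thesis using ray_dist(2)[of \<one> "?t + \<tau>" "?t + \<tau>'"] T(2)[of ?t] T'(2)[of ?t] by simp
qed

text \<open>A rough shift is a close one, as the alternative is divergence.\<close>

lemma shift_improve:
  assumes g: "g \<in> carrier G" and s: "shifts \<delta> g \<tau>"
  obtains \<sigma> where "shifts close g \<sigma>" "\<bar>\<sigma> - \<tau>\<bar> \<le> close + \<delta> + 4"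
proof -
  have "\<not> divergent K \<one> g" for K
  proof
    assume K: "divergent K \<one> g"
    obtain T where T: "T \<ge> 0" "\<And>t. t \<ge> T \<Longrightarrow> 0 \<le> t + \<tau> \<and> mdist X (ray g t) (ray \<one> (t + \<tau>)) \<le> \<delta>"
      using s unfolding shifts_def by blast
    define t where "t = T + \<bar>\<tau>\<bar> + \<bar>\<delta>\<bar> + \<bar>K\<bar> + 1"
    have t: "t \<ge> T" "t \<ge> 0" using T(1) by (auto simp: t_def)
    have "(t + \<tau>) + t - K \<le> mdist X (ray \<one> (t + \<tau>)) (ray g t)"
      using K T(2)[OF t(1)] t unfolding divergent_def by blast
    then have "(t + \<tau>) + t - K \<le> \<delta>" using T(2)[OF t(1)] by (simp add: mdist_commute)
    then show False unfolding t_def using T(1) by linarith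
  qed
  then obtain \<sigma> where \<sigma>: "shifts close g \<sigma>" using shifts_or_divergent[of \<one> g] g by auto
  then show thesis using that shift_unique[OF g \<sigma> s] by blast
qed

lemma shift_mult:
  assumes "g \<in> carrier G" "h \<in> carrier G" "shifts \<delta> g \<tau>" "shifts \<delta>' h \<tau>'"
  shows "shifts (\<delta> + \<delta>') (g \<otimes> h) (\<tau>' + \<tau>)"
proof -
  obtain T T' where T: "T \<ge> 0" "\<And>t. t \<ge> T \<Longrightarrow> 0 \<le> t + \<tau> \<and> mdist X (ray g t) (ray \<one> (t + \<tau>)) \<le> \<delta>"
    and T': "T' \<ge> 0" "\<And>t. t \<ge> T' \<Longrightarrow> 0 \<le> t + \<tau>' \<and> mdist X (ray h t) (ray \<one> (t + \<tau>')) \<le> \<delta>'"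
    using assms(3,4) unfolding shifts_def by blast
  have "0 \<le> t + (\<tau>' + \<tau>) \<and> mdist X (ray (g \<otimes> h) t) (ray \<one> (t + (\<tau>' + \<tau>))) \<le> \<delta> + \<delta>'"
    if t: "t \<ge> max T' (T + \<bar>\<tau>'\<bar>)" for t
  proof -
    have t': "t \<ge> T'" "t + \<tau>' \<ge> T" using t by auto
    have "mdist X (ray (g \<otimes> h) t) (ray g (t + \<tau>')) = mdist X (ray h t) (ray \<one> (t + \<tau>'))"
      using mdist_ray_translate[of g h \<one>] assms by simp
    then show ?thesis
      using mdist_triangle[of "ray (g \<otimes> h) t" X "ray g (t + \<tau>')" "ray \<one> (t + (\<tau>' + \<tau>))"]
        T(2)[OF t'(2)] T'(2)[OF t'(1)] assms by (simp add: add.assoc)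
  qed
  then show ?thesis unfolding shifts_def using T'(1) by (intro exI[of _ "max T' (T + \<bar>\<tau>'\<bar>)"]) auto
qed

lemma shift_inv:
  assumes "g \<in> carrier G" "shifts \<delta> g \<tau>"
  shows "shifts \<delta> (inv g) (- \<tau>)"
proof -
  obtain T where T: "T \<ge> 0" "\<And>t. t \<ge> T \<Longrightarrow> 0 \<le> t + \<tau> \<and> mdist X (ray g t) (ray \<one> (t + \<tau>)) \<le> \<delta>"
    using assms(2) unfolding shifts_def by blast
  have "0 \<le> t + (- \<tau>) \<and> mdist X (ray (inv g) t) (ray \<one> (t + (- \<tau>))) \<le> \<delta>" if "t \<ge> T + \<bar>\<tau>\<bar>" for t
  proof -
    have t: "t - \<tau> \<ge> T" using that by linarith
    have "mdist X (ray g (t - \<tau>)) (ray \<one> t) = mdist X (ray \<one> (t - \<tau>)) (ray (inv g) t)"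
      using mdist_ray_translate[of g \<one> "inv g" "t - \<tau>" t] assms by simp
    then show ?thesis using T(2)[OF t] T(1) t by (simp add: mdist_commute)
  qed
  then show ?thesis unfolding shifts_def using T(1) by (intro exI[of _ "T + \<bar>\<tau>\<bar>"]) auto
qed

text \<open>Far out on the ray, conjugation by a point of the ray maps elements with a bounded shift into
  a ball of bounded radius.\<close>

lemma finite_bounded_shifts: "finite {g \<in> carrier G. \<exists>\<tau>. shifts \<delta> g \<tau> \<and> \<bar>\<tau>\<bar> \<le> C}" (is "finite ?F")
proof -
  define B where "B = {g \<in> carrier G. gd \<one> g \<le> nat \<lceil>\<delta> + C + 4\<rceil>}"
  have "card S \<le> card B" if S: "S \<subseteq> ?F" "finite S" for S
  proof -
    have "\<forall>g\<in>S. \<exists>\<tau> T. \<bar>\<tau>\<bar> \<le> C \<and> T \<ge> 0 \<and> (\<forall>t\<ge>T. 0 \<le> t + \<tau> \<and> mdist X (ray g t) (ray \<one> (t + \<tau>)) \<le> \<delta>)"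
      using S(1) unfolding shifts_def by blast
    then obtain \<tau> T where \<tau>: "\<And>g. g \<in> S \<Longrightarrow> \<bar>\<tau> g\<bar> \<le> C"
      "\<And>g t. g \<in> S \<Longrightarrow> t \<ge> T g \<Longrightarrow> 0 \<le> t + \<tau> g \<and> mdist X (ray g t) (ray \<one> (t + \<tau> g)) \<le> \<delta>"
      by metis
    obtain n :: nat where n: "\<And>g. g \<in> S \<Longrightarrow> T g \<le> real n"
    proof -
      obtain m where "\<And>g. g \<in> S \<Longrightarrow> T g \<le> m"
        using bdd_above_finite[OF finite_imageI[OF S(2), of T]] unfolding bdd_above_def by blast
      then have "T g \<le> real (nat \<lceil>m\<rceil>)" if "g \<in> S" for g
        using that real_nat_ceiling_ge[of m] order_trans by blast
      then show thesis using that by blast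
    qed
    let ?c = "\<lambda>g. inv (b n) \<otimes> (g \<otimes> b n)"
    have "?c ` S \<subseteq> B"
    proof
      fix z assume "z \<in> ?c ` S"
      then obtain g where g: "g \<in> S" "z = ?c g" by blast
      have gc: "g \<in> carrier G" using g S by blast
      have t: "0 \<le> real n + \<tau> g" "mdist X (ray g (real n)) (ray \<one> (real n + \<tau> g)) \<le> \<delta>"
        using \<tau>(2)[OF g(1) n[OF g(1)]] by auto
      have "mdist X (ray g (real n)) (ray \<one> (real n)) \<le> \<delta> + C + 4"
        using mdist_triangle[of "ray g (real n)" X "ray \<one> (real n + \<tau> g)" "ray \<one> (real n)"] t gc
          ray_dist(1)[of \<one> "real n + \<tau> g" "real n"] \<tau>(1)[OF g(1)] by simp
      then have "real (gd (b n) (g \<otimes> b n)) \<le> \<delta> + C + 4"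
        using gc mdist_vertices[of "g \<otimes> b n" "b n"] gd_commute[of "b n"] by simp
      then have "gd \<one> z \<le> nat \<lceil>\<delta> + C + 4\<rceil>" using g(2) gd_one[of "b n" "g \<otimes> b n"] gc by simp linarith
      then show "z \<in> B" using g(2) gc by (simp add: B_def)
    qed
    moreover have "inj_on ?c S"
      using S(1) by (intro inj_onI) (auto simp: subset_iff)
    ultimately show ?thesis using card_inj_on_le finite_ball unfolding B_def by blast
  qed
  then show ?thesis using finite_if_finite_subsets_card_bdd by blast
qed

text \<open>An isometry that fixes both ends of a divergent pair of rays moves towards one end as far as
  away from the other.\<close>

lemma shifts_cancel:
  assumes g: "g \<in> carrier G" and h: "h \<in> carrier G" and K: "divergent K g h"
  shows "\<exists>C. \<forall>y \<tau> \<tau>'. y \<in> carrier G \<longrightarrow> shifts close (inv g \<otimes> y \<otimes> g) \<tau> \<longrightarrow>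
    shifts close (inv h \<otimes> y \<otimes> h) \<tau>' \<longrightarrow> \<bar>\<tau> + \<tau>'\<bar> \<le> C"
proof -
  define Q where "Q = mdist X (ray g 0) (ray h 0) + 8"
  have up: "mdist X (ray g s) (ray h t) \<le> s + t + Q" if "s \<ge> 0" "t \<ge> 0" for s t
    using mdist_triangle[of "ray g s" X "ray g 0" "ray h t"] mdist_triangle[of "ray g 0" X "ray h 0" "ray h t"]
      ray_dist(1)[OF g that(1), of 0] ray_dist(1)[OF h _ that(2), of 0] that g h by (simp add: Q_def)
  have "\<bar>\<tau> + \<tau>'\<bar> \<le> K + Q + 2 * close"
    if y: "y \<in> carrier G" and sg: "shifts close (inv g \<otimes> y \<otimes> g) \<tau>" and sh: "shifts close (inv h \<otimes> y \<otimes> h) \<tau>'"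
    for y \<tau> \<tau>'
  proof -
    obtain T T' where T: "T \<ge> 0" "\<And>t. t \<ge> T \<Longrightarrow> 0 \<le> t + \<tau> \<and> mdist X (ray (inv g \<otimes> y \<otimes> g) t) (ray \<one> (t + \<tau>)) \<le> close"
      and T': "T' \<ge> 0" "\<And>t. t \<ge> T' \<Longrightarrow> 0 \<le> t + \<tau>' \<and> mdist X (ray (inv h \<otimes> y \<otimes> h) t) (ray \<one> (t + \<tau>')) \<le> close"
      using sg sh unfolding shifts_def by blast
    define t where "t = max T T'"
    have t: "t \<ge> T" "t \<ge> T'" "t \<ge> 0" using T(1) by (auto simp: t_def)
    have conj: "k \<otimes> (inv k \<otimes> y \<otimes> k) = y \<otimes> k" if "k \<in> carrier G" for k
      using that y by (simp add: m_assoc[symmetric])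
    have 1: "mdist X (ray (y \<otimes> g) t) (ray g (t + \<tau>)) \<le> close" "0 \<le> t + \<tau>"
      using mdist_ray_translate[of g "inv g \<otimes> y \<otimes> g" \<one> t "t + \<tau>"] T(2)[OF t(1)] conj[OF g] g y by auto
    have 2: "mdist X (ray (y \<otimes> h) t) (ray h (t + \<tau>')) \<le> close" "0 \<le> t + \<tau>'"
      using mdist_ray_translate[of h "inv h \<otimes> y \<otimes> h" \<one> t "t + \<tau>'"] T'(2)[OF t(2)] conj[OF h] h y by auto
    have 3: "mdist X (ray (y \<otimes> g) t) (ray (y \<otimes> h) t) = mdist X (ray g t) (ray h t)"
      using mdist_ray_translate[OF y g h] .
    have m: "ray (y \<otimes> g) t \<in> mspace X" "ray (y \<otimes> h) t \<in> mspace X" "ray g (t + \<tau>) \<in> mspace X"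
      "ray h (t + \<tau>') \<in> mspace X" using y g h by auto
    have 4: "mdist X (ray g (t + \<tau>)) (ray h (t + \<tau>')) \<le> 2 * close + mdist X (ray g t) (ray h t)"
      "mdist X (ray g t) (ray h t) \<le> 2 * close + mdist X (ray g (t + \<tau>)) (ray h (t + \<tau>'))"
      using mdist_triangle[OF m(3,1,4)] mdist_triangle[OF m(1,2,4)] mdist_triangle[OF m(1,3,2)]
        mdist_triangle[OF m(3,4,2)] 1 2 3 mdist_commute[of X "ray g (t + \<tau>)" "ray (y \<otimes> g) t"]
        mdist_commute[of X "ray h (t + \<tau>')" "ray (y \<otimes> h) t"] by linarith+
    have "(t + \<tau>) + (t + \<tau>') - K \<le> mdist X (ray g (t + \<tau>)) (ray h (t + \<tau>'))" "t + t - K \<le> mdist X (ray g t) (ray h t)"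
      using K 1(2) 2(2) t(3) unfolding divergent_def by blast+
    then show ?thesis using 4 up[OF t(3,3)] up[OF 1(2) 2(2)] by linarith
  qed
  then show ?thesis by blast
qed

section \<open>Normal subgroups that fix the end of a Morse ray\<close>

text \<open>If an infinite normal subgroup fixed three ends in one orbit, then its elements would have
  bounded shifts along all three, by pairwise cancellation; but only finitely many elements do.\<close>

lemma orbit_of_fixed_end_small:
  assumes H: "H \<lhd> G" "infinite H" and fixed: "\<And>x. x \<in> H \<Longrightarrow> \<exists>\<tau>. shifts close x \<tau>"
    and g: "g \<in> carrier G" "\<nexists>\<tau>. shifts close g \<tau>" and h: "h \<in> carrier G" "\<nexists>\<tau>. shifts close h \<tau>"
  shows "\<exists>\<tau>. shifts close (inv g \<otimes> h) \<tau>"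
proof (rule ccontr)
  assume gh: "\<nexists>\<tau>. shifts close (inv g \<otimes> h) \<tau>"
  have Hc: "H \<subseteq> carrier G" using H(1) by (simp add: normal_def subgroup.subset)
  obtain K\<^sub>1 K\<^sub>2 K\<^sub>3 where K: "divergent K\<^sub>1 \<one> g" "divergent K\<^sub>2 \<one> h" "divergent K\<^sub>3 g h"
    using shifts_or_divergent[of \<one> g] shifts_or_divergent[of \<one> h] shifts_or_divergent[OF g(1) h(1)] g h gh
    by auto
  obtain C\<^sub>1 where C1: "\<And>y \<tau> \<tau>'. y \<in> carrier G \<Longrightarrow> shifts close (inv \<one> \<otimes> y \<otimes> \<one>) \<tau> \<Longrightarrow>
      shifts close (inv g \<otimes> y \<otimes> g) \<tau>' \<Longrightarrow> \<bar>\<tau> + \<tau>'\<bar> \<le> C\<^sub>1"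
    using shifts_cancel[OF one_closed g(1) K(1)] by blast
  obtain C\<^sub>2 where C2: "\<And>y \<tau> \<tau>'. y \<in> carrier G \<Longrightarrow> shifts close (inv \<one> \<otimes> y \<otimes> \<one>) \<tau> \<Longrightarrow>
      shifts close (inv h \<otimes> y \<otimes> h) \<tau>' \<Longrightarrow> \<bar>\<tau> + \<tau>'\<bar> \<le> C\<^sub>2"
    using shifts_cancel[OF one_closed h(1) K(2)] by blast
  obtain C\<^sub>3 where C3: "\<And>y \<tau> \<tau>'. y \<in> carrier G \<Longrightarrow> shifts close (inv g \<otimes> y \<otimes> g) \<tau> \<Longrightarrow>
      shifts close (inv h \<otimes> y \<otimes> h) \<tau>' \<Longrightarrow> \<bar>\<tau> + \<tau>'\<bar> \<le> C\<^sub>3"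
    using shifts_cancel[OF g(1) h(1) K(3)] by blast
  have "\<exists>\<tau>. shifts close y \<tau> \<and> \<bar>\<tau>\<bar> \<le> C\<^sub>1 + C\<^sub>2 + C\<^sub>3" if y: "y \<in> H" for y
  proof -
    have yc: "y \<in> carrier G" using y Hc by blast
    have "inv g \<otimes> y \<otimes> g \<in> H" "inv h \<otimes> y \<otimes> h \<in> H"
      using normal.inv_op_closed1[OF H(1)] g(1) h(1) y by auto
    then obtain \<tau> \<tau>\<^sub>g \<tau>\<^sub>h where \<tau>: "shifts close y \<tau>" "shifts close (inv g \<otimes> y \<otimes> g) \<tau>\<^sub>g" "shifts close (inv h \<otimes> y \<otimes> h) \<tau>\<^sub>h"
      using fixed y by metis
    have y1: "shifts close (inv \<one> \<otimes> y \<otimes> \<one>) \<tau>" using \<tau>(1) yc by simp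
    show ?thesis using C1[OF yc y1 \<tau>(2)] C2[OF yc y1 \<tau>(3)] C3[OF yc \<tau>(2,3)] \<tau>(1)
      by (intro exI[of _ \<tau>]) linarith
  qed
  then have "H \<subseteq> {g \<in> carrier G. \<exists>\<tau>. shifts close g \<tau> \<and> \<bar>\<tau>\<bar> \<le> C\<^sub>1 + C\<^sub>2 + C\<^sub>3}" using Hc by blast
  then show False using H(2) finite_bounded_shifts finite_subset by blast
qed

text \<open>The subgroup contains an element with a large shift. Multiplication by it and its inverse
  reduces the shift of any element that fixes the end to a bounded one.\<close>

lemma stabilizer_near_fixing_subgroup:
  assumes H: "subgroup H G" "infinite H" and fixed: "\<And>x. x \<in> H \<Longrightarrow> \<exists>\<tau>. shifts close x \<tau>"
  shows "\<exists>C. \<forall>g\<in>carrier G. (\<exists>\<tau>. shifts close g \<tau>) \<longrightarrow> (\<exists>h\<in>H. gd g h \<le> C)"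
proof -
  have Hc: "H \<subseteq> carrier G" using H(1) by (rule subgroup.subset)
  \<comment> \<open>The error in the shift of a product, by \<open>shift_mult\<close> and \<open>shift_improve\<close>.\<close>
  define q where "q = 3 * close + 4"
  obtain y \<tau>\<^sub>0 where y: "y \<in> H" "shifts close y \<tau>\<^sub>0" "\<bar>\<tau>\<^sub>0\<bar> > q + 1"
  proof -
    have "\<not> H \<subseteq> {g \<in> carrier G. \<exists>\<tau>. shifts close g \<tau> \<and> \<bar>\<tau>\<bar> \<le> q + 1}"
      using H(2) finite_bounded_shifts finite_subset by blast
    then obtain y where "y \<in> H" "\<not> (\<exists>\<tau>. shifts close y \<tau> \<and> \<bar>\<tau>\<bar> \<le> q + 1)" using Hc by blast
    then show thesis using that fixed[of y] by (meson not_le)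
  qed
  define F where "F = {g \<in> carrier G. \<exists>\<tau>. shifts close g \<tau> \<and> \<bar>\<tau>\<bar> \<le> \<bar>\<tau>\<^sub>0\<bar> + 1}"
  have F: "finite F" unfolding F_def by (rule finite_bounded_shifts)
  have red: "\<exists>h\<in>H. h \<otimes> g \<in> F" if g: "g \<in> carrier G" "\<exists>\<tau>. shifts close g \<tau>" for g
  proof -
    \<comment> \<open>Choose the element of \<open>H g\<close> with the smallest shift.\<close>
    define P where "P n \<longleftrightarrow> (\<exists>h\<in>H. \<exists>\<tau>. shifts close (h \<otimes> g) \<tau> \<and> nat \<lfloor>\<bar>\<tau>\<bar>\<rfloor> = n)" for n
    have "shifts close (\<one> \<otimes> g) \<tau> \<longleftrightarrow> shifts close g \<tau>" for \<tau> using g(1) by simp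
    then have "\<exists>n. P n" using g(2) subgroup.one_closed[OF H(1)] unfolding P_def by blast
    then have "P (LEAST n. P n)" by (rule LeastI_ex)
    then obtain h \<tau> where h: "h \<in> H" "shifts close (h \<otimes> g) \<tau>" "nat \<lfloor>\<bar>\<tau>\<bar>\<rfloor> = (LEAST n. P n)"
      unfolding P_def by blast
    have hg: "h \<otimes> g \<in> carrier G" using h(1) Hc g by auto
    have "\<bar>\<tau>\<bar> \<le> \<bar>\<tau>\<^sub>0\<bar> + 1"
    proof (rule ccontr)
      assume big: "\<not> \<bar>\<tau>\<bar> \<le> \<bar>\<tau>\<^sub>0\<bar> + 1"
      obtain y' \<tau>' where y': "y' \<in> H" "shifts close y' \<tau>'" "\<bar>\<tau> + \<tau>'\<bar> = \<bar>\<tau>\<bar> - \<bar>\<tau>\<^sub>0\<bar>"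
      proof (cases "\<tau> * \<tau>\<^sub>0 \<le> 0")
        case True
        then have "\<bar>\<tau> + \<tau>\<^sub>0\<bar> = \<bar>\<tau>\<bar> - \<bar>\<tau>\<^sub>0\<bar>" using big by (auto simp: mult_le_0_iff abs_if split: if_splits)
        then show thesis using that[of y \<tau>\<^sub>0] y by blast
      next
        case False
        then have "\<bar>\<tau> + - \<tau>\<^sub>0\<bar> = \<bar>\<tau>\<bar> - \<bar>\<tau>\<^sub>0\<bar>" using big by (auto simp: mult_le_0_iff abs_if split: if_splits)
        moreover have "shifts close (inv y) (- \<tau>\<^sub>0)" using y Hc by (intro shift_inv) auto
        ultimately show thesis using that[of "inv y" "- \<tau>\<^sub>0"] y(1) subgroup.m_inv_closed[OF H(1)] by blast
      qed
      have y'c: "y' \<in> carrier G" using y' Hc by blast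
      have "shifts (close + close) (y' \<otimes> (h \<otimes> g)) (\<tau> + \<tau>')"
        by (rule shift_mult[OF y'c hg y'(2) h(2)])
      then obtain \<sigma> where \<sigma>: "shifts close (y' \<otimes> (h \<otimes> g)) \<sigma>" "\<bar>\<sigma> - (\<tau> + \<tau>')\<bar> \<le> close + (close + close) + 4"
        using shift_improve[of "y' \<otimes> (h \<otimes> g)"] y'c hg by blast
      then have "\<bar>\<sigma>\<bar> < \<bar>\<tau>\<bar> - 1" using y'(3) y(3) unfolding q_def by linarith
      then have "nat \<lfloor>\<bar>\<sigma>\<bar>\<rfloor> < nat \<lfloor>\<bar>\<tau>\<bar>\<rfloor>" by linarith
      moreover have "P (nat \<lfloor>\<bar>\<sigma>\<bar>\<rfloor>)"
      proof -
        have "y' \<otimes> (h \<otimes> g) = (y' \<otimes> h) \<otimes> g" using y'c h(1) Hc g by (auto simp: m_assoc)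
        then have "shifts close ((y' \<otimes> h) \<otimes> g) \<sigma>" using \<sigma>(1) by simp
        moreover have "y' \<otimes> h \<in> H" using subgroup.m_closed[OF H(1) y'(1) h(1)] .
        ultimately show ?thesis unfolding P_def by blast
      qed
      ultimately show False using h(3) not_less_Least by metis
    qed
    then show ?thesis using h(1,2) hg unfolding F_def by blast
  qed
  define C where "C = (\<Sum>z\<in>F. gd z \<one>)"
  have "\<exists>h\<in>H. gd g h \<le> C" if g: "g \<in> carrier G" "\<exists>\<tau>. shifts close g \<tau>" for g
  proof -
    obtain h where h: "h \<in> H" "h \<otimes> g \<in> F" using red[OF g] by blast
    have hc: "h \<in> carrier G" using h(1) Hc by blast
    have "gd g (inv h) = gd (h \<otimes> g) \<one>" using gd_left_mult[of h g "inv h"] hc g(1) by simp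
    also have "\<dots> \<le> C" unfolding C_def using member_le_sum[OF h(2) _ F, of "\<lambda>z. gd z \<one>"] by simp
    finally show ?thesis using subgroup.m_inv_closed[OF H(1) h(1)] by blast
  qed
  then show ?thesis by blast
qed

text \<open>The orbit of the end has at most two points, so the group is covered by the stabiliser and one of
  its cosets, which normality brings back next to \<open>H\<close>.\<close>

lemma group_near_fixing_normal_subgroup:
  assumes H: "H \<lhd> G" "infinite H" and fixed: "\<And>x. x \<in> H \<Longrightarrow> \<exists>\<tau>. shifts close x \<tau>"
  shows "\<exists>C. \<forall>g\<in>carrier G. \<exists>h\<in>H. gd g h \<le> C"
proof -
  have sub: "subgroup H G" using H(1) by (simp add: normal_def)
  have Hc: "H \<subseteq> carrier G" using sub by (rule subgroup.subset)
  obtain C where C: "\<And>g. g \<in> carrier G \<Longrightarrow> \<exists>\<tau>. shifts close g \<tau> \<Longrightarrow> \<exists>h\<in>H. gd g h \<le> C"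
    using stabilizer_near_fixing_subgroup[OF sub H(2) fixed] by blast
  show ?thesis
  proof (cases "\<forall>g\<in>carrier G. \<exists>\<tau>. shifts close g \<tau>")
    case True
    then show ?thesis using C by blast
  next
    case False
    then obtain g0 where g0: "g0 \<in> carrier G" "\<nexists>\<tau>. shifts close g0 \<tau>" by blast
    have "\<exists>h\<in>H. gd g h \<le> C + gd \<one> (inv g0)" if g: "g \<in> carrier G" for g
    proof (cases "\<exists>\<tau>. shifts close g \<tau>")
      case True
      then obtain h where "h \<in> H" "gd g h \<le> C" using C[OF g] by blast
      then show ?thesis by (intro bexI[of _ h]) simp_all
    next
      case False
      then have "\<exists>\<tau>. shifts close (inv g0 \<otimes> g) \<tau>"
        using orbit_of_fixed_end_small[OF H fixed g0 g] by blast
      then obtain h where h: "h \<in> H" "gd (inv g0 \<otimes> g) h \<le> C" using C[of "inv g0 \<otimes> g"] g g0 by blast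
      have hc: "h \<in> carrier G" using h Hc by blast
      let ?h = "g0 \<otimes> h \<otimes> inv g0"
      have "g0 \<otimes> (inv g0 \<otimes> g) = g" using g0 g by (simp add: m_assoc[symmetric])
      then have "gd g (g0 \<otimes> h) \<le> C" using gd_left_mult[of g0 "inv g0 \<otimes> g" h] h(2) g0 g hc by simp
      moreover have "gd (g0 \<otimes> h) ?h = gd \<one> (inv g0)"
        using gd_left_mult[of "g0 \<otimes> h" \<one> "inv g0"] g0 hc by simp
      ultimately have "gd g ?h \<le> C + gd \<one> (inv g0)"
        using gd_triangle[of g "g0 \<otimes> h" ?h] g g0 hc by simp
      moreover have "?h \<in> H" using normal.inv_op_closed2[OF H(1) g0(1) h(1)] .
      ultimately show ?thesis by blast
    qed
    then show ?thesis by blast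
  qed
qed

end


section \<open>Limit sets of normal subgroups\<close>

context cayley begin

text \<open>The ray itself is followed up to a late vertex, and only the last point is moved into \<open>H\<close>.\<close>

lemma in_limit_set_if_group_near:
  assumes H: "H \<subseteq> carrier G" and near: "\<And>g. g \<in> carrier G \<Longrightarrow> \<exists>h\<in>H. gd g h \<le> C"
    and M: "morse_gauge M" and \<alpha>: "\<alpha> \<in> morse_rays_of_gauge X e M"
  shows "asymptotic X e `` {\<alpha>} \<in> limit_set G A H"
proof -
  obtain f where f: "rough_geodesic UNIV f" "f 0 = \<one>"
    and f\<alpha>: "\<And>t. t \<ge> 0 \<Longrightarrow> mdist X (step_path f t) (\<alpha> t) \<le> 2"
    and fM: "morse X (transported_gauge 1 0 1 4 1 0 2 M) {0..} (step_path f)"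
    by (rule discretise_morse_ray[OF M \<alpha>]) blast
  let ?M\<^sub>1 = "transported_gauge 1 0 1 4 1 0 2 M"
  let ?M\<^sub>2 = "transported_gauge 1 4 1 (4 + 2 * C) 1 0 C ?M\<^sub>1"
  have M1: "morse_gauge ?M\<^sub>1" by (rule morse_gauge_transported[OF M]) auto
  have M2: "morse_gauge ?M\<^sub>2" by (rule morse_gauge_transported[OF M1]) auto
  have fc: "\<And>n. f n \<in> carrier G" using rough_geodesic_carrier[OF f(1)] .
  show ?thesis
  proof (rule in_limit_set_if_followed[OF M \<alpha> M2 H])
    fix n :: nat
    let ?l = "real (Suc n)"
    obtain h where h: "h \<in> H" "gd (f (Suc n)) h \<le> C" using near[OF fc] by blast
    have hc: "h \<in> carrier G" using h H by blast
    define \<eta> where "\<eta> = (step_path f)(?l := vertex h)"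
    have \<eta>X: "\<eta> t \<in> mspace X" for t using step_path_in_X[OF fc] hc by (simp add: \<eta>_def)
    have d: "mdist X (\<eta> t) (step_path f t) \<le> real C" for t
    proof (cases "t = ?l")
      case True
      then have "mdist X (\<eta> t) (step_path f t) = real (gd h (f (Suc n)))"
        unfolding True step_path_of_nat using mdist_vertices[OF hc fc] by (simp add: \<eta>_def)
      then show ?thesis using h(2) gd_commute[of h] by simp
    next
      case False
      then show ?thesis using step_path_in_X[OF fc] by (simp add: \<eta>_def)
    qed
    have "quasi_geodesic X 1 4 {0..?l} (step_path f)"
      by (rule quasi_geodesic_subset[OF quasi_geodesic_step_ray[OF f(1)]]) auto
    then have q: "quasi_geodesic X 1 (4 + 2 * real C) {0..?l} \<eta>"
      by (rule quasi_geodesic_perturb) (use \<eta>X d in auto)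
    have "morse X ?M\<^sub>2 {0..?l} \<eta>"
      by (rule morse_transport[OF quasi_geodesic_step_ray[OF f(1)] fM M1 _ _ _ _ _ quasi_isometric_embedding_id,
            where r = "\<lambda>t. t"]) (use quasi_geodesicD[OF q] d in auto)
    moreover have "\<eta> 0 = e" "\<eta> ?l = vertex h" using f(2) by (simp_all add: \<eta>_def step_path_def)
    moreover have "mdist X (\<eta> t) (\<alpha> t) \<le> 2" if "t \<in> {0..real n}" for t
      using f\<alpha>[of t] that by (simp add: \<eta>_def)
    ultimately show "\<exists>h\<in>H. \<exists>l \<eta>. quasi_geodesic X 1 (4 + 2 * real C) {0..l} \<eta> \<and> morse X ?M\<^sub>2 {0..l} \<eta> \<and>
        \<eta> 0 = e \<and> \<eta> l = vertex h \<and> real n \<le> l \<and> (\<forall>t\<in>{0..real n}. mdist X (\<eta> t) (\<alpha> t) \<le> 2)"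
      using q h(1) by (intro bexI[of _ h] exI[of _ ?l] exI[of _ \<eta>] conjI) auto
  qed
qed

end

context morse_ray_translates begin

text \<open>Come in along the reversed ray and leave along its translate by \<open>x\<close>. The jump at 0 stands for a
  path between the starting points.\<close>

definition turn :: "'a \<Rightarrow> real \<Rightarrow> 'a \<Rightarrow> real" where
  "turn x t = (if t \<le> 0 then ray \<one> (- t) else ray x t)"

text \<open>Divergence is the lower bound for distances across the jump, and Morse halves glue to a
  Morse path.\<close>

lemma turn_morse:
  assumes x: "x \<in> carrier G" and K: "divergent K \<one> x"
  shows "\<exists>c M'. c \<ge> 4 \<and> morse_gauge M' \<and> quasi_geodesic X 1 c UNIV (turn x) \<and> morse X M' UNIV (turn x)"
proof -
  define Q where "Q = mdist X (ray \<one> 0) (ray x 0)"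
  define c where "c = 8 + Q + \<bar>K\<bar>"
  have Q: "Q \<ge> 0" by (simp add: Q_def)
  then have c: "c \<ge> 4" by (simp add: c_def)
  have q: "quasi_geodesic X 1 c UNIV (turn x)"
  proof (rule quasi_geodesicI)
    show "turn x \<in> UNIV \<rightarrow> mspace X" using x by (simp add: turn_def)
    fix s t :: real assume st: "s \<le> t"
    consider "t \<le> 0" | "s \<le> 0" "0 < t" | "0 < s" using st by linarith
    then have "t - s \<le> mdist X (turn x s) (turn x t) + c \<and> mdist X (turn x s) (turn x t) \<le> t - s + c"
    proof cases
      case 1
      then show ?thesis using ray_dist[of \<one> "- s" "- t"] st c by (simp add: turn_def)
    next
      case 2
      have "(- s) + t - K \<le> mdist X (ray \<one> (- s)) (ray x t)" 
        using K[unfolded divergent_def, rule_format, of "- s" t] 2 by simp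
      moreover have "mdist X (ray \<one> (- s)) (ray x t) \<le> (- s + 4) + Q + (t + 4)"
        using mdist_triangle[of "ray \<one> (- s)" X "ray \<one> 0" "ray x t"] mdist_triangle[of "ray \<one> 0" X "ray x 0" "ray x t"]
          ray_dist(1)[of \<one> "- s" 0] ray_dist(1)[of x 0 t] 2 x by (simp add: Q_def)
      moreover have "K \<le> \<bar>K\<bar>" "0 \<le> \<bar>K\<bar>" by auto
      ultimately have "t - s \<le> mdist X (ray \<one> (- s)) (ray x t) + c"
        "mdist X (ray \<one> (- s)) (ray x t) \<le> t - s + c" using Q unfolding c_def by linarith+
      then show ?thesis using 2 by (simp add: turn_def)
    next
      case 3
      then show ?thesis using ray_dist[of x s t] x st c by (simp add: turn_def)
    qed
    then show "t - s \<le> 1 * (mdist X (turn x s) (turn x t) + c)" "mdist X (turn x s) (turn x t) \<le> 1 * (t - s) + c"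
      by simp_all
  qed (use c in auto)
  note D = quasi_geodesicD[OF q]
  let ?M = "transported_gauge 1 4 1 c 1 0 Q M"
  have gauge: "morse_gauge ?M" using c Q by (intro morse_gauge_transported[OF M]) auto
  have lip: "mdist X (turn x s) (turn x t) \<le> 1 * \<bar>s - t\<bar> + c" for s t using D(7) by simp
  have "mdist X (turn x t) (ray \<one> (- t)) \<le> Q" if "t \<le> 0" for t
    using that Q by (simp add: turn_def)
  then have "morse X ?M {..0} (turn x)"
    by (intro morse_transport[OF quasi_geodesic_ray[OF one_closed] morse_ray[OF one_closed] M _ _ _ _ lip
          quasi_isometric_embedding_id, where r = "\<lambda>t. - t"])
      (use D(5) Q c in \<open>auto simp: is_interval_ic\<close>)
  moreover have "mdist X (turn x t) (ray x t) \<le> Q" if "t \<ge> 0" for t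
    using that x Q by (cases "t = 0") (auto simp: turn_def Q_def)
  then have "morse X ?M {0..} (turn x)"
    by (intro morse_transport[OF quasi_geodesic_ray[OF x] morse_ray[OF x] M _ _ _ _ lip
          quasi_isometric_embedding_id, where r = "\<lambda>t. t"])
      (use D(5) Q c in \<open>auto simp: is_interval_ci\<close>)
  ultimately have "morse X (\<lambda>k c. ?M (3 * k) (c + 2 + 5 * 4)) UNIV (turn x)"
    by (intro morse_glue[OF coarsely_geodesic_X gauge, where z = 0]) (use D in auto)
  moreover have "morse_gauge (\<lambda>k c. ?M (3 * k) (c + 2 + 5 * 4))"
    using gauge unfolding morse_gauge_def by simp
  ultimately show ?thesis using c q by blast
qed

end

context cayley begin

text \<open>Walk along \<open>f\<close> up to a point from which the way back looks like \<open>b\<close>, turn there by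
  \<open>x\<close>, and walk back along the corresponding translate of \<open>f\<close>. The short pieces of this path are pieces
  of translates of \<open>f\<close> or of the bi-infinite path through \<open>b\<close> and \<open>x \<cdot> b\<close>, so it is uniformly
  Morse. It ends at a conjugate of \<open>x\<close>.\<close>

lemma in_limit_set_if_turn:
  assumes ltg: "morse_local_to_global_space X" and H: "H \<lhd> G" and x: "x \<in> H"
    and M: "morse_gauge M" and \<alpha>: "\<alpha> \<in> morse_rays_of_gauge X e M"
    and f: "rough_geodesic UNIV f" "f 0 = \<one>" "morse X M\<^sub>1 {0..} (step_path f)" "morse_gauge M\<^sub>1"
      "\<And>t. t \<ge> 0 \<Longrightarrow> mdist X (step_path f t) (\<alpha> t) \<le> 2"
    and b: "\<And>n. n \<le> \<kappa> n" "\<And>n m. m \<le> n \<Longrightarrow> b m = inv (f (\<kappa> n)) \<otimes> f (\<kappa> n - m)"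
    and \<Lambda>: "quasi_geodesic X 1 c UNIV \<Lambda>" "morse X M\<^sub>2 UNIV \<Lambda>" "morse_gauge M\<^sub>2" "c \<ge> 4"
      "\<And>m. \<Lambda> (- real m) = vertex (b m)" "\<And>m. m > 0 \<Longrightarrow> \<Lambda> (real m) = vertex (x \<otimes> b m)"
  shows "asymptotic X e `` {\<alpha>} \<in> limit_set G A H"
proof -
  have sub: "subgroup H G" using H by (simp add: normal_def)
  have Hc: "H \<subseteq> carrier G" using sub by (rule subgroup.subset)
  have xc: "x \<in> carrier G" using x Hc by blast
  have fc: "\<And>n. f n \<in> carrier G" using rough_geodesic_carrier[OF f(1)] .
  let ?N\<^sub>1 = "transported_gauge 1 4 1 (4 + 1) 1 2 0 M\<^sub>1" and ?N\<^sub>2 = "transported_gauge 1 c 1 (c + 1) 1 2 0 M\<^sub>2"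
  define N where "N = (\<lambda>k c. max (?N\<^sub>1 k c) (?N\<^sub>2 k c))"
  have "morse_gauge ?N\<^sub>1" by (rule morse_gauge_transported[OF f(4)]) auto
  then have N: "morse_gauge N" by (simp add: morse_gauge_def N_def le_max_iff_disj)
  have N1: "morse_quasi_geodesic X N 1 (c + 1) I \<gamma>" if "morse_quasi_geodesic X ?N\<^sub>1 1 (4 + 1) I \<gamma>" for I \<gamma>
    using that \<Lambda>(4) unfolding morse_quasi_geodesic_def
    by (auto elim!: quasi_geodesic_mono morse_mono simp: N_def)
  have N2: "morse_quasi_geodesic X N 1 (c + 1) I \<gamma>" if "morse_quasi_geodesic X ?N\<^sub>2 1 (c + 1) I \<gamma>" for I \<gamma>
    using that unfolding morse_quasi_geodesic_def
    by (auto elim!: morse_mono simp: N_def)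
  have "\<exists>B M' k' c'. B \<ge> 0 \<and> morse_gauge M' \<and> k' \<ge> 1 \<and> c' \<ge> 0 \<and>
      (\<forall>I \<gamma>. local_morse_quasi_geodesic X B N 1 (c + 1) I \<gamma> \<longrightarrow> morse_quasi_geodesic X M' k' c' I \<gamma>)"
    using ltg N \<Lambda>(4) unfolding morse_local_to_global_space_def by simp
  then obtain B M' k' c' where B: "B \<ge> 0" "morse_gauge M'"
    and global: "\<And>I \<gamma>. local_morse_quasi_geodesic X B N 1 (c + 1) I \<gamma> \<Longrightarrow> morse_quasi_geodesic X M' k' c' I \<gamma>"
    by blast
  show ?thesis
  proof (rule in_limit_set_if_followed[OF M \<alpha> B(2) Hc])
    fix n :: nat
    \<comment> \<open>Pieces of length \<open>B\<close> that contain the turning point stay within the window of size \<open>L\<close> in which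
      the way back agrees with \<open>b\<close>.\<close>
    define L where "L = max n (nat \<lceil>B\<rceil> + 2)"
    have L: "n \<le> L" "B + 2 \<le> real L" unfolding L_def by (auto simp: le_max_iff_disj) linarith
    define k where "k = \<kappa> L"
    have k: "L \<le> k" using b(1) by (simp add: k_def)
    have bk: "b m = inv (f k) \<otimes> f (k - m)" if "m \<le> L" for m using b(2)[OF that] by (simp add: k_def)
    define h where "h = f k \<otimes> x \<otimes> inv (f k)"
    have h: "h \<in> H" unfolding h_def using normal.inv_op_closed2[OF H fc x] .
    have hc: "h \<in> carrier G" using h Hc by blast
    define \<eta> where "\<eta> m = (if m \<le> k then f m else h \<otimes> f (2 * k - m))" for m
    have \<eta>c: "\<eta> m \<in> carrier G" for m using fc hc by (simp add: \<eta>_def)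
    let ?l = "real (2 * k)"
    have "local_morse_quasi_geodesic X B N 1 (c + 1) {0..?l} (step_path \<eta>)"
      unfolding local_morse_quasi_geodesic_def
    proof (intro conjI allI impI)
      show "step_path \<eta> \<in> {0..?l} \<rightarrow> mspace X" using step_path_in_X[OF \<eta>c] by simp
      fix s t assume st: "s \<le> t \<and> {s..t} \<subseteq> {0..?l} \<and> \<bar>s - t\<bar> \<le> B"
      then have s0: "0 \<le> s" and tl: "t \<le> ?l" by auto
      have fl: "real (nat \<lfloor>u\<rfloor>) \<le> u" "u < real (nat \<lfloor>u\<rfloor>) + 1" if "u \<in> {s..t}" for u
        using that s0 by auto
      consider "t < real k + 1" | "real k + 1 \<le> s" | "s < real k + 1" "real k + 1 \<le> t" by linarith
      then show "morse_quasi_geodesic X N 1 (c + 1) {s..t} (step_path \<eta>)"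
      proof cases
        case 1
        show ?thesis
        proof (rule N1, rule morse_window[OF quasi_geodesic_step_ray[OF f(1)] f(3,4) \<eta>c one_closed s0,
              where N = "{..k}" and r = real])
          fix u assume u: "u \<in> {s..t}"
          then have "real (nat \<lfloor>u\<rfloor>) < real (k + 1)" using fl(1)[OF u] 1 by auto
          then show "nat \<lfloor>u\<rfloor> \<in> {..k}" by (simp only: of_nat_less_iff) simp
        qed (use fc in \<open>auto simp: \<eta>_def\<close>)
      next
        case 2
        show ?thesis
        proof (rule N1, rule morse_window[OF quasi_geodesic_step_ray[OF f(1)] f(3,4) \<eta>c inv_closed[OF hc] s0,
              where N = "{k<..2 * k}" and r = "\<lambda>m. real (2 * k - m)"])
          fix u assume u: "u \<in> {s..t}"
          have "real k < real (nat \<lfloor>u\<rfloor>)" "real (nat \<lfloor>u\<rfloor>) \<le> real (2 * k)" 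
            using fl[OF u] u 2 tl unfolding atLeastAtMost_iff by linarith+
          then show "nat \<lfloor>u\<rfloor> \<in> {k<..2 * k}" by (simp only: of_nat_less_iff of_nat_le_iff) simp
        next
          fix m assume "m \<in> {k<..2 * k}"
          then show "real (2 * k - m) \<in> {0..} \<and> step_path f (real (2 * k - m)) = vertex (inv h \<otimes> \<eta> m)"
            unfolding step_path_of_nat using fc hc by (simp add: \<eta>_def m_assoc[symmetric])
        qed (auto simp: of_nat_diff)
      next
        case 3
        show ?thesis
        proof (rule N2, rule morse_window[OF \<Lambda>(1-3) \<eta>c inv_closed[OF fc[of k]] s0,
              where N = "{k - L..k + L}" and r = "\<lambda>m. real m - real k"])
          fix u assume u: "u \<in> {s..t}"
          have "real (k - L) = real k - real L" "real (k + L) = real k + real L"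
            using k by (simp_all add: of_nat_diff)
          moreover have "t - s \<le> B" using st by auto
          ultimately have "real (k - L) \<le> real (nat \<lfloor>u\<rfloor>)" "real (nat \<lfloor>u\<rfloor>) \<le> real (k + L)"
            using fl[OF u] u 3 L(2) unfolding atLeastAtMost_iff by linarith+
          then show "nat \<lfloor>u\<rfloor> \<in> {k - L..k + L}" by (simp only: of_nat_le_iff) simp
        next
          fix m assume m: "m \<in> {k - L..k + L}"
          have "\<Lambda> (real m - real k) = vertex (inv (f k) \<otimes> \<eta> m)"
          proof (cases "m \<le> k")
            case True
            then have "real m - real k = - real (k - m)" "k - m \<le> L" "k - (k - m) = m"
              using m by (auto simp: of_nat_diff)
            then show ?thesis using \<Lambda>(5)[of "k - m"] bk[of "k - m"] True by (simp add: \<eta>_def)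
          next
            case False
            then have m': "real m - real k = real (m - k)" "m - k \<le> L" "0 < m - k" "k - (m - k) = 2 * k - m"
              using m by (auto simp: of_nat_diff)
            have "inv (f k) \<otimes> \<eta> m = x \<otimes> (inv (f k) \<otimes> f (2 * k - m))"
              using False fc xc by (simp add: \<eta>_def h_def m_assoc[symmetric])
            then have "x \<otimes> b (m - k) = inv (f k) \<otimes> \<eta> m" unfolding bk[OF m'(2)] m'(4) by simp
            then show ?thesis unfolding m'(1) \<Lambda>(6)[OF m'(3)] by simp
          qed
          then show "real m - real k \<in> UNIV \<and> \<Lambda> (real m - real k) = vertex (inv (f k) \<otimes> \<eta> m)" by simp
        qed auto
      qed
    qed auto
    from global[OF this] have q: "quasi_geodesic X k' c' {0..?l} (step_path \<eta>)" "morse X M' {0..?l} (step_path \<eta>)"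
      by (auto simp: morse_quasi_geodesic_def)
    have e0: "step_path \<eta> 0 = e" using f(2) by (simp add: step_path_def \<eta>_def)
    have "\<eta> (2 * k) = h"
    proof (cases "k = 0")
      case True
      then show ?thesis using L k B(1) by simp
    next
      case False
      then show ?thesis using f(2) hc by (simp add: \<eta>_def)
    qed
    then have el: "step_path \<eta> ?l = vertex h" unfolding step_path_of_nat by simp
    have "mdist X (step_path \<eta> t) (\<alpha> t) \<le> 2" if t: "t \<in> {0..real n}" for t
    proof -
      have "nat \<lfloor>t\<rfloor> \<le> n" using t by (simp add: nat_le_iff floor_le_iff)
      then have "step_path \<eta> t = step_path f t" using L(1) k by (simp add: step_path_def \<eta>_def)
      then show ?thesis using f(5) t by simp
    qed
    moreover have "real n \<le> ?l" using L(1) k by simp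
    ultimately show "\<exists>h\<in>H. \<exists>l \<eta>. quasi_geodesic X k' c' {0..l} \<eta> \<and> morse X M' {0..l} \<eta> \<and>
        \<eta> 0 = e \<and> \<eta> l = vertex h \<and> real n \<le> l \<and> (\<forall>t\<in>{0..real n}. mdist X (\<eta> t) (\<alpha> t) \<le> 2)"
      using q h e0 el by (intro bexI[of _ h] exI[of _ ?l] exI[of _ "step_path \<eta>"] conjI) auto
  qed
qed

text \<open>Either some element of \<open>H\<close> moves the end of the backward limit \<open>b\<close>, and paths can turn, or all of them
  fix it, and the group lies near \<open>H\<close>.\<close>

lemma limit_set_of_normal_subgroup:
  assumes ltg: "morse_local_to_global_space X" and H: "H \<lhd> G" "infinite H"
  shows "limit_set G A H = topspace (cayley_boundary G A)"
proof
  show "limit_set G A H \<subseteq> topspace (cayley_boundary G A)" by (auto simp: limit_set_def)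
  show "topspace (cayley_boundary G A) \<subseteq> limit_set G A H"
  proof
    fix z assume "z \<in> topspace (cayley_boundary G A)"
    then obtain \<alpha> where \<alpha>': "\<alpha> \<in> morse_rays X e" "z = asymptotic X e `` {\<alpha>}"
      by (auto simp: morse_boundary_set_def elim: quotientE)
    then obtain M where gM: "morse_gauge M" and \<alpha>: "\<alpha> \<in> morse_rays_of_gauge X e M" by (auto simp: morse_rays_def)
    have Hc: "H \<subseteq> carrier G" using H(1) by (simp add: normal_def subgroup.subset)
    obtain f where f: "rough_geodesic UNIV f" "f 0 = \<one>"
      and f\<alpha>: "\<And>t. t \<ge> 0 \<Longrightarrow> mdist X (step_path f t) (\<alpha> t) \<le> 2"
      and fM: "morse X (transported_gauge 1 0 1 4 1 0 2 M) {0..} (step_path f)"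
      by (rule discretise_morse_ray[OF gM \<alpha>]) blast
    define M\<^sub>1 where "M\<^sub>1 = transported_gauge 1 0 1 4 1 0 2 M"
    define M\<^sub>2 where "M\<^sub>2 = window_gauge M\<^sub>1"
    have M1: "morse_gauge M\<^sub>1" unfolding M\<^sub>1_def by (rule morse_gauge_transported[OF gM]) auto
    have M2: "morse_gauge M\<^sub>2" unfolding M\<^sub>2_def by (rule morse_gauge_transported[OF M1]) auto
    have fM1: "morse X M\<^sub>1 {0..} (step_path f)" using fM by (simp add: M\<^sub>1_def)
    obtain b \<kappa> where b: "rough_geodesic UNIV b" "b 0 = \<one>" "morse X M\<^sub>2 {0..} (step_path b)"
      and \<kappa>: "\<And>n. n \<le> \<kappa> n" "\<And>n m. m \<le> n \<Longrightarrow> b m = inv (f (\<kappa> n)) \<otimes> f (\<kappa> n - m)"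
      unfolding M\<^sub>2_def by (rule backward_limit[OF f(1) fM1 M1]) blast
    interpret morse_ray_translates G A b "window_gauge M\<^sub>2"
    proof unfold_locales
      show "morse_gauge (window_gauge M\<^sub>2)" by (rule morse_gauge_transported[OF M2]) auto
      show "morse X (window_gauge M\<^sub>2) {0..} (step_path (\<lambda>n. g \<otimes> b n))" if "g \<in> carrier G" for g
        by (rule translated_rough_geodesic(2)[OF b(1,3) M2 that])
    qed (rule b(1))
    show "z \<in> limit_set G A H"
    proof (cases "\<forall>x\<in>H. \<exists>\<tau>. shifts close x \<tau>")
      case True
      then obtain C where "\<And>g. g \<in> carrier G \<Longrightarrow> \<exists>h\<in>H. gd g h \<le> C"
        using group_near_fixing_normal_subgroup[OF H] by blast
      from in_limit_set_if_group_near[OF Hc this gM \<alpha>] show ?thesis unfolding \<alpha>'(2) .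
    next
      case False
      then obtain x where x: "x \<in> H" "\<nexists>\<tau>. shifts close x \<tau>" by blast
      have xc: "x \<in> carrier G" using x Hc by blast
      obtain K where "divergent K \<one> x" using shifts_or_divergent[of \<one> x] x(2) xc by auto
      then obtain c M' where \<Lambda>: "c \<ge> 4" "morse_gauge M'" "quasi_geodesic X 1 c UNIV (turn x)" "morse X M' UNIV (turn x)"
        using turn_morse[OF xc] by blast
      have "turn x (- real m) = vertex (b m)" for m
        by (simp add: turn_def)
      moreover have "turn x (real m) = vertex (x \<otimes> b m)" if "m > 0" for m
        using that by (simp add: turn_def)
      ultimately show ?thesis
        unfolding \<alpha>'(2)
        by (intro in_limit_set_if_turn[OF ltg H(1) x(1) gM \<alpha> f fM1 M1 f\<alpha> \<kappa> \<Lambda>(3,4,2,1)])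
    qed
  qed
qed

end

theorem theorem7:
  fixes G :: "('g, 'm) monoid_scheme" and A :: "'g set"
  assumes "morse_local_to_global_group G"
    and "finite_generating_set G A"
  shows "cayley_boundary G A closure_of
           {attracting_point G A g | g. morse_element G g \<and> infinite (generate G {g})}
         = topspace (cayley_boundary G A) \<and>
         (\<forall>H. H \<lhd> G \<and> infinite H \<longrightarrow> limit_set G A H = topspace (cayley_boundary G A))"
proof -
  interpret cayley G A
    using assms by (simp add: cayley_def cayley_axioms_def morse_local_to_global_group_def)
  have "morse_local_to_global_space (cayley_graph G A)" by (rule local_to_global_X[OF assms(1)])
  then show ?thesis using attracting_points_dense limit_set_of_normal_subgroup by blast
qed

end
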